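(* Let $n\ge 1$. There are constants $C>0$ and $0<\varepsilon<\sqrt{2}$ such that $$|K_{\psi}(z,w)|^2 \leq C\, \frac{e^{\psi(z)}e^{\psi(w)}}{(1-|z|^2)^{2n+1} (1-|w|^2)^{2n+1}}\, e^{-\varepsilon d_\psi(z, w)} \quad \text{for all } z, w \in \mathbf{B}_n .$$
   Context: $\langle z,w\rangle=\sum_{j=1}^n z_j\bar w_j$ and $|z|=\langle z,z\rangle^{1/2}$ on $\mathbf{C}^n$; $\mathbf{B}_n=\{z\in\mathbf{C}^n:|z|<1\}$; $dV$ is Lebesgue measure on $\mathbf{C}^n$. Put $\psi(z)=\frac{1}{1-|z|^2}$ for $z\in\mathbf{B}_n$. The weighted Bergman space $A^2_\psi(\mathbf{B}_n)$ is the Hilbert space of all holomorphic $f:\mathbf{B}_n\to\mathbf{C}$ with $\int_{\mathbf{B}_n}|f|^2e^{-\psi}\,dV<\infty$, with inner product $\langle f,g\rangle_\psi=\int_{\mathbf{B}_n}f\bar g\,e^{-\psi}\,dV$. Point evaluations are bounded on it, so for each $z\in\mathbf{B}_n$ there is a unique $K_z\in A^2_\psi(\mathbf{B}_n)$ with $f(z)=\langle f,K_z\rangle_\psi$ for all $f\in A^2_\psi(\mathbf{B}_n)$. The Bergman kernel is $K_\psi(z,w)=\overline{K_z(w)}$. The complex Hessian of $\psi$ defines a Hermitian metric $h_\psi$ on $\mathbf{B}_n$: for $\xi\in\mathbf{C}^n$ at the point $z$, $|\xi|_{h_\psi}^2=\frac{2|\langle\xi,z\rangle|^2}{(1-|z|^2)^3}+\frac{|\xi|^2}{(1-|z|^2)^2}$.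 For a piecewise $C^1$ curve $\gamma:[0,1]\to\mathbf{B}_n$ its length is $\ell_\psi(\gamma)=\int_0^1|\gamma'(t)|_{h_\psi}\,dt$ (the norm taken at $\gamma(t)$), and $d_\psi(z,w)$ is the infimum of $\ell_\psi(\gamma)$ over all piecewise $C^1$ curves $\gamma$ in $\mathbf{B}_n$ from $z$ to $w$. *)

theory Defs
  imports "HOL-Analysis.Analysis"
begin

text \<open>Points of \<open>\<complex>\<^sup>n\<close> have type \<open>complex ^ 'n\<close> with \<open>n = CARD('n)\<close>. The unit ball is
  \<open>ball 0 1\<close> for the library norm, which by \<open>cinner_self\<close> below is \<open>\<langle>z,z\<rangle>\<^sup>1\<^sup>/\<^sup>2\<close>.\<close>

definition cinner :: "complex ^ 'n \<Rightarrow> complex ^ 'n \<Rightarrow> complex" where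
  "cinner z w = (\<Sum>j\<in>UNIV. z $ j * cnj (w $ j))"

lemma cinner_self: "cinner z z = complex_of_real ((norm z)\<^sup>2)"
  by (simp add: cinner_def norm_vec_def L2_set_def sum_nonneg flip: complex_norm_square)

definition psi :: "complex ^ 'n \<Rightarrow> real" where
  "psi z = 1 / (1 - (norm z)\<^sup>2)"

definition holomorphic_Cn_on :: "(complex ^ 'n \<Rightarrow> complex) \<Rightarrow> (complex ^ 'n) set \<Rightarrow> bool" where
  "holomorphic_Cn_on f U \<longleftrightarrow>
    (\<forall>z\<in>U. \<exists>f'. (f has_derivative f') (at z) \<and> (\<forall>c v. f' (c *s v) = c * f' v))"

text \<open>A function on the ball is represented by its extension by \<open>0\<close> to the whole type, so that
  equality of representatives is equality on the ball.\<close>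

definition bergman_space :: "(complex ^ 'n \<Rightarrow> complex) set" where
  "bergman_space = {f. holomorphic_Cn_on f (ball 0 1) \<and> (\<forall>z. z \<notin> ball 0 1 \<longrightarrow> f z = 0) \<and>
    set_integrable lborel (ball 0 1) (\<lambda>z. (cmod (f z))\<^sup>2 * exp (- psi z))}"

definition bergman_inner ::
    "(complex ^ 'n \<Rightarrow> complex) \<Rightarrow> (complex ^ 'n \<Rightarrow> complex) \<Rightarrow> complex" where
  "bergman_inner f g =
    (LINT z:ball 0 1|lborel. f z * cnj (g z) * complex_of_real (exp (- psi z)))"

definition point_eval_rep :: "complex ^ 'n \<Rightarrow> complex ^ 'n \<Rightarrow> complex" where
  "point_eval_rep z =
    (THE k. k \<in> bergman_space \<and> (\<forall>f\<in>bergman_space. f z = bergman_inner f k))"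

definition bergman_kernel :: "complex ^ 'n \<Rightarrow> complex ^ 'n \<Rightarrow> complex" where
  "bergman_kernel z w = cnj (point_eval_rep z w)"

text \<open>The norm of the tangent vector \<open>\<xi>\<close> at \<open>z\<close> in the metric given by the complex Hessian
  \<open>\<partial>\<^sup>2\<psi> / \<partial>z\<^sub>j \<partial>(cnj z\<^sub>k) = 2 cnj z\<^sub>j z\<^sub>k / (1 - |z|\<^sup>2)\<^sup>3 + \<delta>\<^sub>j\<^sub>k / (1 - |z|\<^sup>2)\<^sup>2\<close>.\<close>

definition h_norm :: "complex ^ 'n \<Rightarrow> complex ^ 'n \<Rightarrow> real" where
  "h_norm z \<xi> = sqrt (2 * (cmod (cinner \<xi> z))\<^sup>2 / (1 - (norm z)\<^sup>2) ^ 3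
                     + (norm \<xi>)\<^sup>2 / (1 - (norm z)\<^sup>2)\<^sup>2)"

text \<open>Each piece is \<open>C\<^sup>1\<close> on its closed interval, with one-sided derivatives at the ends. The
  library's \<open>piecewise_C1_differentiable_on\<close> lets the derivative blow up at a break point; the
  length integral could then diverge and take the default value \<open>0\<close>.\<close>

definition piecewise_C1_curve :: "(real \<Rightarrow> complex ^ 'n) \<Rightarrow> bool" where
  "piecewise_C1_curve \<gamma> \<longleftrightarrow>
    (\<exists>(k::nat) t. t 0 = 0 \<and> t k = 1 \<and>
      (\<forall>i<k. t i < t (Suc i) \<and>
        (\<exists>D. continuous_on {t i..t (Suc i)} D \<and>
          (\<forall>s\<in>{t i..t (Suc i)}.
            (\<gamma> has_vector_derivative D s) (at s within {t i..t (Suc i)})))))"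

text \<open>At the end points and the finitely many break points \<open>vector_derivative\<close> may be
  unspecified; this does not affect the integral.\<close>

definition h_length :: "(real \<Rightarrow> complex ^ 'n) \<Rightarrow> real" where
  "h_length \<gamma> = integral {0..1} (\<lambda>t. h_norm (\<gamma> t) (vector_derivative \<gamma> (at t)))"

definition d_psi :: "complex ^ 'n \<Rightarrow> complex ^ 'n \<Rightarrow> real" where
  "d_psi z w = Inf {h_length \<gamma> |\<gamma>. piecewise_C1_curve \<gamma> \<and> \<gamma> ` {0..1} \<subseteq> ball 0 1 \<and>
                                  \<gamma> 0 = z \<and> \<gamma> 1 = w}"

end

theory Submission
  imports Defs "HOL-Probability.Probability" "HOL-Complex_Analysis.Complex_Analysis"
begin

text \<open>The weight is radial, so the kernel is \<open>F \<langle>z,w\<rangle>\<close> with \<open>F t = \<Sum>\<^sub>k t\<^sup>k / m\<^sub>k\<close>, where \<open>m\<^sub>k\<close> is the weighted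
  \<open>L\<^sup>2\<close> norm squared of the \<open>k\<close>-th power of a unit linear form. Writing \<open>e\<^sup>-\<^sup>\<psi>\<close> as a superposition of
  indicators of balls gives \<open>1 / m\<^sub>k\<close> as an explicit polynomial divided by
  \<open>\<integral> exp (- \<tau>) (1 - 1/\<tau>)\<^bsup>k+n\<^esup> d\<tau>\<close>, which is analytic in \<open>k\<close> and, by a variance bound, has no zero for
  \<open>|Im k| \<le> c (Re k)\<^bsup>3/4\<^esup>\<close>. Put \<open>t = (1 - s) e\<^bsup>i\<theta>\<^esup>\<close>. Moving the contour of summation to
  height \<open>c s\<^bsup>-3/2\<^esup>\<close> bounds \<open>|F t|\<close> by \<open>s\<^bsup>-2n-1\<^esup> e\<^bsup>1/s\<^esup>\<close> times
  \<open>exp (- min (c |\<theta>| s\<^bsup>-3/2\<^esup>) (c'/s))\<close>. On the other side, \<open>d\<^sub>\<psi>\<close> is bounded above by the length of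
  the segment from \<open>z\<close> to \<open>w\<close> when the two points are close, and by that of the radial path through
  \<open>0\<close> otherwise; in both cases a small multiple of it is absorbed by
  \<open>\<psi> z + \<psi> w - 2/s\<close> and the gain from the contour shift.\<close>

section \<open>Invariance of Lebesgue measure under orthogonal maps\<close>

text \<open>At \<open>|t| = 1 - s\<close> the terms of the series have size about
  \<open>k^(n - 1/4) exp (2 sqrt k - s k)\<close>: a peak near \<open>k = s^(-2)\<close> of width
  \<open>s^(-3/2)\<close>, and height times width explains the power \<open>2n + 1\<close>. Write
  \<open>s = 1 - |<z,w>|\<close>, \<open>a = 1 - |z|^2\<close>, \<open>b = 1 - |w|^2\<close>. Since
  \<open>a + b <= 2 s\<close>, the gap \<open>1/a + 1/b - 2/s\<close> is nonnegative, and it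
  controls every displacement except a common change of phase. Absolute values in the series thus
  already give decay transversally to the rotations. The obstacle is
  \<open>w = e^(i \<theta>) z\<close>: there the gap vanishes, while for small \<theta> the length
  of the rotation has order \<open>|\<theta>| s^(-3/2)\<close>. Decay has to come from cancellation
  of the phases \<open>e^(i k \<theta>)\<close> among the roughly \<open>s^(-3/2)\<close> terms of
  the peak. Hence the coefficients are continued to complex \<open>k\<close>, and a zero-free region
  of height \<open>(Re k)^(3/4)\<close> is the right one, being \<open>s^(-3/2)\<close> at the peak.
  The minimum in the exponent appears because the terms below the peak, where the contour cannot be
  moved that far, are only known to be smaller by a factor \<open>exp (-c'/s)\<close>.\<close>

lemma nn_integral_lborel_translate:
  fixes f :: "'a::euclidean_space \<Rightarrow> ennreal"
  assumes [measurable]: "f \<in> borel_measurable borel"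
  shows "(\<integral>\<^sup>+x. f (a + x) \<partial>lborel) = (\<integral>\<^sup>+x. f x \<partial>lborel)"
proof -
  have "(\<integral>\<^sup>+x. f x \<partial>lborel) = (\<integral>\<^sup>+x. f x \<partial>(distr lborel borel ((+) a)))"
    by (simp add: lborel_distr_plus)
  also have "\<dots> = (\<integral>\<^sup>+x. f (a + x) \<partial>lborel)"
    by (subst nn_integral_distr) auto
  finally show ?thesis ..
qed

text \<open>Smearing by the indicator \<open>g\<close> of a ball replaces any determinant: after the
  translation \<open>y = T x + u\<close> the inner integral runs over \<open>g (y - T x)\<close>,
  and since \<open>T\<close> is an isometry this is, as a function of \<open>x\<close>, the
  indicator of a ball of the same radius around \<open>S y\<close>. Both sides therefore acquire the
  same factor \<open>c\<close>.\<close>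

lemma nn_integral_lborel_orthogonal:
  fixes T :: "'a::euclidean_space \<Rightarrow> 'a"
  assumes T: "orthogonal_transformation T" and [measurable]: "f \<in> borel_measurable borel"
  shows "(\<integral>\<^sup>+x. f (T x) \<partial>lborel) = (\<integral>\<^sup>+x. f x \<partial>lborel)"
proof -
  define S where "S = inv T"
  have linT: "linear T"
    using T orthogonal_transformation_linear by blast
  have TS: "T (S x) = x" for x
    unfolding S_def by (meson T orthogonal_transformation_surj surj_f_inv_f)
  have linS: "linear S"
    unfolding S_def using T orthogonal_transformation_inv orthogonal_transformation_linear by blast
  have [measurable]: "T \<in> borel_measurable borel" "S \<in> borel_measurable borel"
    using linT linS by (auto intro!: borel_measurable_continuous_onI linear_continuous_on simp: linear_conv_bounded_linear)
  define B where "B = ball (0::'a) 1"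
  define g where "g = (indicator B :: 'a \<Rightarrow> ennreal)"
  have [measurable]: "g \<in> borel_measurable borel" unfolding g_def B_def by (intro borel_measurable_indicator) simp
  define c where "c = emeasure lborel B"
  \<comment> \<open>Cancelling \<open>c\<close> in \<open>ennreal\<close> at the end requires both
    facts.\<close>
  have c0: "c \<noteq> 0" "c \<noteq> \<infinity>"
    using content_ball_pos[of 1 "0::'a"] emeasure_lborel_ball_finite[of "0::'a" 1]
    by (auto simp: c_def B_def emeasure_eq_measure2 measure_def)
  have gc: "(\<integral>\<^sup>+u. g u \<partial>lborel) = c" by (simp add: g_def c_def B_def)
  have tr: "(\<integral>\<^sup>+x. f (T x + u) \<partial>lborel) = (\<integral>\<^sup>+x. f (T x) \<partial>lborel)" for u
  proof -
    have "T (S u + x) = T x + u" for x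
      by (simp add: linear_add[OF linT] TS)
    then show ?thesis by (subst nn_integral_lborel_translate[of "\<lambda>x. f (T x)" "S u", symmetric]) auto
  qed
  have "c * (\<integral>\<^sup>+x. f (T x) \<partial>lborel) = (\<integral>\<^sup>+u. g u * (\<integral>\<^sup>+x. f (T x) \<partial>lborel) \<partial>lborel)"
    by (simp add: nn_integral_multc gc)
  also have "\<dots> = (\<integral>\<^sup>+u. (\<integral>\<^sup>+x. g u * f (T x + u) \<partial>lborel) \<partial>lborel)"
    by (simp add: nn_integral_cmult tr)
  also have "\<dots> = (\<integral>\<^sup>+x. (\<integral>\<^sup>+u. g u * f (T x + u) \<partial>lborel) \<partial>lborel)"
    by (intro lborel_pair.Fubini') measurable
  also have "\<dots> = (\<integral>\<^sup>+x. (\<integral>\<^sup>+y. g (y - T x) * f y \<partial>lborel) \<partial>lborel)"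
  proof (rule nn_integral_cong)
    fix x
    show "(\<integral>\<^sup>+u. g u * f (T x + u) \<partial>lborel) = (\<integral>\<^sup>+y. g (y - T x) * f y \<partial>lborel)"
      by (subst nn_integral_lborel_translate[of "\<lambda>y. g (y - T x) * f y" "T x", symmetric]) auto
  qed
  also have "\<dots> = (\<integral>\<^sup>+y. (\<integral>\<^sup>+x. g (y - T x) * f y \<partial>lborel) \<partial>lborel)"
    by (intro lborel_pair.Fubini') measurable
  also have "\<dots> = (\<integral>\<^sup>+y. c * f y \<partial>lborel)"
  proof (rule nn_integral_cong)
    fix y
    have "norm (y - T x) = norm (x - S y)" for x
    proof -
      have "norm (y - T x) = norm (T (S y - x))" by (simp add: linear_diff[OF linT] TS)
      also have "\<dots> = norm (S y - x)" using T orthogonal_transformation_norm by blast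
      finally show ?thesis by (simp add: norm_minus_commute)
    qed
    then have "g (y - T x) = g (- S y + x)" for x by (simp add: g_def B_def indicator_def)
    then have "(\<integral>\<^sup>+x. g (y - T x) \<partial>lborel) = c"
      by (simp only: nn_integral_lborel_translate[of g "- S y"] gc \<open>g \<in> borel_measurable borel\<close>)
    then show "(\<integral>\<^sup>+x. g (y - T x) * f y \<partial>lborel) = c * f y"
      by (simp add: nn_integral_multc)
  qed
  also have "\<dots> = c * (\<integral>\<^sup>+y. f y \<partial>lborel)" by (simp add: nn_integral_cmult)
  finally show ?thesis using c0 by (simp add: ennreal_mult_cancel_left)
qed

lemma distr_lborel_orthogonal:
  fixes T :: "'a::euclidean_space \<Rightarrow> 'a"
  assumes T: "orthogonal_transformation T"
  shows "distr lborel borel T = lborel"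
proof (rule measure_eqI)
  have [measurable]: "T \<in> borel_measurable borel"
    using orthogonal_transformation_linear[OF T]
    by (auto intro!: borel_measurable_continuous_onI linear_continuous_on simp: linear_conv_bounded_linear)
  fix A :: "'a set" assume "A \<in> sets (distr lborel borel T)"
  then have [measurable]: "A \<in> sets borel" by simp
  have "emeasure (distr lborel borel T) A = (\<integral>\<^sup>+x. indicator A x \<partial>distr lborel borel T)"
    by simp
  also have "\<dots> = (\<integral>\<^sup>+x. indicator A (T x) \<partial>lborel)"
    by (subst nn_integral_distr) auto
  also have "\<dots> = emeasure lborel A"
    by (subst nn_integral_lborel_orthogonal[OF T]) auto
  finally show "emeasure (distr lborel borel T) A = emeasure lborel A" .
qed simp

section \<open>The Hermitian inner product\<close>

lemma cinner_add_left: "cinner (x + y) z = cinner x z + cinner y z"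
  by (simp add: cinner_def ring_distribs sum.distrib)

lemma cinner_add_right: "cinner z (x + y) = cinner z x + cinner z y"
  by (simp add: cinner_def ring_distribs sum.distrib)

lemma cinner_diff_left: "cinner (x - y) z = cinner x z - cinner y z"
  by (simp add: cinner_def ring_distribs sum_subtractf)

lemma cinner_diff_right: "cinner z (x - y) = cinner z x - cinner z y"
  by (simp add: cinner_def ring_distribs sum_subtractf)

lemma cinner_mult_left [simp]: "cinner (c *s x) z = c * cinner x z"
  by (simp add: cinner_def sum_distrib_left mult_ac)

lemma cinner_mult_right [simp]: "cinner z (c *s x) = cnj c * cinner z x"
  by (simp add: cinner_def sum_distrib_left mult_ac)

lemma cnj_cinner: "cnj (cinner x y) = cinner y x"
  by (simp add: cinner_def mult.commute)

lemma vec_scaleR_eq_cscale: "r *\<^sub>R (x :: complex ^ 'n) = complex_of_real r *s x"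
  unfolding vec_eq_iff vector_scaleR_component vector_smult_component
  by (simp add: scaleR_conv_of_real)

lemma Re_cinner: "Re (cinner x y) = x \<bullet> y"
  by (simp add: cinner_def inner_vec_def inner_complex_def)

lemma norm_cscale: "norm (c *s (x :: complex ^ 'n)) = cmod c * norm x"
  by (simp add: norm_vec_def norm_mult L2_set_right_distrib)

text \<open>Multiplying \<open>x\<close> by a unit scalar makes the inner product real and
  nonnegative, which reduces the claim to the real Cauchy-Schwarz inequality.\<close>

lemma norm_cinner_le: "cmod (cinner x y) \<le> norm x * norm y"
proof (cases "cinner x y = 0")
  case False
  define c where "c = cnj (sgn (cinner x y))"
  have c: "cmod c = 1" using False by (simp add: c_def norm_sgn)
  have "complex_of_real (cmod (cinner x y)) = cinner (c *s x) y"
    using False by (simp add: c_def sgn_div_norm field_simps scaleR_conv_of_real complex_norm_square power2_eq_square mult.commute)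
      (metis complex_norm_square power2_eq_square mult.commute of_real_mult)
  then have "cmod (cinner x y) = (c *s x) \<bullet> y"
    by (metis Re_cinner Re_complex_of_real)
  also have "\<dots> \<le> norm (c *s x) * norm y" by (rule norm_cauchy_schwarz)
  finally show ?thesis by (simp add: norm_cscale c)
qed simp

lemma bounded_linear_cinner_left: "bounded_linear (\<lambda>x. cinner x y)"
  by (rule bounded_linear_intro[where K = "norm y"])
     (simp_all add: cinner_add_left vec_scaleR_eq_cscale norm_cinner_le scaleR_conv_of_real)

lemma continuous_on_cinner [continuous_intros]:
  assumes "continuous_on A f" "continuous_on A g"
  shows "continuous_on A (\<lambda>x. cinner (f x) (g x))"
  unfolding cinner_def using assms by (intro continuous_intros) 

lemma continuous_on_cscale [continuous_intros]:
  assumes "continuous_on A f" "continuous_on A g"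
  shows "continuous_on A (\<lambda>x. f x *s (g x :: complex ^ 'n))"
  unfolding vector_scalar_mult_def using assms by (intro continuous_on_vec_lambda continuous_intros)

lemma borel_measurable_cinner [measurable]: "(\<lambda>x. cinner x y) \<in> borel_measurable borel"
  "(\<lambda>y. cinner x y) \<in> borel_measurable borel"
  by (intro borel_measurable_continuous_onI continuous_intros)+

lemma norm_add_sq_cinner:
  "(norm (x + y :: complex ^ 'n))\<^sup>2 = (norm x)\<^sup>2 + (norm y)\<^sup>2 + 2 * Re (cinner x y)"
  by (simp add: Re_cinner power2_norm_eq_inner inner_add_left inner_add_right inner_commute)

lemma norm_diff_sq_cinner:
  "(norm (x - y :: complex ^ 'n))\<^sup>2 = (norm x)\<^sup>2 + (norm y)\<^sup>2 - 2 * Re (cinner x y)"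
  by (simp add: Re_cinner power2_norm_eq_inner inner_diff_left inner_diff_right inner_commute)

section \<open>Upper bounds for the distance\<close>

lemma h_norm_nonneg: "x \<in> ball 0 1 \<Longrightarrow> 0 \<le> h_norm x \<xi>"
  by (auto simp: h_norm_def abs_square_less_1 less_imp_le intro!: add_nonneg_nonneg divide_nonneg_nonneg)

text \<open>If the speed is not integrable, the length has the default value 0, so the bound holds
  in that case too.\<close>

lemma h_length_nonneg:
  assumes "\<gamma> ` {0..1} \<subseteq> ball 0 1"
  shows "0 \<le> h_length \<gamma>"
proof (cases "(\<lambda>t. h_norm (\<gamma> t) (vector_derivative \<gamma> (at t))) integrable_on {0..1}")
  case True
  then show ?thesis unfolding h_length_def
    using assms by (intro integral_nonneg) (auto intro!: h_norm_nonneg)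
next
  case False
  then show ?thesis by (simp add: h_length_def not_integrable_integral)
qed

lemma d_psi_le:
  assumes "piecewise_C1_curve \<gamma>" "\<gamma> ` {0..1} \<subseteq> ball 0 1" "\<gamma> 0 = z" "\<gamma> 1 = w"
  shows "d_psi z w \<le> h_length \<gamma>"
  unfolding d_psi_def
proof (rule cInf_lower)
  show "bdd_below {h_length \<gamma> |\<gamma>. piecewise_C1_curve \<gamma> \<and> \<gamma> ` {0..1} \<subseteq> ball 0 1 \<and> \<gamma> 0 = z \<and> \<gamma> 1 = w}"
    by (rule bdd_belowI[of _ 0]) (auto intro: h_length_nonneg)
qed (use assms in auto)

text \<open>Comparison with an integrable majorant \<open>g\<close> of the speed away from finitely
  many break points. The speed itself need not be shown integrable: otherwise the length is 0, and
  \<open>I\<close> is nonnegative.\<close>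

lemma h_length_le:
  assumes "finite S" "(g has_integral I) {0..1}" "\<And>t. t \<in> {0..1} \<Longrightarrow> 0 \<le> g t"
    and D: "\<And>t. t \<in> {0..1} - S \<Longrightarrow> (\<gamma> has_vector_derivative D t) (at t)"
    and le: "\<And>t. t \<in> {0..1} - S \<Longrightarrow> h_norm (\<gamma> t) (D t) \<le> g t"
  shows "h_length \<gamma> \<le> I"
proof (cases "(\<lambda>t. h_norm (\<gamma> t) (vector_derivative \<gamma> (at t))) integrable_on {0..1}")
  case True
  let ?f = "\<lambda>t. h_norm (\<gamma> t) (vector_derivative \<gamma> (at t))"
  let ?f' = "\<lambda>t. if t \<in> S then 0 else ?f t"
  have "(?f has_integral h_length \<gamma>) {0..1}"
    using True unfolding h_length_def by (rule integrable_integral)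
  then have "(?f' has_integral h_length \<gamma>) {0..1}"
    by (rule has_integral_spike[OF negligible_finite[OF \<open>finite S\<close>], rotated]) auto
  then show ?thesis
    by (rule has_integral_le[OF _ assms(2)])
       (use assms(3) D le in \<open>force simp: vector_derivative_at\<close>)
next
  case False
  have "0 \<le> I" using assms(2,3) by (rule has_integral_nonneg)
  then show ?thesis using False by (simp add: h_length_def not_integrable_integral)
qed

lemma d_psi_segment:
  assumes z: "z \<in> ball 0 1" and w: "w \<in> ball 0 1"
    and le: "\<And>t. 0 \<le> t \<Longrightarrow> t \<le> 1 \<Longrightarrow> h_norm ((1 - t) *\<^sub>R z + t *\<^sub>R w) (w - z) \<le> K"
  shows "d_psi z w \<le> K"
proof -
  define \<gamma> where "\<gamma> = (\<lambda>t. (1 - t) *\<^sub>R z + t *\<^sub>R w)"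
  have D: "(\<gamma> has_vector_derivative (w - z)) (at t within A)" for t A
    unfolding \<gamma>_def by (auto intro!: derivative_eq_intros)
  have "piecewise_C1_curve \<gamma>" unfolding piecewise_C1_curve_def
    by (rule exI[of _ 1], rule exI[of _ real]) (auto intro!: exI[of _ "\<lambda>_. w - z"] D)
  moreover have sub: "\<gamma> ` {0..1} \<subseteq> ball 0 1"
    using convexD_alt[OF convex_ball z w] by (auto simp: \<gamma>_def)
  ultimately have "d_psi z w \<le> h_length \<gamma>"
    by (intro d_psi_le) (auto simp: \<gamma>_def)
  also have "0 \<le> K"
    using le[of 0] h_norm_nonneg[OF z] by (fastforce intro: order_trans)
  then have "h_length \<gamma> \<le> K"
    using has_integral_const_real[of K 0 1]
    by (intro h_length_le[where S="{}" and g="\<lambda>_. K" and D="\<lambda>_. w - z"]) (use D le in \<open>auto simp: \<gamma>_def[THEN fun_cong]\<close>)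
  finally show ?thesis .
qed

text \<open>Replacing \<open>1 - |c z|^2\<close> by the smaller \<open>u = 1 - c |z|\<close> costs
  only a constant and leaves a bound with an elementary antiderivative. The value 2 of
  \<open>|d|\<close> is the speed of a path that covers each radius in half of the unit
  interval.\<close>

lemma h_norm_radial:
  assumes "norm z < 1" "0 \<le> c" "c \<le> 1" "\<bar>d\<bar> = 2"
  shows "h_norm (c *\<^sub>R z) (d *\<^sub>R z) \<le> 4 * norm z / (1 - c * norm z) powr (3/2)"
proof -
  define r where "r = norm z"
  have r: "0 \<le> r" "r < 1" using assms by (auto simp: r_def)
  have cr: "0 \<le> c * r" "c * r < 1"
    using r assms by (auto intro: le_less_trans[OF mult_left_le_one_le])
  define u where "u = 1 - c * r"
  have u: "0 < u" "u \<le> 1" using cr by (auto simp: u_def)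
  have d: "d\<^sup>2 = 4" using \<open>\<bar>d\<bar> = 2\<close> by (metis power2_abs four_x_squared mult.right_neutral one_power2)
  have v: "u \<le> 1 - (norm (c *\<^sub>R z))\<^sup>2"
  proof -
    have "(c * r)\<^sup>2 \<le> c * r" using cr by (simp add: power2_eq_square mult_left_le_one_le)
    then show ?thesis using assms by (simp add: u_def r_def)
  qed
  have ci: "cmod (cinner (d *\<^sub>R z) (c *\<^sub>R z)) = 2 * c * r\<^sup>2"
    using assms by (simp add: vec_scaleR_eq_cscale norm_mult cinner_self r_def norm_power)
  have "(h_norm (c *\<^sub>R z) (d *\<^sub>R z))\<^sup>2 =
      2 * (2 * c * r\<^sup>2)\<^sup>2 / (1 - (norm (c *\<^sub>R z))\<^sup>2) ^ 3 + 4 * r\<^sup>2 / (1 - (norm (c *\<^sub>R z))\<^sup>2)\<^sup>2"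
    unfolding h_norm_def ci using v u d by (simp add: r_def power_mult_distrib)
  also have "\<dots> \<le> 2 * (2 * r)\<^sup>2 / u ^ 3 + 4 * r\<^sup>2 / u ^ 3"
  proof (intro add_mono frac_le)
    show "2 * (2 * c * r\<^sup>2)\<^sup>2 \<le> 2 * (2 * r)\<^sup>2"
    proof -
      have "c * r\<^sup>2 \<le> 1 * r" using r assms by (intro order_trans[OF mult_right_mono[of c 1]])
         (auto simp: power2_eq_square mult_left_le_one_le)
      then have "(2 * c * r\<^sup>2)\<^sup>2 \<le> (2 * r)\<^sup>2" using r assms by (intro power_mono) auto
      then show ?thesis by simp
    qed
    show "u ^ 3 \<le> (1 - (norm (c *\<^sub>R z))\<^sup>2)\<^sup>2"
    proof -
      have "u ^ 3 \<le> u ^ 2" using u by (intro power_decreasing) auto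
      also have "\<dots> \<le> (1 - (norm (c *\<^sub>R z))\<^sup>2)\<^sup>2" using v u by (intro power_mono) auto
      finally show ?thesis .
    qed
  qed (use v u in \<open>auto intro!: power_mono\<close>)
  also have "\<dots> \<le> 16 * r\<^sup>2 / u ^ 3" using u by (simp add: field_simps)
  also have "\<dots> = (4 * r / u powr (3/2))\<^sup>2"
  proof -
    have "(u powr (3/2))\<^sup>2 = u powr 3" using u by (simp add: powr_power)
    also have "\<dots> = u ^ 3" using u by (simp add: powr_numeral)
    finally show ?thesis by (simp add: power_divide power_mult_distrib)
  qed
  finally show ?thesis
    unfolding u_def r_def[symmetric] by (rule power2_le_imp_le) (use r in auto)
qed

lemma has_vector_derivative_inverse_sqrt_affine:
  fixes c d k :: real
  assumes "0 < c + d * t"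
  shows "((\<lambda>t. k * (c + d * t) powr (-1/2)) has_vector_derivative
          - (k * d / 2) / (c + d * t) powr (3/2)) (at t within A)"
proof -
  have "((\<lambda>t. (c + d * t) powr (-1/2)) has_real_derivative
      (-1/2) * (c + d * t) powr (-1/2 - 1) * d) (at t within A)"
    by (rule DERIV_chain2[where f = "\<lambda>x. x powr (-1/2)" and g = "\<lambda>t. c + d * t", OF has_real_derivative_powr[OF assms]])
       (auto intro!: derivative_eq_intros)
  then have "((\<lambda>t. k * (c + d * t) powr (-1/2)) has_real_derivative
      k * ((-1/2) * (c + d * t) powr (-1/2 - 1) * d)) (at t within A)"
    by (rule DERIV_cmult)
  moreover have "k * ((-1/2) * (c + d * t) powr (-1/2 - 1) * d) = - (k * d / 2) / (c + d * t) powr (3/2)"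
    by (simp add: powr_minus_divide)
  ultimately show ?thesis
    unfolding has_real_derivative_iff_has_vector_derivative[symmetric] by metis
qed

text \<open>A speed of order \<open>(1 - r)^(-3/2)\<close> integrates to
  \<open>(1 - r)^(-1/2)\<close>, so the detour through the origin costs only square roots of
  \<open>psi z\<close> and \<open>psi w\<close>, far less than the exponents themselves near the
  sphere.\<close>

lemma d_psi_through_0:
  fixes z w :: "complex ^ 'n"
  assumes z: "z \<in> ball 0 1" and w: "w \<in> ball 0 1"
  shows "d_psi z w \<le> 6 / sqrt (1 - (norm z)\<^sup>2) + 6 / sqrt (1 - (norm w)\<^sup>2)"
proof -
  define \<gamma> :: "real \<Rightarrow> complex ^ 'n"
    where "\<gamma> = (\<lambda>t. if t \<le> 1/2 then (1 - 2*t) *\<^sub>R z else (2*t - 1) *\<^sub>R w)"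
  define D :: "real \<Rightarrow> complex ^ 'n" where "D = (\<lambda>t. if t \<le> 1/2 then (-2) *\<^sub>R z else 2 *\<^sub>R w)"
  have nz: "norm z < 1" "norm w < 1" using z w by auto
  have D1: "(\<gamma> has_vector_derivative (-2) *\<^sub>R z) (at t within {0..1/2})" if "t \<in> {0..1/2}" for t
  proof (rule has_vector_derivative_transform[OF that])
    show "((\<lambda>t. (1 - 2*t) *\<^sub>R z) has_vector_derivative (-2) *\<^sub>R z) (at t within {0..1/2})"
      by (auto intro!: derivative_eq_intros)
  qed (auto simp: \<gamma>_def)
  have D2: "(\<gamma> has_vector_derivative 2 *\<^sub>R w) (at t within {1/2..1})" if "t \<in> {1/2..1}" for t
  proof (rule has_vector_derivative_transform[OF that])
    show "((\<lambda>t. (2*t - 1) *\<^sub>R w) has_vector_derivative 2 *\<^sub>R w) (at t within {1/2..1})"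
      by (auto intro!: derivative_eq_intros)
    show "\<gamma> s = (2 * s - 1) *\<^sub>R w" if "s \<in> {1/2..1}" for s
    proof (cases "s = 1/2")
      case True
      show ?thesis unfolding \<gamma>_def True by simp
    qed (use that in \<open>auto simp: \<gamma>_def\<close>)
  qed
  have pc: "piecewise_C1_curve \<gamma>" unfolding piecewise_C1_curve_def
  proof (rule exI[of _ 2], rule exI[of _ "\<lambda>i::nat. real i / 2"], intro conjI allI impI)
    fix i :: nat assume "i < 2"
    then consider "i = 0" | "i = 1" by linarith
    then show "\<exists>D. continuous_on {real i / 2..real (Suc i) / 2} D \<and>
        (\<forall>s\<in>{real i / 2..real (Suc i) / 2}. (\<gamma> has_vector_derivative D s) (at s within {real i / 2..real (Suc i) / 2}))"
    proof cases
      case 1 then show ?thesis using D1 by (intro exI[of _ "\<lambda>_. (-2) *\<^sub>R z"]) auto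
    next
      case 2 then show ?thesis using D2 by (intro exI[of _ "\<lambda>_. 2 *\<^sub>R w"]) auto
    qed
  qed auto
  have sub: "\<gamma> ` {0..1} \<subseteq> ball 0 1"
  proof -
    have "c * norm v < 1" if "norm v < 1" "0 \<le> c" "c \<le> 1" for c and v :: "complex ^ 'n"
      using that by (auto intro: le_less_trans[OF mult_left_le_one_le])
    then show ?thesis using nz by (auto simp: \<gamma>_def)
  qed
  define g where "g = (\<lambda>t. if t \<le> 1/2 then 4 * norm z / (1 - (1 - 2*t) * norm z) powr (3/2)
                          else 4 * norm w / (1 - (2*t - 1) * norm w) powr (3/2))"
  have pos: "0 < 1 - c * norm v" if "norm v < 1" "0 \<le> c" "c \<le> 1" for c and v :: "complex ^ 'n"
    using that mult_left_le_one_le[of "norm v" c] by auto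
  have I1: "(g has_integral (- 4 / sqrt 1) - (- 4 / sqrt (1 - norm z))) {0..1/2}"
  proof -
    have "((\<lambda>t. 4 * norm z / (1 - (1 - 2*t) * norm z) powr (3/2)) has_integral
        4 * (- ((1 - (1 - 2*(1/2)) * norm z) powr (-1/2))) - 4 * (- ((1 - (1 - 2*0) * norm z) powr (-1/2)))) {0..1/2}"
    proof (rule fundamental_theorem_of_calculus)
      fix t :: real assume t: "t \<in> {0..1/2}"
      have p: "0 < 1 - (1 - 2*t) * norm z" using t nz by (intro pos) auto
      show "((\<lambda>t. 4 * (- ((1 - (1 - 2*t) * norm z) powr (-1/2)))) has_vector_derivative
          4 * norm z / (1 - (1 - 2*t) * norm z) powr (3/2)) (at t within {0..1/2})"
        using has_vector_derivative_inverse_sqrt_affine[of "1 - norm z" "2 * norm z" t "-4" "{0..1/2}"] p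
        by (simp add: algebra_simps)
    qed simp
    then have "((\<lambda>t. 4 * norm z / (1 - (1 - 2*t) * norm z) powr (3/2)) has_integral
        (- 4 / sqrt 1) - (- 4 / sqrt (1 - norm z))) {0..1/2}"
      using nz by (simp add: powr_minus_divide powr_half_sqrt)
    then show ?thesis by (rule has_integral_eq[rotated]) (auto simp: g_def)
  qed
  have I2: "(g has_integral (4 / sqrt (1 - norm w)) - (4 / sqrt 1)) {1/2..1}"
  proof -
    have "((\<lambda>t. 4 * norm w / (1 - (2*t - 1) * norm w) powr (3/2)) has_integral
        4 * (((1 - (2*1 - 1) * norm w) powr (-1/2))) - 4 * (((1 - (2*(1/2) - 1) * norm w) powr (-1/2)))) {1/2..1}"
    proof (rule fundamental_theorem_of_calculus)
      fix t :: real assume t: "t \<in> {1/2..1}"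
      have p: "0 < 1 - (2*t - 1) * norm w" using t nz by (intro pos) auto
      show "((\<lambda>t. 4 * (((1 - (2*t - 1) * norm w) powr (-1/2)))) has_vector_derivative
          4 * norm w / (1 - (2*t - 1) * norm w) powr (3/2)) (at t within {1/2..1})"
        using has_vector_derivative_inverse_sqrt_affine[of "1 + norm w" "-2 * norm w" t "4" "{1/2..1}"] p
        by (simp add: algebra_simps)
    qed simp
    then have "((\<lambda>t. 4 * norm w / (1 - (2*t - 1) * norm w) powr (3/2)) has_integral
        (4 / sqrt (1 - norm w)) - (4 / sqrt 1)) {1/2..1}"
      using nz by (simp add: powr_minus_divide powr_half_sqrt)
    then show ?thesis
      by (rule has_integral_spike[of "{1/2}", rotated 2]) (auto simp: g_def)
  qed
  have I: "(g has_integral ((- 4 / sqrt 1) - (- 4 / sqrt (1 - norm z)) + ((4 / sqrt (1 - norm w)) - (4 / sqrt 1)))) {0..1}"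
    by (rule has_integral_combine[OF _ _ I1 I2]) auto
  have hl: "h_length \<gamma> \<le> (- 4 / sqrt 1) - (- 4 / sqrt (1 - norm z)) + ((4 / sqrt (1 - norm w)) - (4 / sqrt 1))"
  proof (rule h_length_le[where S="{0,1/2,1}" and D=D, OF _ I])
    fix t :: real assume t: "t \<in> {0..1} - {0,1/2,1}"
    show "(\<gamma> has_vector_derivative D t) (at t)"
    proof (cases "t < 1/2")
      case True
      then show ?thesis using D1[of t] t at_within_Icc_at[of 0 t "1/2"] by (simp add: D_def)
    next
      case False
      then show ?thesis using D2[of t] t at_within_Icc_at[of "1/2" t 1] by (simp add: D_def)
    qed
    show "h_norm (\<gamma> t) (D t) \<le> g t"
    proof (cases "t \<le> 1/2")
      case True
      then show ?thesis using h_norm_radial[OF nz(1), of "1-2*t" "-2"] t by (simp add: \<gamma>_def D_def g_def)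
    next
      case False
      then show ?thesis using h_norm_radial[OF nz(2), of "2*t-1" "2"] t by (simp add: \<gamma>_def D_def g_def)
    qed
  qed (auto simp: g_def)
  \<comment> \<open>Passing from \<open>1 - r\<close> to \<open>1 - r^2\<close> costs a factor
    \<open>sqrt 2\<close>, and \<open>4 * sqrt 2 <= 6\<close>.\<close>
  have half: "4 / sqrt (1 - norm v) \<le> 6 / sqrt (1 - (norm v)\<^sup>2)" if "norm v < 1" for v :: "complex ^ 'n"
  proof -
    have p: "0 < 1 - norm v" "0 < 1 - (norm v)\<^sup>2" using that by (auto simp: abs_square_less_1)
    have "1 - (norm v)\<^sup>2 \<le> 2 * (1 - norm v)"
      using sum_power2_ge_zero[of "1 - norm v" 0] by (simp add: power2_eq_square algebra_simps)
    then have "(4 * sqrt (1 - (norm v)\<^sup>2))\<^sup>2 \<le> (6 * sqrt (1 - norm v))\<^sup>2"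
      using p by (simp add: power_mult_distrib)
    then have "4 * sqrt (1 - (norm v)\<^sup>2) \<le> 6 * sqrt (1 - norm v)"
      by (rule power2_le_imp_le) (use p in auto)
    then show ?thesis using p by (simp add: field_simps)
  qed
  have "d_psi z w \<le> h_length \<gamma>"
    by (rule d_psi_le[OF pc sub]) (auto simp: \<gamma>_def)
  then show ?thesis using hl half[OF nz(1)] half[OF nz(2)] by auto
qed

section \<open>Length of the segment between two nearby points\<close>

lemma h_norm_le:
  assumes "0 < m" "m \<le> 1 - (norm x)\<^sup>2" "cmod (cinner \<xi> x) \<le> c"
  shows "h_norm x \<xi> \<le> sqrt 2 * c / (m * sqrt m) + norm \<xi> / m"
proof -
  have c: "0 \<le> c" using assms(3) norm_ge_zero order_trans by blast
  have "h_norm x \<xi> \<le> sqrt (2 * c\<^sup>2 / m ^ 3 + (norm \<xi>)\<^sup>2 / m\<^sup>2)"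
    unfolding h_norm_def using assms c
    by (intro real_sqrt_le_mono add_mono frac_le power_mono mult_left_mono) auto
  also have "\<dots> \<le> sqrt (2 * c\<^sup>2 / m ^ 3) + sqrt ((norm \<xi>)\<^sup>2 / m\<^sup>2)"
    using assms c by (intro sqrt_add_le_add_sqrt) auto
  also have "\<dots> = sqrt 2 * c / (m * sqrt m) + norm \<xi> / m"
    using assms c by (simp add: real_sqrt_divide real_sqrt_mult power3_eq_cube)
  finally show ?thesis .
qed

lemma cmod_cis_minus_1_le: "cmod (cis \<theta> - 1) \<le> \<bar>\<theta>\<bar>"
proof -
  have "(cmod (cis \<theta> - 1))\<^sup>2 = (2 * \<bar>sin (\<theta>/2)\<bar>)\<^sup>2"
  proof -
    have "(cmod (cis \<theta> - 1))\<^sup>2 = (cos \<theta> - 1)\<^sup>2 + (sin \<theta>)\<^sup>2" by (simp add: cmod_power2)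
    also have "\<dots> = 2 - 2 * cos \<theta>"
      using sin_cos_squared_add[of \<theta>] by (simp add: power2_eq_square algebra_simps)
    also have "\<dots> = 4 * (sin (\<theta>/2))\<^sup>2" using cos_double_sin[of "\<theta>/2"] by simp
    finally show ?thesis by (simp add: power_mult_distrib)
  qed
  then have "cmod (cis \<theta> - 1) = 2 * \<bar>sin (\<theta>/2)\<bar>"
    by (rule power2_eq_imp_eq) auto
  then show ?thesis using abs_sin_x_le_abs_x[of "\<theta>/2"] by simp
qed

text \<open>The squared norm of \<open>z - cis \<theta> *s w\<close> is exactly
  \<open>2 * s - a - b\<close>; its nonnegativity is the first claim, and its root bounds the
  displacement up to the rotation. On the segment \<open>1 - |x|^2 >= m\<close> by convexity of the
  ball of radius \<open>sqrt (1 - m)\<close>. The costly weight \<open>m^(-3/2)\<close> falls only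
  on \<open><w - z, x>\<close>, a convex combination of the two endpoint values, each of which is up
  to sign \<open>(1 - s)\<close> times a phase minus \<open>1 - a\<close> or \<open>1 - b\<close>;
  the full displacement carries only \<open>1/m\<close>.\<close>

lemma d_psi_near:
  fixes z w :: "complex ^ 'n"
  assumes z: "z \<in> ball 0 1" and w: "w \<in> ball 0 1"
    and t: "cinner z w = of_real (1 - s) * cis \<theta>"
    and a: "a = 1 - (norm z)\<^sup>2" and b: "b = 1 - (norm w)\<^sup>2" and s: "0 \<le> s" "s \<le> 1"
    and m: "0 < m" "m \<le> a" "m \<le> b"
  shows "a + b \<le> 2 * s"
    "d_psi z w \<le> sqrt 2 * (\<bar>a - s\<bar> + \<bar>b - s\<bar> + 2 * \<bar>\<theta>\<bar>) / (m * sqrt m)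
       + (sqrt (2 * s - a - b) + \<bar>\<theta>\<bar>) / m"
proof -
  have "(norm (z - cis \<theta> *s w))\<^sup>2 = (norm z)\<^sup>2 + (norm w)\<^sup>2 - 2 * Re (cnj (cis \<theta>) * cinner z w)"
    by (simp add: norm_diff_sq_cinner norm_cscale)
  also have "cnj (cis \<theta>) * cinner z w = of_real (1 - s) * (cis \<theta> * cnj (cis \<theta>))"
    by (simp add: t)
  also have "cis \<theta> * cnj (cis \<theta>) = 1" by (simp add: cis_cnj cis_mult)
  finally have D: "(norm (z - cis \<theta> *s w))\<^sup>2 = 2 * s - a - b" by (simp add: a b)
  show ab: "a + b \<le> 2 * s" using D zero_le_power2[of "norm (z - cis \<theta> *s w)"] by linarith
  have D': "norm (z - cis \<theta> *s w) = sqrt (2 * s - a - b)"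
    using D by (metis norm_ge_zero real_sqrt_unique)
  have nw: "norm w < 1" "norm z < 1" using z w by auto
  have "norm (w - z) = norm (- (z - cis \<theta> *s w) - (cis \<theta> - 1) *s w)"
    by (simp add: vector_sub_rdistrib algebra_simps)
  also have "\<dots> \<le> sqrt (2 * s - a - b) + cmod (cis \<theta> - 1) * norm w"
    by (metis D' norm_cscale norm_minus_cancel norm_triangle_ineq4)
  also have "\<dots> \<le> sqrt (2 * s - a - b) + \<bar>\<theta>\<bar> * 1"
    using nw by (intro add_left_mono mult_mono cmod_cis_minus_1_le) auto
  finally have nxi: "norm (w - z) \<le> sqrt (2 * s - a - b) + \<bar>\<theta>\<bar>" by simp
  have tm: "cmod (of_real x * cis \<phi> - of_real y) \<le> \<bar>x - y\<bar> + \<bar>\<phi>\<bar>" if "0 \<le> x" "x \<le> 1" for x y \<phi>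
  proof -
    have "of_real x * cis \<phi> - of_real y = of_real x * (cis \<phi> - 1) + of_real (x - y)"
      by (simp add: algebra_simps)
    then have "cmod (of_real x * cis \<phi> - of_real y) \<le> cmod (of_real x * (cis \<phi> - 1)) + cmod (of_real (x - y))"
      by (metis norm_triangle_ineq)
    also have "\<dots> \<le> 1 * \<bar>\<phi>\<bar> + \<bar>x - y\<bar>"
      unfolding norm_mult norm_of_real using that
      by (intro add_mono mult_mono cmod_cis_minus_1_le) auto
    finally show ?thesis by simp
  qed
  have "cinner (w - z) z = of_real (1 - s) * cis (- \<theta>) - of_real (1 - a)"
    using cnj_cinner[of z w] by (simp add: cinner_diff_left cinner_self a t cis_cnj)
  then have c1: "cmod (cinner (w - z) z) \<le> \<bar>a - s\<bar> + \<bar>\<theta>\<bar>"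
    using tm[of "1 - s" "-\<theta>" "1 - a"] s by (simp add: abs_minus_commute)
  have "cinner (w - z) w = - (of_real (1 - s) * cis \<theta> - of_real (1 - b))"
    by (simp add: cinner_diff_left cinner_self b t)
  then have c2: "cmod (cinner (w - z) w) \<le> \<bar>b - s\<bar> + \<bar>\<theta>\<bar>"
    using tm[of "1 - s" "\<theta>" "1 - b"] s by (simp add: norm_minus_commute abs_minus_commute)
  show "d_psi z w \<le> sqrt 2 * (\<bar>a - s\<bar> + \<bar>b - s\<bar> + 2 * \<bar>\<theta>\<bar>) / (m * sqrt m)
       + (sqrt (2 * s - a - b) + \<bar>\<theta>\<bar>) / m"
  proof (rule d_psi_segment[OF z w])
    fix u :: real assume u: "0 \<le> u" "u \<le> 1"
    define x where "x = (1 - u) *\<^sub>R z + u *\<^sub>R w"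
    have M: "norm z \<le> sqrt (1 - m)" "norm w \<le> sqrt (1 - m)"
      using m a b by (auto intro: real_le_rsqrt)
    have "norm x \<le> (1 - u) * norm z + u * norm w"
      unfolding x_def using u by (intro order_trans[OF norm_triangle_ineq]) auto
    also have "\<dots> \<le> sqrt (1 - m)"
      using M u by (intro convex_bound_le) auto
    finally have "(norm x)\<^sup>2 \<le> (sqrt (1 - m))\<^sup>2" by (intro power_mono) auto
    moreover have "0 \<le> 1 - m" using m a zero_le_power2[of "norm z"] by linarith
    ultimately have mx: "m \<le> 1 - (norm x)\<^sup>2" by simp
    have "cinner (w - z) x = of_real (1 - u) * cinner (w - z) z + of_real u * cinner (w - z) w"
      by (simp only: x_def cinner_add_right vec_scaleR_eq_cscale cinner_mult_right complex_cnj_complex_of_real)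
    then have "cmod (cinner (w - z) x) \<le> cmod (of_real (1 - u) * cinner (w - z) z) + cmod (of_real u * cinner (w - z) w)"
      by (metis norm_triangle_ineq)
    also have "\<dots> \<le> 1 * (\<bar>a - s\<bar> + \<bar>\<theta>\<bar>) + 1 * (\<bar>b - s\<bar> + \<bar>\<theta>\<bar>)"
      unfolding norm_mult norm_of_real using u c1 c2 by (intro add_mono mult_mono) auto
    finally have "cmod (cinner (w - z) x) \<le> \<bar>a - s\<bar> + \<bar>b - s\<bar> + 2 * \<bar>\<theta>\<bar>" by simp
    from h_norm_le[OF m(1) mx this]
    have "h_norm x (w - z) \<le> sqrt 2 * (\<bar>a - s\<bar> + \<bar>b - s\<bar> + 2 * \<bar>\<theta>\<bar>) / (m * sqrt m) + norm (w - z) / m" .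
    also have "\<dots> \<le> sqrt 2 * (\<bar>a - s\<bar> + \<bar>b - s\<bar> + 2 * \<bar>\<theta>\<bar>) / (m * sqrt m)
       + (sqrt (2 * s - a - b) + \<bar>\<theta>\<bar>) / m"
      using nxi m by (intro add_left_mono divide_right_mono) auto
    finally show "h_norm ((1 - u) *\<^sub>R z + u *\<^sub>R w) (w - z) \<le> sqrt 2 * (\<bar>a - s\<bar> + \<bar>b - s\<bar> + 2 * \<bar>\<theta>\<bar>) / (m * sqrt m)
       + (sqrt (2 * s - a - b) + \<bar>\<theta>\<bar>) / m"
      by (simp add: x_def)
  qed
qed

text \<open>Inserting \<open>4/(a + b)\<close> between \<open>1/a + 1/b\<close> and
  \<open>2/s\<close> splits the gap into one part for the difference of the moduli and one for
  \<open>2 * s - a - b\<close>, the two quantities that occur in \<open>d_psi_near\<close>.\<close>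

lemma reciprocal_gap:
  fixes a b s :: real
  assumes "0 < a" "0 < b" "0 < s"
  shows "1/a + 1/b - 2/s = (a - b)\<^sup>2 / (a * b * (a + b)) + 2 * (2 * s - a - b) / (s * (a + b))"
proof -
  have "0 < a + b" using assms by simp
  then show ?thesis using assms by (simp add: divide_simps power2_eq_square) (simp add: algebra_simps)
qed

text \<open>The larger of \<open>a\<close> and \<open>b\<close> is at most \<open>2 * s - m\<close>,
  so the gap is smallest when it equals \<open>2 * s - m\<close>, where it has a closed
  form.\<close>

lemma reciprocal_gap_min:
  fixes a b s m :: real
  assumes "0 < a" "0 < b" "a + b \<le> 2 * s" and m: "m = min a b"
  shows "(s - m)\<^sup>2 / (s\<^sup>2 * m) \<le> 1/a + 1/b - 2/s"
proof -
  have s: "0 < s" using assms by linarith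
  have mm: "0 < m" "m \<le> s" using assms by (auto simp: min_def split: if_splits)
  have "1/m + 1/(2 * s - m) \<le> 1/a + 1/b"
  proof -
    have "max a b \<le> 2 * s - m" "0 < max a b" using assms by (auto simp: min_def max_def)
    then have "1/(2 * s - m) \<le> 1 / max a b" by (intro divide_left_mono) auto
    then show ?thesis using m by (auto simp: min_def max_def split: if_splits)
  qed
  moreover have "(s - m)\<^sup>2 / (s\<^sup>2 * m) \<le> 1/m + 1/(2 * s - m) - 2/s"
  proof -
    have e: "1/m + 1/(2 * s - m) - 2/s = 2 * (s - m)\<^sup>2 / (s * m * (2 * s - m))"
      using mm s by (simp add: divide_simps power2_eq_square) (simp add: algebra_simps)
    have "(s - m)\<^sup>2 / (s\<^sup>2 * m) = 2 * (s - m)\<^sup>2 / (s * m * (2 * s))"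
      using mm s by (simp add: divide_simps power2_eq_square)
    also have "\<dots> \<le> 2 * (s - m)\<^sup>2 / (s * m * (2 * s - m))"
      using mm s by (intro divide_left_mono mult_left_mono mult_pos_pos) auto
    finally show ?thesis by (simp add: e)
  qed
  ultimately show ?thesis by linarith
qed

text \<open>The gap \<open>psi z + psi w - 2/s\<close> pays for displacement in modulus and
  direction, the minimum pays for the phase, and the last summand \<open>2 * \<epsilon>'\<close>
  absorbs additive constants.\<close>

lemma d_psi_le_exponent_gap:
  assumes "0 < \<epsilon>" "0 < \<delta>"
  obtains \<epsilon>' where "0 < \<epsilon>'" "\<epsilon>' < 1"
    "\<And>(z::complex^'n) w s \<theta>. z \<in> ball 0 1 \<Longrightarrow> w \<in> ball 0 1 \<Longrightarrow> 0 < s \<Longrightarrow> s \<le> 1 \<Longrightarrow>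
      cinner z w = of_real (1 - s) * cis \<theta> \<Longrightarrow>
      \<epsilon>' * d_psi z w \<le> psi z + psi w - 2/s + 2 * min (\<epsilon> * \<bar>\<theta>\<bar> / (s * sqrt s)) (\<delta> / s) + 2 * \<epsilon>'"
proof -
  define \<eta> where "\<eta> = min (min \<epsilon> \<delta>) 1"
  have eta: "0 < \<eta>" "\<eta> \<le> \<epsilon>" "\<eta> \<le> \<delta>" "\<eta> \<le> 1" using assms by (auto simp: \<eta>_def)
  \<comment> \<open>The number 54 comes from \<open>A\<close> below, where
    \<open>a * b * (a + b) <= 54 * m^3\<close>; the other comparisons hold with this value as
    well.\<close>
  define \<epsilon>' where "\<epsilon>' = \<eta> / 54"
  have main: "\<epsilon>' * d_psi z w \<le> psi z + psi w - 2/s + 2 * min (\<epsilon> * \<bar>\<theta>\<bar> / (s * sqrt s)) (\<delta> / s) + 2 * \<epsilon>'"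
    if z: "z \<in> ball 0 1" and w: "w \<in> ball 0 1" and s: "0 < s" "s \<le> 1"
      and t: "cinner z w = of_real (1 - s) * cis \<theta>" for z w :: "complex ^ 'n" and s \<theta>
  proof -
    define a b m where "a = 1 - (norm z)\<^sup>2" and "b = 1 - (norm w)\<^sup>2" and "m = min a b"
    have a: "0 < a" "a \<le> 1" and b: "0 < b" "b \<le> 1"
      using z w by (auto simp: a_def b_def abs_square_less_1)
    have m: "0 < m" "m \<le> a" "m \<le> b" "m \<le> 1" using a b by (auto simp: m_def)
    have psi: "psi z = 1/a" "psi w = 1/b" by (auto simp: psi_def a_def b_def)
    note near = d_psi_near[OF z w t a_def b_def less_imp_le[OF s(1)] s(2) m(1-3)]
    note ab = near(1)
    have ms: "m \<le> s" using ab m by linarith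
    note gap1 = reciprocal_gap[OF a(1) b(1) s(1)] and gap2 = reciprocal_gap_min[OF a(1) b(1) ab m_def]
    have gap0: "0 \<le> 1/a + 1/b - 2/s" using m s by (intro order_trans[OF _ gap2]) auto
    have min0: "0 \<le> min (\<epsilon> * \<bar>\<theta>\<bar> / (s * sqrt s)) (\<delta> / s)" using assms s by auto
    have sq: "sqrt x \<le> 1" "x \<le> sqrt x" "0 < sqrt x" if "0 < x" "x \<le> 1" for x :: real
    proof -
      show "sqrt x \<le> 1" "0 < sqrt x" using that by auto
      then show "x \<le> sqrt x" using that
 mult_left_le[of "sqrt x" "sqrt x"] by simp
    qed
    have "1/sqrt a \<le> 1/sqrt m" "1/sqrt b \<le> 1/sqrt m" using a b m by (auto simp: frac_le)
    then have crude: "d_psi z w \<le> 12 / sqrt m"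
      using d_psi_through_0[OF z w, folded a_def b_def] by (simp add: divide_inverse)
    \<comment> \<open>In \<open>Ia\<close> one point is much closer to the sphere than
      \<open>s\<close>, so the gap is at least \<open>1/(4 m)\<close>. In \<open>Ib\<close> the
      phase is so large that the minimum is at least \<open>\<eta> / sqrt s\<close>. Both exceed a
      multiple of \<open>1/sqrt m\<close>, the cost of the path through 0. In \<open>II\<close> the
      numbers \<open>a\<close>, \<open>b\<close>, \<open>m\<close>, \<open>s\<close> are comparable
      and the segment is used.\<close>
    consider (Ia) "2 * m < s" | (Ib) "s \<le> 2 * m" "s < \<bar>\<theta>\<bar>" | (II) "s \<le> 2 * m" "\<bar>\<theta>\<bar> \<le> s" by linarith
    then show ?thesis
    proof cases
      case Ia
      have "1/(4 * m) \<le> (s - m)\<^sup>2 / (s\<^sup>2 * m)"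
      proof -
        have "s\<^sup>2 \<le> (2 * (s - m))\<^sup>2" using Ia s by (intro power_mono) auto
        then show ?thesis unfolding power_mult_distrib using s m by (simp add: divide_simps)
      qed
      moreover have "1/(4 * sqrt m) \<le> 1/(4 * m)" using m sq[of m] by (simp add: frac_le)
      moreover have "\<epsilon>' * d_psi z w \<le> (1/54) * (12 / sqrt m)"
        using crude eta m by (intro order_trans[OF mult_left_mono[OF crude]] mult_right_mono) (auto simp: \<epsilon>'_def)
      moreover have "(1/54) * (12 / sqrt m) \<le> 1/(4 * sqrt m)" using m by (simp add: divide_simps)
      moreover have "0 < \<epsilon>'" using eta by (simp add: \<epsilon>'_def)
      ultimately show ?thesis using gap2 min0 unfolding psi by linarith
    next
      case Ib
      have ss: "sqrt s \<le> 2 * sqrt m"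
      proof -
        have "sqrt s \<le> sqrt (4 * m)" using Ib m by (intro real_sqrt_le_mono) auto
        then show ?thesis by (simp add: real_sqrt_mult)
      qed
      have "\<eta> / sqrt s \<le> \<epsilon> * \<bar>\<theta>\<bar> / (s * sqrt s)"
      proof -
        have "\<eta> * s \<le> \<epsilon> * \<bar>\<theta>\<bar>" using Ib eta s by (intro mult_mono) auto
        then show ?thesis using s by (simp add: divide_simps mult_ac)
      qed
      moreover have "\<eta> / sqrt s \<le> \<delta> / s" using sq[OF s] s eta by (intro frac_le) auto
      moreover have "\<eta> / (2 * sqrt m) \<le> \<eta> / sqrt s" using ss s eta m by (intro divide_left_mono) auto
      moreover have "\<epsilon>' * d_psi z w \<le> (\<eta>/54) * (12 / sqrt m)"
        using crude eta m by (intro order_trans[OF mult_left_mono[OF crude]] mult_right_mono) (auto simp: \<epsilon>'_def)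
      moreover have "(\<eta>/54) * (12 / sqrt m) \<le> \<eta> / (2 * sqrt m)" using m eta by (simp add: divide_simps)
      moreover have "0 < \<epsilon>'" using eta by (simp add: \<epsilon>'_def)
      ultimately show ?thesis using gap0 min0 unfolding psi by auto
    next
      case II
      define q where "q = m * sqrt m"
      define D2 where "D2 = 2 * s - a - b"
      have q: "0 < q" "m\<^sup>2 \<le> q" "q \<le> m" using sq[OF m(1,4)] m
        by (auto simp: q_def power2_eq_square mult_left_le)
      have q2: "q\<^sup>2 = m ^ 3" using m by (simp add: q_def power_mult_distrib power3_eq_cube power2_eq_square)
      have D2: "0 \<le> D2" using ab by (simp add: D2_def)
      have "2 * \<bar>a - s\<bar> \<le> \<bar>a - b\<bar> + D2" "2 * \<bar>b - s\<bar> \<le> \<bar>a - b\<bar> + D2"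
        using ab by (auto simp: D2_def abs_if)
      then have "\<bar>a - s\<bar> + \<bar>b - s\<bar> + 2 * \<bar>\<theta>\<bar> \<le> \<bar>a - b\<bar> + D2 + 2 * \<bar>\<theta>\<bar>"
        by (simp add: field_simps)
      then have "sqrt 2 * (\<bar>a - s\<bar> + \<bar>b - s\<bar> + 2 * \<bar>\<theta>\<bar>) / q \<le> (3/2) * (\<bar>a - b\<bar> + D2 + 2 * \<bar>\<theta>\<bar>) / q"
        using q by (intro divide_right_mono mult_mono real_le_lsqrt) (auto simp: power2_eq_square)
      \<comment> \<open>The inequality \<open>x <= 1 + x^2\<close> turns the root into the term
        linear in \<open>D2\<close> that the gap contains; below, the same device turns
        \<open>|a - b| / q\<close> into its square. Each use leaves a constant 1.\<close>
      moreover have "(sqrt D2 + \<bar>\<theta>\<bar>) / m \<le> (1 + D2 / m\<^sup>2) + \<bar>\<theta>\<bar> / q"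
      proof -
        have "sqrt D2 / m \<le> 1 + (sqrt D2 / m)\<^sup>2"
          using sum_power2_ge_zero[of "sqrt D2 / m - 1/2" 0] by (simp add: power2_eq_square algebra_simps)
        moreover have "(sqrt D2 / m)\<^sup>2 = D2 / m\<^sup>2" using D2 by (simp add: power_divide)
        moreover have "\<bar>\<theta>\<bar> / m \<le> \<bar>\<theta>\<bar> / q" using q by (intro divide_left_mono) (use m in auto)
        ultimately show ?thesis by (simp add: add_divide_distrib)
      qed
      ultimately have "d_psi z w \<le> (3/2) * (\<bar>a - b\<bar> + D2 + 2 * \<bar>\<theta>\<bar>) / q + (1 + D2 / m\<^sup>2) + \<bar>\<theta>\<bar> / q"
        using near(2) unfolding q_def[symmetric] D2_def[symmetric] by linarith
      also have "\<dots> = 3/2 * (\<bar>a - b\<bar> / q) + 3/2 * (D2 / q) + D2 / m\<^sup>2 + 4 * (\<bar>\<theta>\<bar> / q) + 1"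
      proof -
        have "(3/2) * (\<bar>a - b\<bar> + D2 + 2 * \<bar>\<theta>\<bar>) / q = 3/2 * (\<bar>a - b\<bar> / q) + 3/2 * (D2 / q) + 3 * (\<bar>\<theta>\<bar> / q)"
          by (simp add: add_divide_distrib distrib_left)
        then show ?thesis by simp
      qed
      also have "\<dots> \<le> ((a - b)\<^sup>2 / m ^ 3 + 1) + 3/2 * (D2 / m\<^sup>2) + D2 / m\<^sup>2 + 4 * (\<bar>\<theta>\<bar> / q) + 1"
      proof -
        have "3/2 * (\<bar>a - b\<bar> / q) \<le> (\<bar>a - b\<bar> / q)\<^sup>2 + 1"
          using sum_power2_ge_zero[of "\<bar>a - b\<bar> / q - 3/4" 0] by (simp add: power2_eq_square algebra_simps)
        moreover have "(\<bar>a - b\<bar> / q)\<^sup>2 = (a - b)\<^sup>2 / m ^ 3" by (simp add: power_divide q2)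
        moreover have "D2 / q \<le> D2 / m\<^sup>2" using q D2 m by (intro divide_left_mono) auto
        ultimately show ?thesis by linarith
      qed
      finally have d: "d_psi z w \<le> (a - b)\<^sup>2 / m ^ 3 + 5/2 * (D2 / m\<^sup>2) + 4 * (\<bar>\<theta>\<bar> / q) + 2" by linarith
      have a3: "a \<le> 3 * m" and b3: "b \<le> 3 * m" using ab m II by linarith+
      have A: "(1/54) * ((a - b)\<^sup>2 / m ^ 3) \<le> (a - b)\<^sup>2 / (a * b * (a + b))"
      proof -
        have "a * b * (a + b) \<le> (3 * m) * (3 * m) * (6 * m)"
          using a b a3 b3 m by (intro mult_mono) auto
        then have "(a - b)\<^sup>2 / (54 * m ^ 3) \<le> (a - b)\<^sup>2 / (a * b * (a + b))"
          using a b m by (intro divide_left_mono) (auto simp: power3_eq_cube)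
        then show ?thesis by simp
      qed
      have B: "(1/6) * (D2 / m\<^sup>2) \<le> 2 * D2 / (s * (a + b))"
      proof -
        have "s * (a + b) \<le> (2 * m) * (6 * m)" using a b a3 b3 m II s by (intro mult_mono) auto
        then have "2 * D2 / (12 * m\<^sup>2) \<le> 2 * D2 / (s * (a + b))"
          using a b m s D2 by (intro divide_left_mono) (auto simp: power2_eq_square)
        then show ?thesis by simp
      qed
      have C: "\<eta> * \<bar>\<theta>\<bar> / (s * sqrt s) \<le> min (\<epsilon> * \<bar>\<theta>\<bar> / (s * sqrt s)) (\<delta> / s)"
      proof -
        have "\<eta> * \<bar>\<theta>\<bar> / (s * sqrt s) \<le> \<epsilon> * \<bar>\<theta>\<bar> / (s * sqrt s)"
          using eta s by (intro divide_right_mono mult_right_mono) auto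
        moreover have "\<eta> * \<bar>\<theta>\<bar> / (s * sqrt s) \<le> \<delta> / s"
        proof -
          have "\<eta> * \<bar>\<theta>\<bar> \<le> \<delta> * s" using II eta s by (intro mult_mono) auto
          also have "\<dots> \<le> \<delta> * sqrt s" using sq[OF s] assms by (intro mult_left_mono) auto
          finally show ?thesis using s by (simp add: divide_simps)
        qed
        ultimately show ?thesis by simp
      qed
      have C2: "(\<eta>/4) * (\<bar>\<theta>\<bar> / q) \<le> \<eta> * \<bar>\<theta>\<bar> / (s * sqrt s)"
      proof -
        have "sqrt s \<le> sqrt (4 * m)" using II m by (intro real_sqrt_le_mono) auto
        then have "s * sqrt s \<le> (2 * m) * (2 * sqrt m)" using II s m by (intro mult_mono) (auto simp: real_sqrt_mult)
        then have "\<eta> * \<bar>\<theta>\<bar> / (4 * q) \<le> \<eta> * \<bar>\<theta>\<bar> / (s * sqrt s)"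
          using eta s m by (intro divide_left_mono) (auto simp: q_def)
        then show ?thesis by simp
      qed
      have p: "0 \<le> (a - b)\<^sup>2 / m ^ 3" "0 \<le> D2 / m\<^sup>2" "0 \<le> \<bar>\<theta>\<bar> / q" using m D2 q by auto
      have "\<epsilon>' * d_psi z w \<le> \<epsilon>' * ((a - b)\<^sup>2 / m ^ 3 + 5/2 * (D2 / m\<^sup>2) + 4 * (\<bar>\<theta>\<bar> / q) + 2)"
        using eta d by (intro mult_left_mono) (auto simp: \<epsilon>'_def)
      also have "\<dots> = \<epsilon>' * ((a - b)\<^sup>2 / m ^ 3) + (\<epsilon>' * (5/2)) * (D2 / m\<^sup>2) + (\<epsilon>' * 4) * (\<bar>\<theta>\<bar> / q) + 2 * \<epsilon>'"
        by (simp add: algebra_simps)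
      also have "\<dots> \<le> (1/54) * ((a - b)\<^sup>2 / m ^ 3) + (1/6) * (D2 / m\<^sup>2) + (2 * (\<eta>/4)) * (\<bar>\<theta>\<bar> / q) + 2 * \<epsilon>'"
        using eta p by (intro add_mono mult_right_mono) (auto simp: \<epsilon>'_def)
      also have "\<dots> \<le> (a - b)\<^sup>2 / (a * b * (a + b)) + 2 * D2 / (s * (a + b)) + 2 * min (\<epsilon> * \<bar>\<theta>\<bar> / (s * sqrt s)) (\<delta> / s) + 2 * \<epsilon>'"
        using A B C C2 by linarith
      also have "\<dots> = psi z + psi w - 2/s + 2 * min (\<epsilon> * \<bar>\<theta>\<bar> / (s * sqrt s)) (\<delta> / s) + 2 * \<epsilon>'"
        unfolding psi gap1 D2_def by simp
      finally show ?thesis .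
    qed
  qed
  show thesis
    by (rule that[of \<epsilon>']) (use eta main in \<open>auto simp: \<epsilon>'_def\<close>)
qed

section \<open>Sums of saddle point type\<close>

lemma geometric_tail_sum:
  fixes c :: real
  assumes "0 < c"
  shows "summable (\<lambda>j. exp (- c * real j))" "(\<Sum>j. exp (- c * real j)) \<le> 1 + 1 / c"
proof -
  have e: "exp (- c * real j) = exp (- c) ^ j" for j
    by (simp add: exp_of_nat_mult[symmetric] mult.commute)
  have lt: "norm (exp (- c)) < 1" using assms by simp
  show "summable (\<lambda>j. exp (- c * real j))"
    unfolding e using lt by (rule summable_geometric)
  have "(\<Sum>j. exp (- c * real j)) = 1 / (1 - exp (- c))"
    unfolding e using lt by (rule suminf_geometric)
  also have "\<dots> \<le> 1 + 1 / c"
  proof -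
    have "(1 + c) * exp (-c) \<le> exp c * exp (-c)" by (intro mult_right_mono) auto
    then have "(1 + c) * exp (-c) \<le> 1" by (simp flip: exp_add)
    then have "c \<le> (1 + c) * (1 - exp (-c))" by (simp add: algebra_simps)
    moreover have "0 < 1 - exp (-c)" using assms by simp
    ultimately show ?thesis using assms by (simp add: divide_simps add.commute)
  qed
  finally show "(\<Sum>j. exp (- c * real j)) \<le> 1 + 1 / c" .
qed

text \<open>Moving the centre \<open>J\<close> to the natural number \<open>N\<close> below it costs
  a factor \<open>exp c\<close>, after which both sides are geometric series. For negative
  \<open>J\<close> the centre becomes 0, and then the distances to the summation points only
  decrease.\<close>

lemma two_sided_exp_sum:
  fixes c J :: real
  assumes "0 < c"
  shows "summable (\<lambda>j. exp (- c * \<bar>real j - J\<bar>))"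
    "(\<Sum>j. exp (- c * \<bar>real j - J\<bar>)) \<le> exp c * (4 + 4 / c)"
proof -
  let ?f = "\<lambda>j. exp (- c * \<bar>real j - J\<bar>)"
  define N where "N = nat \<lfloor>J\<rfloor>"
  have a: "?f j \<le> exp c * exp (- c * \<bar>real j - real N\<bar>)" for j
  proof (cases "J \<ge> 0")
    case True
    then have "real N \<le> J" "J \<le> real N + 1" by (simp_all add: N_def)
    then have "\<bar>real j - real N\<bar> - 1 \<le> \<bar>real j - J\<bar>" by linarith
    then have "c * (\<bar>real j - real N\<bar> - 1) \<le> c * \<bar>real j - J\<bar>" using assms by (intro mult_left_mono) auto
    then show ?thesis by (simp flip: exp_add add: algebra_simps)
  next
    case False
    then have "N = 0" by (simp add: N_def)
    moreover have "c * real j \<le> c * \<bar>real j - J\<bar>" using False assms by (intro mult_left_mono) auto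
    moreover have "c * \<bar>real j - real N\<bar> = c * real j" using \<open>N = 0\<close> by simp
    ultimately have "c * \<bar>real j - real N\<bar> \<le> c + c * \<bar>real j - J\<bar>" using assms by linarith
    then show ?thesis by (simp flip: exp_add)
  qed
  have b: "exp (- c * \<bar>real j - real N\<bar>) \<le> (if j \<le> N then exp (- c * real (N - j)) else 0) + (if N \<le> j then exp (- c * real (j - N)) else 0)" for j
    by (auto simp: of_nat_diff)
  have s1: "summable (\<lambda>j. if j \<le> N then exp (- c * real (N - j)) else 0)"
    by (rule summable_finite[of "{..N}"]) auto
  have "(\<Sum>j. if j \<le> N then exp (- c * real (N - j)) else 0) = (\<Sum>j\<le>N. exp (- c * real (N - j)))"
    by (subst suminf_finite[of "{..N}"]) auto
  also have "\<dots> = (\<Sum>j\<le>N. exp (- c * real j))"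
    using sum.nat_diff_reindex[of "\<lambda>j. exp (- c * real j)" "Suc N"] by (simp add: lessThan_Suc_atMost)
  also have "\<dots> \<le> (\<Sum>j. exp (- c * real j))"
    by (rule sum_le_suminf[OF geometric_tail_sum(1)[OF assms]]) auto
  also have "\<dots> \<le> 1 + 1 / c" by (rule geometric_tail_sum(2)[OF assms])
  finally have v1: "(\<Sum>j. if j \<le> N then exp (- c * real (N - j)) else 0) \<le> 1 + 1 / c" .
  have sh: "(\<lambda>j. if N \<le> j + N then exp (- c * real (j + N - N)) else 0) = (\<lambda>j. exp (- c * real j))" by auto
  have s2: "summable (\<lambda>j. if N \<le> j then exp (- c * real (j - N)) else 0)"
    using geometric_tail_sum(1)[OF assms]
    by (subst summable_iff_shift[symmetric, of _ N]) (simp only: sh)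
  have "(\<Sum>j. if N \<le> j then exp (- c * real (j - N)) else 0) = (\<Sum>j. exp (- c * real j))"
    by (subst suminf_split_initial_segment[OF s2, of N]) (simp only: sh, simp)
  then have v2: "(\<Sum>j. if N \<le> j then exp (- c * real (j - N)) else 0) \<le> 1 + 1 / c"
    using geometric_tail_sum(2)[OF assms] by simp
  note s12 = summable_mult[OF summable_add[OF s1 s2], of "exp c"]
  have le: "?f j \<le> exp c * ((if j \<le> N then exp (- c * real (N - j)) else 0) + (if N \<le> j then exp (- c * real (j - N)) else 0))" for j
    by (rule order_trans[OF a mult_left_mono[OF b]]) auto
  show sf: "summable ?f"
    by (rule summable_comparison_test[OF _ s12]) (use le in auto)
  have "suminf ?f \<le> (\<Sum>j. exp c * ((if j \<le> N then exp (- c * real (N - j)) else 0) + (if N \<le> j then exp (- c * real (j - N)) else 0)))"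
    by (rule suminf_le[OF le sf s12])
  also have "\<dots> = exp c * ((\<Sum>j. if j \<le> N then exp (- c * real (N - j)) else 0) + (\<Sum>j. if N \<le> j then exp (- c * real (j - N)) else 0))"
    by (subst suminf_mult[OF summable_add[OF s1 s2]], subst suminf_add[OF s1 s2]) simp
  also have "\<dots> \<le> exp c * ((1 + 1/c) + (1 + 1/c))"
    using v1 v2 by (intro mult_left_mono add_mono) auto
  also have "\<dots> \<le> exp c * (4 + 4/c)" using assms by (intro mult_left_mono) (auto simp: field_simps)
  finally show "suminf ?f \<le> exp c * (4 + 4 / c)" .
qed

text \<open>A single term of the exponential series of \<open>c * x\<close> is at most the whole
  sum.\<close>

lemma power_mult_exp_le:
  fixes x c :: real
  assumes "0 \<le> x" "0 < c"
  shows "x ^ n * exp (- c * x) \<le> fact n / c ^ n"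
proof -
  have "(\<Sum>i\<in>{n}. (c * x) ^ i /\<^sub>R fact i) \<le> (\<Sum>i. (c * x) ^ i /\<^sub>R fact i)"
    using assms exp_converges[of "c * x"] by (intro sum_le_suminf) (auto simp: sums_iff)
  then have "(c * x) ^ n / fact n \<le> exp (c * x)"
    using exp_converges[of "c * x"] by (simp add: sums_iff divide_inverse mult.commute)
  then show ?thesis using assms by (simp add: exp_minus field_simps)
qed

text \<open>The size, up to constants, of the \<open>k\<close>-th term of the kernel series at
  \<open>|t| = 1 - s\<close>, with \<open>x = k + n\<close>: the factor
  \<open>x^(n - 1/4) exp (2 sqrt x)\<close> is the growth of the coefficients, and
  \<open>exp (- s x)\<close> stands for \<open>(1 - s)^k\<close>. The argument is real because the
  bound is also needed between integers.\<close>

definition saddle_term :: "nat \<Rightarrow> real \<Rightarrow> real \<Rightarrow> real" where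
  "saddle_term n s x = x powr (real n - 1/4) * exp (2 * sqrt x - s * x)"

lemma saddle_term_nonneg: "0 \<le> saddle_term n s x"
  by (simp add: saddle_term_def)

text \<open>Completing the square in \<open>sqrt x\<close> exhibits the saddle
  \<open>x = 1/s^2\<close> and its height \<open>1/s\<close>.\<close>

lemma exponent_square:
  assumes "0 < s" "0 \<le> x"
  shows "2 * sqrt x - s * x = 1/s - s * (sqrt x - 1/s)\<^sup>2"
proof -
  have "s * (sqrt x - 1/s)\<^sup>2 = s * (sqrt x)\<^sup>2 - 2 * sqrt x + 1/s"
    using assms by (simp add: power2_diff power_divide field_simps power2_eq_square)
  then show ?thesis using assms by simp
qed

lemma powr_le_scale:
  assumes "1 \<le> n" "0 \<le> x" "x \<le> K / s\<^sup>2" "1 \<le> K" "0 < s"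
  shows "x powr (real n - 1/4) \<le> K ^ n * sqrt s / s ^ (2 * n)"
proof -
  have "x powr (real n - 1/4) \<le> (K / s\<^sup>2) powr (real n - 1/4)"
    using assms by (intro powr_mono2) auto
  also have "\<dots> = K powr (real n - 1/4) / (s\<^sup>2) powr (real n - 1/4)"
    using assms by (simp add: powr_divide)
  also have "(s\<^sup>2) powr (real n - 1/4) = s powr (2 * (real n - 1/4))"
    using assms by (simp add: powr_powr flip: powr_numeral)
  also have "\<dots> = s powr real (2 * n) / s powr (1/2)"
    by (subst powr_diff[symmetric]) (simp add: algebra_simps)
  also have "\<dots> = s ^ (2 * n) / sqrt s"
    using assms by (simp only: powr_realpow powr_half_sqrt)
  also have "K powr (real n - 1/4) / (s ^ (2 * n) / sqrt s) \<le> K powr real n / (s ^ (2 * n) / sqrt s)"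
    using assms by (intro divide_right_mono powr_mono) auto
  also have "\<dots> = K ^ n * sqrt s / s ^ (2 * n)" using assms by (simp add: powr_realpow)
  finally show ?thesis .
qed

text \<open>Here \<open>sqrt x\<close> stays at least \<open>1/(4 s)\<close> below the saddle
  \<open>1/s\<close>, and the square then costs \<open>s * (1/(4 s))^2 = 1/(16 s)\<close>.\<close>

lemma saddle_term_small:
  assumes "1 \<le> n" "0 \<le> x" "x \<le> 9 / (16 * s\<^sup>2)" "0 < s" "s \<le> 1"
  shows "saddle_term n s x \<le> exp (1/s - 1 / (16 * s)) / s ^ (2 * n)"
proof -
  have "sqrt x \<le> 3 / (4 * s)"
    using assms by (intro real_le_lsqrt) (auto simp: power_divide power_mult_distrib)
  then have "1 / (4 * s) \<le> 1/s - sqrt x" using assms by (simp add: field_simps)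
  then have "(1 / (4 * s))\<^sup>2 \<le> (1/s - sqrt x)\<^sup>2" using assms by (intro power_mono) auto
  then have "s * (1 / (4 * s))\<^sup>2 \<le> s * (sqrt x - 1/s)\<^sup>2" using assms by (simp add: power2_commute)
  moreover have "s * (1 / (4 * s))\<^sup>2 = 1 / (16 * s)" using assms by (simp add: power2_eq_square field_simps)
  ultimately have e: "2 * sqrt x - s * x \<le> 1/s - 1 / (16 * s)"
    using exponent_square[of s x] assms by simp
  have "x powr (real n - 1/4) \<le> 1 ^ n * sqrt s / s ^ (2 * n)"
    using assms by (intro powr_le_scale) (auto simp: field_simps)
  also have "\<dots> \<le> 1 / s ^ (2 * n)" using assms by (intro divide_right_mono) auto
  finally have "saddle_term n s x \<le> 1 / s ^ (2 * n) * exp (1/s - 1 / (16 * s))"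
    unfolding saddle_term_def using e by (intro mult_mono) auto
  then show ?thesis by simp
qed

text \<open>For \<open>x <= 4/s^2\<close> the exponent is Gaussian in \<open>x - 1/s^2\<close> on
  the scale \<open>s^(-3/2)\<close>. Beyond that it decays at least like \<open>s x / 4\<close>;
  half of this rate absorbs the power of \<open>x\<close>, the other half keeps the sum
  finite.\<close>

lemma saddle_term_le:
  assumes n: "1 \<le> n" and s: "0 < s" "s \<le> 1"
  shows "saddle_term n s (real j) \<le> exp (1/s) *
     (4 ^ n * exp 1 * sqrt s / s ^ (2 * n) * exp (- (2 * (s * sqrt s) / 3) * \<bar>real j - 1/s\<^sup>2\<bar>)
      + fact n * 8 ^ n / s ^ n * exp (- (s / 8) * real j))"
proof -
  define x where "x = real j"
  have x: "0 \<le> x" by (simp add: x_def)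
  define J where "J = 1/s\<^sup>2"
  have e: "saddle_term n s x = exp (1/s) * (x powr (real n - 1/4) * exp (- (s * (sqrt x - 1/s)\<^sup>2)))"
    unfolding saddle_term_def exponent_square[OF s(1) x] by (simp add: exp_diff exp_minus field_simps)
  have "x powr (real n - 1/4) * exp (- (s * (sqrt x - 1/s)\<^sup>2)) \<le>
     4 ^ n * exp 1 * sqrt s / s ^ (2 * n) * exp (- (2 * (s * sqrt s) / 3) * \<bar>x - J\<bar>)
      + fact n * 8 ^ n / s ^ n * exp (- (s / 8) * x)" (is "?L \<le> ?A + ?B")
  proof (cases "x \<le> 4 / s\<^sup>2")
    case True
    have sx: "sqrt x \<le> 2 / s"
      using True s by (intro real_le_lsqrt) (auto simp: power_divide)
    have "x - J = (sqrt x - 1/s) * (sqrt x + 1/s)"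
      using x by (simp add: J_def algebra_simps power2_eq_square)
    then have "\<bar>x - J\<bar> = \<bar>sqrt x - 1/s\<bar> * (sqrt x + 1/s)"
      using x s by (simp add: abs_mult)
    also have "\<dots> \<le> \<bar>sqrt x - 1/s\<bar> * (3/s)"
      using sx by (intro mult_left_mono) (auto simp: add_divide_distrib[symmetric])
    finally have "s * \<bar>x - J\<bar> / 3 \<le> \<bar>sqrt x - 1/s\<bar>" using s by (simp add: field_simps)
    then have "(s * \<bar>x - J\<bar> / 3)\<^sup>2 \<le> \<bar>sqrt x - 1/s\<bar>\<^sup>2" using s by (intro power_mono) auto
    then have "s * (s * \<bar>x - J\<bar> / 3)\<^sup>2 \<le> s * (sqrt x - 1/s)\<^sup>2" using s by simp
    moreover have "s * (s * \<bar>x - J\<bar> / 3)\<^sup>2 = (s * sqrt s * \<bar>x - J\<bar> / 3)\<^sup>2"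
      using s by (simp add: power_mult_distrib power_divide)
    \<comment> \<open>Weakening the Gaussian by \<open>y^2 >= 2 y - 1\<close> produces a two-sided
      exponential of the same width, whose sum over the integers is geometric.\<close>
    moreover have "2 * (s * sqrt s * \<bar>x - J\<bar> / 3) - 1 \<le> (s * sqrt s * \<bar>x - J\<bar> / 3)\<^sup>2"
      using sum_power2_ge_zero[of "s * sqrt s * \<bar>x - J\<bar> / 3 - 1" 0] by (simp add: power2_diff)
    ultimately have "- (s * (sqrt x - 1/s)\<^sup>2) \<le> 1 + (- (2 * (s * sqrt s) / 3) * \<bar>x - J\<bar>)" by simp
    then have "exp (- (s * (sqrt x - 1/s)\<^sup>2)) \<le> exp 1 * exp (- (2 * (s * sqrt s) / 3) * \<bar>x - J\<bar>)"
      by (simp flip: exp_add)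
    then have "?L \<le> (4 ^ n * sqrt s / s ^ (2 * n)) * (exp 1 * exp (- (2 * (s * sqrt s) / 3) * \<bar>x - J\<bar>))"
      using s n x True by (intro mult_mono powr_le_scale) auto
    moreover have "0 \<le> ?B" using s by auto
    ultimately show ?thesis by (simp add: mult_ac)
  next
    case False
    then have "2 / s \<le> sqrt x" using s by (intro real_le_rsqrt) (auto simp: power_divide)
    then have "sqrt x / 2 \<le> sqrt x - 1/s" by simp
    then have "(sqrt x / 2)\<^sup>2 \<le> (sqrt x - 1/s)\<^sup>2" using x by (intro power_mono) auto
    then have "s * (x / 4) \<le> s * (sqrt x - 1/s)\<^sup>2" using s x by (simp add: power_divide)
    then have e1: "exp (- (s * (sqrt x - 1/s)\<^sup>2)) \<le> exp (- (s/8) * x) * exp (- (s/8) * x)"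
      by (simp flip: exp_add)
    have "4 / s\<^sup>2 \<ge> 1" using s power_le_one[of s 2] by (simp add: le_divide_eq)
    then have "x \<ge> 1" using False by simp
    then have "x powr (real n - 1/4) \<le> x powr real n" by (intro powr_mono) auto
    also have "\<dots> = x ^ n" using \<open>x \<ge> 1\<close> by (simp add: powr_realpow)
    finally have "?L \<le> x ^ n * (exp (- (s/8) * x) * exp (- (s/8) * x))"
      using x e1 by (intro mult_mono) auto
    also have "\<dots> = (x ^ n * exp (- (s/8) * x)) * exp (- (s/8) * x)" by simp
    also have "\<dots> \<le> (fact n / (s/8) ^ n) * exp (- (s/8) * x)"
      using s x by (intro mult_right_mono power_mult_exp_le) auto
    also have "\<dots> = ?B" by (simp add: power_divide)
    finally have "?L \<le> ?B" .
    moreover have "0 \<le> ?A" using s by simp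
    ultimately show ?thesis by linarith
  qed
  then show ?thesis unfolding x_def[symmetric] J_def[symmetric] e by (intro mult_left_mono) auto
qed

text \<open>The peak has height \<open>sqrt s / s^(2 n)\<close> times \<open>exp (1/s)\<close> and
  width \<open>1/(s * sqrt s)\<close>; the product gives the power \<open>2 n + 1\<close>. The far
  part contributes only \<open>s^(- n - 1)\<close>. These two parts account for the two summands of
  the constant.\<close>

lemma saddle_term_sum:
  assumes n: "1 \<le> n" and s: "0 < s" "s \<le> 1"
  shows "summable (\<lambda>j. saddle_term n s (real j))"
    "(\<Sum>j. saddle_term n s (real j)) \<le> (10 * 4 ^ n * exp 2 + 9 * fact n * 8 ^ n) * exp (1/s) / s ^ (2 * n + 1)"
proof -
  define c where "c = 2 * (s * sqrt s) / 3"
  have ss: "0 < sqrt s" "sqrt s \<le> 1" "0 < s * sqrt s" "s * sqrt s \<le> 1"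
    using s by (auto intro: mult_le_one)
  have c: "0 < c" "c \<le> 1" using ss by (auto simp: c_def)
  define A where "A = 4 ^ n * exp 1 * sqrt s / s ^ (2 * n)"
  define B where "B = fact n * 8 ^ n / s ^ n"
  have AB: "0 \<le> A" "0 \<le> B" using s by (auto simp: A_def B_def)
  have s8: "0 < s / 8" using s by simp
  note S1 = two_sided_exp_sum[OF c(1), of "1/s\<^sup>2"] and S2 = geometric_tail_sum[OF s8]
  let ?g = "\<lambda>j. exp (1/s) * (A * exp (- c * \<bar>real j - 1/s\<^sup>2\<bar>) + B * exp (- (s / 8) * real j))"
  have le: "saddle_term n s (real j) \<le> ?g j" for j
    using saddle_term_le[OF n s, of j] by (simp add: A_def B_def c_def)
  have gs: "summable ?g"
    by (intro summable_mult summable_add S1(1) S2(1))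
  show sb: "summable (\<lambda>j. saddle_term n s (real j))"
    by (rule summable_comparison_test[OF _ gs]) (use le saddle_term_nonneg in auto)
  have "(\<Sum>j. saddle_term n s (real j)) \<le> suminf ?g"
    by (rule suminf_le[OF le sb gs])
  also have "suminf ?g = exp (1/s) * (A * (\<Sum>j. exp (- c * \<bar>real j - 1/s\<^sup>2\<bar>)) + B * (\<Sum>j. exp (- (s / 8) * real j)))"
    by (subst suminf_mult, intro summable_add summable_mult S1(1) S2(1),
        subst suminf_add[symmetric], intro summable_mult S1(1), intro summable_mult S2(1),
        subst suminf_mult[OF S1(1)], subst suminf_mult[OF S2(1)], rule refl)
  also have "\<dots> \<le> exp (1/s) * (10 * 4 ^ n * exp 2 / s ^ (2 * n + 1) + 9 * fact n * 8 ^ n / s ^ (2 * n + 1))"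
  proof (intro mult_left_mono add_mono)
    have "A * (\<Sum>j. exp (- c * \<bar>real j - 1/s\<^sup>2\<bar>)) \<le> A * (exp c * (4 + 4 / c))"
      using AB S1(2) by (intro mult_left_mono) auto
    also have "\<dots> \<le> A * (exp 1 * (10 / (s * sqrt s)))"
    proof (intro mult_left_mono mult_mono)
      have "4 \<le> 4 / (s * sqrt s)" using ss by (simp add: le_divide_eq)
      moreover have "4 / c = 6 / (s * sqrt s)" by (simp add: c_def)
      moreover have "4 / (s * sqrt s) + 6 / (s * sqrt s) = 10 / (s * sqrt s)" by (simp add: add_divide_distrib[symmetric])
      ultimately show "4 + 4/c \<le> 10 / (s * sqrt s)" by (metis add_right_mono)
    qed (use AB c in auto)
    also have "\<dots> = 10 * 4 ^ n * (exp 1 * exp 1) / s ^ (2 * n + 1)"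
      using ss s by (simp add: A_def field_simps)
    finally show "A * (\<Sum>j. exp (- c * \<bar>real j - 1/s\<^sup>2\<bar>)) \<le> 10 * 4 ^ n * exp 2 / s ^ (2 * n + 1)"
      by (simp flip: exp_add)
    have "B * (\<Sum>j. exp (- (s / 8) * real j)) \<le> B * (1 + 1 / (s/8))"
      using AB S2(2) by (intro mult_left_mono) auto
    also have "\<dots> \<le> B * (9 / s)" using AB s by (intro mult_left_mono) (auto simp: field_simps)
    also have "\<dots> = 9 * fact n * 8 ^ n / s ^ (n + 1)" by (simp add: B_def mult_ac)
    also have "\<dots> \<le> 9 * fact n * 8 ^ n / s ^ (2 * n + 1)"
      using s by (intro divide_left_mono power_decreasing) auto
    finally show "B * (\<Sum>j. exp (- (s / 8) * real j)) \<le> 9 * fact n * 8 ^ n / s ^ (2 * n + 1)" .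
  qed auto
  also have "\<dots> = (10 * 4 ^ n * exp 2 + 9 * fact n * 8 ^ n) * exp (1/s) / s ^ (2 * n + 1)"
    by (simp add: add_divide_distrib algebra_simps)
  finally show "(\<Sum>j. saddle_term n s (real j)) \<le> (10 * 4 ^ n * exp 2 + 9 * fact n * 8 ^ n) * exp (1/s) / s ^ (2 * n + 1)" .
qed

section \<open>A Laplace integral on vertical lines\<close>

lemma integrable_exp_minus_abs:
  fixes a c :: real
  assumes "0 < c"
  shows "integrable lborel (\<lambda>x. exp (- c * \<bar>x - a\<bar>))" "(LINT x|lborel. exp (- c * \<bar>x - a\<bar>)) = 2 / c"
proof -
  have h: "(\<integral>\<^sup>+x. ennreal (exp (- c * x)) * indicator {0..} x \<partial>lborel) = ennreal (1 / c)"
  proof -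
    have "(\<integral>\<^sup>+x. ennreal (exp (- c * x)) * indicator {0..} x \<partial>lborel) = ennreal (0 - (- exp (- c * 0) / c))"
    proof (rule nn_integral_FTC_atLeast)
      show "((\<lambda>x. - exp (- c * x) / c) \<longlongrightarrow> 0) at_top"
        using assms by real_asymp
    qed (use assms in \<open>auto intro!: derivative_eq_intros\<close>)
    then show ?thesis by simp
  qed
  have "(\<integral>\<^sup>+x. ennreal (exp (- c * \<bar>x - a\<bar>)) \<partial>lborel) = (\<integral>\<^sup>+x. ennreal (exp (- c * \<bar>x\<bar>)) \<partial>lborel)"
    by (subst nn_integral_real_affine[where c = 1 and t = a]) auto
  also have "\<dots> = (\<integral>\<^sup>+x. (ennreal (exp (- c * x)) * indicator {0..} x + ennreal (exp (c * x)) * indicator {..<0} x) \<partial>lborel)"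
    by (intro nn_integral_cong) (auto simp: indicator_def)
  also have "\<dots> = (\<integral>\<^sup>+x. ennreal (exp (- c * x)) * indicator {0..} x \<partial>lborel) + (\<integral>\<^sup>+x. ennreal (exp (c * x)) * indicator {..<0} x \<partial>lborel)"
    by (intro nn_integral_add) auto
  also have "(\<integral>\<^sup>+x. ennreal (exp (c * x)) * indicator {..<0} x \<partial>lborel) = (\<integral>\<^sup>+x. ennreal (exp (- c * x)) * indicator {0<..} x \<partial>lborel)"
    by (subst nn_integral_real_affine[where c = "-1" and t = 0]) (auto intro!: nn_integral_cong simp: indicator_def)
  also have "\<dots> = (\<integral>\<^sup>+x. ennreal (exp (- c * x)) * indicator {0..} x \<partial>lborel)"
  proof (rule nn_integral_cong_AE)
    show "AE x in lborel. ennreal (exp (- c * x)) * indicator {0<..} x = ennreal (exp (- c * x)) * indicator {0..} x"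
      using AE_lborel_singleton[of "0::real"] by eventually_elim (auto simp: indicator_def)
  qed
  finally have "(\<integral>\<^sup>+x. ennreal (exp (- c * \<bar>x - a\<bar>)) \<partial>lborel) = ennreal (2 / c)"
    unfolding h using assms by (simp flip: ennreal_plus)
  then have "has_bochner_integral lborel (\<lambda>x. exp (- c * \<bar>x - a\<bar>)) (2 / c)"
    using assms by (intro has_bochner_integral_nn_integral) auto
  then show "integrable lborel (\<lambda>x. exp (- c * \<bar>x - a\<bar>))" "(LINT x|lborel. exp (- c * \<bar>x - a\<bar>)) = 2 / c"
    by (auto simp: has_bochner_integral_iff)
qed

text \<open>This is \<open>e^(-\<tau>) (1 - 1/\<tau>)^x\<close> on \<tau> > 1, written through the
  logarithm so that \<open>laplace_int\<close> can use the same formula with a complex exponent; it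
  is the modulus of that integrand when \<open>x = Re X\<close>.\<close>

definition laplace_weight :: "real \<Rightarrow> real \<Rightarrow> real" where
  "laplace_weight x \<tau> = indicator {1<..} \<tau> * exp (- \<tau> + x * ln (1 - 1/\<tau>))"

definition laplace_int :: "complex \<Rightarrow> complex" where
  "laplace_int X = (LINT \<tau>|lborel. indicator {1<..} \<tau> *\<^sub>R exp (- of_real \<tau> + X * of_real (ln (1 - 1/\<tau>))))"

lemma laplace_weight_nonneg: "0 \<le> laplace_weight x \<tau>"
  by (simp add: laplace_weight_def)

text \<open>These two bounds compare the weight with \<open>exp (- \<tau> - x/\<tau>)\<close> from
  above and with \<open>exp (- \<tau> - x/(\<tau> - 1))\<close> from below, both explicit saddles
  near \<open>sqrt x\<close>.\<close>

lemma ln_one_minus_inverse: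
  assumes "1 < (\<tau>::real)"
  shows "ln (1 - 1/\<tau>) \<le> - 1/\<tau>" "- 1/(\<tau> - 1) \<le> ln (1 - 1/\<tau>)"
proof -
  have p: "0 < 1 - 1/\<tau>" using assms by (simp add: field_simps)
  show "ln (1 - 1/\<tau>) \<le> - 1/\<tau>" using ln_le_minus_one[OF p] by simp
  have "ln (1 / (1 - 1/\<tau>)) \<le> 1 / (1 - 1/\<tau>) - 1" using p by (intro ln_le_minus_one) auto
  also have "\<dots> = 1/(\<tau> - 1)" using assms by (simp add: field_simps)
  finally show "- 1/(\<tau> - 1) \<le> ln (1 - 1/\<tau>)"
    using ln_inverse[of "1 - 1/\<tau>"] p by (simp add: inverse_eq_divide)
qed

lemma borel_measurable_laplace_weight [measurable]: "laplace_weight x \<in> borel_measurable borel"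
  unfolding laplace_weight_def[abs_def] by measurable

lemma laplace_weight_le: "0 \<le> x \<Longrightarrow> laplace_weight x \<tau> \<le> exp 1 * exp (- 1 * \<bar>\<tau> - 1\<bar>)"
proof (cases "1 < \<tau>")
  case True
  assume "0 \<le> x"
  have "ln (1 - 1/\<tau>) \<le> 0" 
  proof (rule order_trans[OF ln_one_minus_inverse(1)[OF True]])
    show "- 1/\<tau> \<le> 0" using True by simp
  qed
  then have "x * ln (1 - 1/\<tau>) \<le> 0" using \<open>0 \<le> x\<close> by (simp add: mult_nonneg_nonpos)
  then show ?thesis using True by (simp add: laplace_weight_def flip: exp_add)
qed (simp add: laplace_weight_def)

lemma integrable_laplace_weight: "0 \<le> x \<Longrightarrow> integrable lborel (laplace_weight x)"
proof (rule Bochner_Integration.integrable_bound)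
  show "integrable lborel (\<lambda>\<tau>. exp 1 * exp (- 1 * \<bar>\<tau> - (1::real)\<bar>))"
    by (intro integrable_mult_right integrable_exp_minus_abs) simp
qed (use laplace_weight_le laplace_weight_nonneg in auto)

lemma norm_laplace_int_integrand:
  "norm (indicator {1<..} \<tau> *\<^sub>R exp (- of_real \<tau> + X * of_real (ln (1 - 1/\<tau>))) :: complex) = laplace_weight (Re X) \<tau>"
  by (simp add: laplace_weight_def indicator_def)

lemma integrable_laplace_int:
  assumes "0 \<le> Re X"
  shows "integrable lborel (\<lambda>\<tau>. indicator {1<..} \<tau> *\<^sub>R exp (- of_real \<tau> + X * of_real (ln (1 - 1/\<tau>))) :: complex)"
proof (rule Bochner_Integration.integrable_bound[OF integrable_laplace_weight[OF assms]])
  show "AE \<tau> in lborel. norm (indicator {1<..} \<tau> *\<^sub>R exp (- of_real \<tau> + X * of_real (ln (1 - 1/\<tau>))) :: complex) \<le> norm (laplace_weight (Re X) \<tau>)"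
    unfolding norm_laplace_int_integrand by simp
qed measurable

lemma laplace_int_of_real: "0 \<le> x \<Longrightarrow> laplace_int (of_real x) = of_real (LINT \<tau>|lborel. laplace_weight x \<tau>)"
  unfolding laplace_int_def integral_complex_of_real[symmetric]
  by (intro Bochner_Integration.integral_cong) (auto simp: laplace_weight_def exp_of_real[symmetric] scaleR_conv_of_real indicator_def)

text \<open>One window of width \<open>sqrt l\<close> to the right of the saddle suffices: with
  \<open>\<sigma> = \<tau> - 1\<close> between \<open>l\<close> and \<open>l + sqrt l\<close>, the
  exponent loss \<open>(\<sigma> - l)^2 / \<sigma>\<close> is at most 1. The final 1/8 is a lower
  bound for \<open>exp (- 2)\<close>.\<close>

lemma integral_laplace_weight_ge:
  assumes l: "1 \<le> l"
  shows "exp (- 2 * l) * sqrt l / 8 \<le> (LINT \<tau>|lborel. laplace_weight (l\<^sup>2) \<tau>)"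
proof -
  let ?I = "{1 + l..1 + l + sqrt l}"
  have "exp (- 2 - 2 * l) * sqrt l = (LINT \<tau>|lborel. indicator ?I \<tau> *\<^sub>R exp (- 2 - 2 * l))"
    using l by (simp add: mult.commute)
  also have "\<dots> \<le> (LINT \<tau>|lborel. laplace_weight (l\<^sup>2) \<tau>)"
  proof (rule integral_mono[OF _ integrable_laplace_weight])
    fix \<tau>
    show "indicator ?I \<tau> *\<^sub>R exp (- 2 - 2 * l) \<le> laplace_weight (l\<^sup>2) \<tau>"
    proof (cases "\<tau> \<in> ?I")
      case True
      define \<sigma> where "\<sigma> = \<tau> - 1"
      have s: "l \<le> \<sigma>" "\<sigma> \<le> l + sqrt l" "1 < \<tau>" using True l by (auto simp: \<sigma>_def)
      have "(\<sigma> - l)\<^sup>2 \<le> (sqrt l)\<^sup>2" using s by (intro power_mono) auto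
      then have "(\<sigma> - l)\<^sup>2 \<le> \<sigma>" using s l by simp
      then have "\<sigma> + l\<^sup>2 / \<sigma> \<le> 2 * l + 1" using s l by (simp add: field_simps power2_eq_square)
      moreover have "l\<^sup>2 * (- 1 / \<sigma>) \<le> l\<^sup>2 * ln (1 - 1/\<tau>)"
        using ln_one_minus_inverse(2)[OF s(3)] unfolding \<sigma>_def by (intro mult_left_mono) auto
      ultimately have "- 2 - 2 * l \<le> - \<tau> + l\<^sup>2 * ln (1 - 1/\<tau>)" by (simp add: \<sigma>_def)
      then show ?thesis using True s by (simp add: laplace_weight_def)
    qed (simp add: laplace_weight_nonneg)
  next
    show "integrable lborel (\<lambda>\<tau>. indicator ?I \<tau> *\<^sub>R exp (- 2 - 2 * l))"
      using l by (intro integrable_scaleR_left integrable_real_indicator) auto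
  qed auto
  finally have ge: "exp (- 2 - 2 * l) * sqrt l \<le> (LINT \<tau>|lborel. laplace_weight (l\<^sup>2) \<tau>)" .
  have "1/8 \<le> exp (- 2 :: real)"
  proof -
    have "exp (2::real) = exp 1 ^ 2" by (simp flip: exp_of_nat_mult)
    also have "\<dots> \<le> (2.8)^2" using e_less_272 by (intro power_mono) auto
    finally show ?thesis by (simp add: exp_minus field_simps power2_eq_square)
  qed
  then have "1/8 * (exp (- 2 * l) * sqrt l) \<le> exp (-2) * (exp (- 2 * l) * sqrt l)"
    using l by (intro mult_right_mono) auto
  also have "\<dots> = exp (- 2 - 2 * l) * sqrt l" by (simp add: mult.assoc[symmetric] flip: exp_add)
  finally show ?thesis using ge by simp
qed

section \<open>Loss of the Laplace integral through oscillation of its integrand\<close>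

lemma one_minus_cos_le: "1 - cos (x::real) \<le> x\<^sup>2 / 2"
proof -
  have "1 - cos x = 2 * (sin (x/2))\<^sup>2" using cos_double_sin[of "x/2"] by simp
  also have "\<dots> \<le> 2 * \<bar>x/2\<bar>\<^sup>2"
    using abs_sin_x_le_abs_x[of "x/2"] power_mono[OF abs_sin_x_le_abs_x, of "x/2" 2] by simp
  finally show ?thesis by (simp add: power_divide)
qed

lemma ln_diff_abs_le:
  assumes "1/2 \<le> p" "1/2 \<le> (q::real)"
  shows "\<bar>ln p - ln q\<bar> \<le> 2 * \<bar>p - q\<bar>"
proof -
  have "ln p - ln q \<le> (p - q) / q" "ln q - ln p \<le> (q - p) / p" using assms by (auto intro: ln_diff_le)
  moreover have "(p - q) / q \<le> 2 * \<bar>p - q\<bar>" "(q - p) / p \<le> 2 * \<bar>p - q\<bar>"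
    using assms mult_right_mono[of "1/2" q "\<bar>p - q\<bar>"] mult_right_mono[of "1/2" p "\<bar>p - q\<bar>"]
    by (auto simp: divide_simps mult_ac) 
  ultimately show ?thesis by linarith
qed

text \<open>Of the linear rate \<open>p/2\<close> one half absorbs the factor \<open>p^2\<close>,
  the other half remains as decay.\<close>

lemma sq_exp_le:
  fixes p :: real
  assumes "0 \<le> p" "p / 2 - 1/8 \<le> e"
  shows "p\<^sup>2 * exp (- e) \<le> 64 * exp (- (p/4))"
proof -
  have "p\<^sup>2 / 32 \<le> exp (p/4)" using exp_lower_Taylor_quadratic[of "p/4"] assms by (simp add: power_divide)
  have e8: "exp (1/8 :: real) \<le> 2" using exp_bound_half[of "1/8::real"] by simp
  have "p\<^sup>2 * exp (- e) \<le> (32 * exp (p/4)) * exp (1/8 - p/2)"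
    using assms \<open>p\<^sup>2 / 32 \<le> exp (p/4)\<close> by (intro mult_mono) auto
  also have "\<dots> = 32 * (exp (1/8) * exp (- (p/4)))" by (simp flip: exp_add)
  also have "\<dots> \<le> 32 * (2 * exp (- (p/4)))" using e8 by (intro mult_left_mono mult_right_mono) auto
  finally show ?thesis by simp
qed

text \<open>Below \<open>l/2\<close> the weight itself is smaller than its peak by
  \<open>exp (- l/2)\<close>, so the trivial bound 2 for \<open>1 - cos\<close> is enough. Above
  \<open>l/2\<close> the logarithm of \<open>1 - 1/\<tau>\<close> is Lipschitz at \<open>l\<close>
  with a constant of order \<open>1/l^2\<close>, so the phase is at most \<open>p/256\<close>, where
  \<open>p = |\<tau> - l| / sqrt l\<close> measures distance in widths of the saddle. The 1024 in
  the hypothesis is what makes this multiple of \<open>p\<close> small.\<close>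

lemma laplace_weight_oscillation:
  assumes l: "512 \<le> l" and y: "\<bar>y\<bar> \<le> l * sqrt l / 1024"
  shows "laplace_weight (l\<^sup>2) \<tau> * (1 - cos (y * (ln (1 - 1/\<tau>) - ln (1 - 1/l)))) \<le>
    exp (- 2 * l) * (2 * exp (- (l/2)) * indicator {1..l/2} \<tau> + 1/512 * exp (- (1 / (4 * sqrt l)) * \<bar>\<tau> - l\<bar>))"
    (is "?w * ?c \<le> exp (- 2 * l) * (?A + ?B)")
proof (cases "1 < \<tau>")
  case True
  define v where "v = \<tau> - l"
  have AB: "0 \<le> ?A" "0 \<le> ?B" by auto
  have "l\<^sup>2 * ln (1 - 1/\<tau>) \<le> l\<^sup>2 * (- 1/\<tau>)"
    using ln_one_minus_inverse(1)[OF True] by (intro mult_left_mono) auto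
  then have "?w \<le> exp (- \<tau> + l\<^sup>2 * (- 1/\<tau>))"
    unfolding laplace_weight_def using True by auto
  \<comment> \<open>Completing the square around the saddle \<open>\<tau> = l\<close>.\<close>
  also have "- \<tau> + l\<^sup>2 * (- 1/\<tau>) = - 2 * l + - (v\<^sup>2 / \<tau>)"
    using True by (simp add: v_def field_simps power2_eq_square)
  also have "exp (- 2 * l + - (v\<^sup>2 / \<tau>)) = exp (- 2 * l) * exp (- (v\<^sup>2 / \<tau>))" by (simp only: exp_add)
  finally have w: "?w \<le> exp (- 2 * l) * exp (- (v\<^sup>2 / \<tau>))" .
  have c: "0 \<le> ?c" "?c \<le> 2" using cos_le_one cos_ge_minus_one[of "y * (ln (1 - 1/\<tau>) - ln (1 - 1/l))"] by (auto simp del: cos_ge_minus_one)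
  show ?thesis
  proof (cases "\<tau> < l/2")
    case lt: True
    have "(l/2) * \<tau> \<le> (l/2) * (l/2)" using lt l True by (intro mult_left_mono) auto
    also have "\<dots> = (l/2)\<^sup>2" by (simp add: power2_eq_square)
    also have "\<dots> \<le> (-v)\<^sup>2" using lt l by (intro power_mono) (auto simp: v_def)
    finally have "l/2 \<le> v\<^sup>2 / \<tau>" using True by (simp add: le_divide_eq)
    then have "exp (- (v\<^sup>2 / \<tau>)) \<le> exp (- (l/2))" by simp
    then have "?w \<le> exp (- 2 * l) * exp (- (l/2))"
      by (intro order_trans[OF w] mult_left_mono) auto
    then have "?w * ?c \<le> (exp (- 2 * l) * exp (- (l/2))) * 2" using c by (intro mult_mono) auto
    also have "\<dots> \<le> exp (- 2 * l) * (?A + ?B)" using lt True by (simp add: field_simps)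
    finally show ?thesis .
  next
    case ge: False
    define p where "p = \<bar>v\<bar> / sqrt l"
    have p: "0 \<le> p" using l by (simp add: p_def)
    have p2: "p\<^sup>2 = v\<^sup>2 / l" using l by (simp add: p_def power_divide)
    have sl: "1 \<le> sqrt l" using l by simp
    \<comment> \<open>The exponent \<open>v^2/\<tau>\<close> is Gaussian in \<open>p\<close> up to
      \<open>2 * l\<close> and linear in \<open>v\<close> beyond; a single linear bound in
      \<open>p\<close> covers both ranges.\<close>
    have e: "p / 2 - 1/8 \<le> v\<^sup>2 / \<tau>"
    proof (cases "\<tau> \<le> 2 * l")
      case True
      have "p / 2 - 1/8 \<le> p\<^sup>2 / 2"
        using sum_power2_ge_zero[of "p - 1/2" 0] by (simp add: power2_eq_square algebra_simps)
      also have "\<dots> = v\<^sup>2 / (2 * l)" by (simp add: p2)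
      also have "\<dots> \<le> v\<^sup>2 / \<tau>" using True \<open>1 < \<tau>\<close> l by (intro divide_left_mono) auto
      finally show ?thesis .
    next
      case False
      then have v: "\<tau> / 2 \<le> v" "0 < v" using l by (auto simp: v_def)
      then have "\<tau> / 2 * v \<le> v * v" by (intro mult_right_mono) auto
      then have "v / 2 \<le> v\<^sup>2 / \<tau>" using \<open>1 < \<tau>\<close> by (simp add: field_simps power2_eq_square)
      moreover have "p \<le> v" using v sl by (simp add: p_def divide_le_eq mult_le_cancel_left1)
      ultimately show ?thesis by simp
    qed
    have "2 \<le> \<tau>" using ge l by simp
    then have "\<bar>ln (1 - 1/\<tau>) - ln (1 - 1/l)\<bar> \<le> 2 * \<bar>(1 - 1/\<tau>) - (1 - 1/l)\<bar>"
      using l by (intro ln_diff_abs_le) (auto simp: field_simps)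
    also have "(1 - 1/\<tau>) - (1 - 1/l) = v / (l * \<tau>)" using True l by (simp add: v_def field_simps)
    also have "2 * \<bar>v / (l * \<tau>)\<bar> = 2 * \<bar>v\<bar> / (l * \<tau>)" using True l by (simp add: abs_mult)
    also have "\<dots> \<le> 2 * \<bar>v\<bar> / (l * (l/2))" using ge l by (intro divide_left_mono mult_left_mono mult_pos_pos) auto
    also have "\<dots> = 4 * \<bar>v\<bar> / l\<^sup>2" by (simp add: power2_eq_square)
    finally have "\<bar>y * (ln (1 - 1/\<tau>) - ln (1 - 1/l))\<bar> \<le> (l * sqrt l / 1024) * (4 * \<bar>v\<bar> / l\<^sup>2)"
      unfolding abs_mult using y l by (intro mult_mono) auto
    also have "\<dots> = p / 256"
      using l by (simp add: p_def power2_eq_square field_simps)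
    finally have "\<bar>y * (ln (1 - 1/\<tau>) - ln (1 - 1/l))\<bar>\<^sup>2 \<le> (p/256)\<^sup>2" by (intro power_mono) auto
    then have "?c \<le> (p / 256)\<^sup>2 / 2"
      using one_minus_cos_le[of "y * (ln (1 - 1/\<tau>) - ln (1 - 1/l))"] by simp
    then have "?w * ?c \<le> (exp (- 2 * l) * exp (- (v\<^sup>2 / \<tau>))) * ((p / 256)\<^sup>2 / 2)"
      using w c laplace_weight_nonneg by (intro mult_mono) auto
    also have "\<dots> = exp (- 2 * l) * (1/131072 * (p\<^sup>2 * exp (- (v\<^sup>2 / \<tau>))))" by (simp add: power_divide)
    also have "\<dots> \<le> exp (- 2 * l) * (1/131072 * (64 * exp (- (p/4))))"
      using sq_exp_le[OF p e] by (intro mult_left_mono) auto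
    also have "exp (- (p/4)) = exp (- (1 / (4 * sqrt l)) * \<bar>\<tau> - l\<bar>)" by (simp add: p_def v_def mult.commute)
    also have "exp (- 2 * l) * (1/131072 * (64 * exp (- (1 / (4 * sqrt l)) * \<bar>\<tau> - l\<bar>))) \<le> exp (- 2 * l) * ?B" by simp
    also have "\<dots> \<le> exp (- 2 * l) * (?A + ?B)" using AB by (intro mult_left_mono) auto
    finally show ?thesis .
  qed
qed (simp add: laplace_weight_def)

text \<open>Once the phase at the saddle point \<open>\<tau> = l\<close> is factored out, the loss caused by oscillation is at most
  the second moment of \<open>y (ln (1 - 1/\<tau>) - ln (1 - 1/l))\<close>, which is of order \<open>y\<^sup>2 / l\<^sup>3\<close>.\<close>

lemma norm_laplace_int_ge:
  assumes l: "512 \<le> l" and y: "\<bar>y\<bar> \<le> l * sqrt l / 1024"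
  shows "exp (- 2 * l) * sqrt l / 16 \<le> norm (laplace_int (Complex (l\<^sup>2) y))"
proof -
  define \<phi> where "\<phi> = (\<lambda>\<tau>. y * (ln (1 - 1/\<tau>) - ln (1 - 1/l)))"
  define E where "E = (\<lambda>\<tau>. exp (- 2 * l) * (2 * exp (- (l/2)) * indicator {1..l/2} \<tau> + 1/512 * exp (- (1 / (4 * sqrt l)) * \<bar>\<tau> - l\<bar>)))"
  have c: "0 < 1 / (4 * sqrt l)" using l by simp
  note ie = integrable_exp_minus_abs[OF c, of l]
  have iI: "integrable lborel (indicator {1..l/2} :: real \<Rightarrow> real)" "(LINT \<tau>|lborel. indicator {1..l/2} \<tau>) = l/2 - 1"
    using l by auto
  have iE: "integrable lborel E" unfolding E_def
    by (intro integrable_mult_right Bochner_Integration.integrable_add ie(1) iI(1))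
  have IE: "(LINT \<tau>|lborel. E \<tau>) = exp (- 2 * l) * (2 * exp (- (l/2)) * (l/2 - 1) + 1/512 * (8 * sqrt l))"
  proof -
    have "(LINT \<tau>|lborel. E \<tau>) = exp (- 2 * l) * ((LINT \<tau>|lborel. 2 * exp (- (l/2)) * indicator {1..l/2} \<tau>) + (LINT \<tau>|lborel. 1/512 * exp (- (1 / (4 * sqrt l)) * \<bar>\<tau> - l\<bar>)))"
      unfolding E_def integral_mult_right_zero
      by (subst Bochner_Integration.integral_add) (auto intro!: integrable_mult_right ie(1)[simplified] iI(1) simp del: integrable_indicator_iff)
    then show ?thesis unfolding integral_mult_right_zero iI ie(2) by simp
  qed
  have wi: "integrable lborel (laplace_weight (l\<^sup>2))" by (rule integrable_laplace_weight) simp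
  have wc: "integrable lborel (\<lambda>\<tau>. laplace_weight (l\<^sup>2) \<tau> * cos (\<phi> \<tau>))"
    by (rule Bochner_Integration.integrable_bound[OF wi])
       (auto simp: abs_mult laplace_weight_nonneg mult_left_le laplace_weight_def \<phi>_def)
  \<comment> \<open>Multiplication by this unit number removes the phase at
    \<open>\<tau> = l\<close> without changing the modulus; the real part then carries
    \<open>cos (\<phi> \<tau>)\<close>, which is close to 1 where the mass lies.\<close>
  have "Re (cis (- y * ln (1 - 1/l)) * laplace_int (Complex (l\<^sup>2) y)) =
      (LINT \<tau>|lborel. Re (cis (- y * ln (1 - 1/l)) * (indicator {1<..} \<tau> *\<^sub>R exp (- of_real \<tau> + Complex (l\<^sup>2) y * of_real (ln (1 - 1/\<tau>))))))"
    unfolding laplace_int_def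
    by (subst integral_mult_right_zero[symmetric], rule integral_Re[symmetric])
       (intro integrable_mult_right integrable_laplace_int, simp)
  also have "\<dots> = (LINT \<tau>|lborel. laplace_weight (l\<^sup>2) \<tau> * cos (\<phi> \<tau>))"
  proof (rule Bochner_Integration.integral_cong[OF refl])
    fix \<tau> :: real
    have ex: "exp (- of_real \<tau> + Complex (l\<^sup>2) y * of_real (ln (1 - 1/\<tau>))) =
        of_real (exp (- \<tau> + l\<^sup>2 * ln (1 - 1/\<tau>))) * cis (y * ln (1 - 1/\<tau>))"
      by (subst exp_eq_polar) simp
    have "cis (- y * ln (1 - 1/l)) * (indicator {1<..} \<tau> *\<^sub>R (of_real (exp (- \<tau> + l\<^sup>2 * ln (1 - 1/\<tau>))) * cis (y * ln (1 - 1/\<tau>))))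
        = of_real (laplace_weight (l\<^sup>2) \<tau>) * (cis (- y * ln (1 - 1/l)) * cis (y * ln (1 - 1/\<tau>)))"
      by (simp add: laplace_weight_def scaleR_conv_of_real)
    also have "cis (- y * ln (1 - 1/l)) * cis (y * ln (1 - 1/\<tau>)) = cis (\<phi> \<tau>)"
      by (simp add: cis_mult \<phi>_def algebra_simps)
    finally show "Re (cis (- y * ln (1 - 1/l)) * (indicator {1<..} \<tau> *\<^sub>R exp (- of_real \<tau> + Complex (l\<^sup>2) y * of_real (ln (1 - 1/\<tau>)))))
       = laplace_weight (l\<^sup>2) \<tau> * cos (\<phi> \<tau>)"
      unfolding ex by simp
  qed
  also have "\<dots> \<ge> (LINT \<tau>|lborel. laplace_weight (l\<^sup>2) \<tau> - E \<tau>)"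
  proof (rule integral_mono)
    show "laplace_weight (l\<^sup>2) \<tau> - E \<tau> \<le> laplace_weight (l\<^sup>2) \<tau> * cos (\<phi> \<tau>)" for \<tau>
      using laplace_weight_oscillation[OF l y, of \<tau>] by (simp add: E_def \<phi>_def algebra_simps)
  qed (use wi iE wc in auto)
  also have "(LINT \<tau>|lborel. laplace_weight (l\<^sup>2) \<tau> - E \<tau>) = (LINT \<tau>|lborel. laplace_weight (l\<^sup>2) \<tau>) - (LINT \<tau>|lborel. E \<tau>)"
    using wi iE by simp
  finally have "(LINT \<tau>|lborel. laplace_weight (l\<^sup>2) \<tau>) - (LINT \<tau>|lborel. E \<tau>) \<le> Re (cis (- y * ln (1 - 1/l)) * laplace_int (Complex (l\<^sup>2) y))" .
  also have "\<dots> \<le> norm (cis (- y * ln (1 - 1/l)) * laplace_int (Complex (l\<^sup>2) y))" by (rule complex_Re_le_cmod)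
  also have "\<dots> = norm (laplace_int (Complex (l\<^sup>2) y))" by (simp add: norm_mult)
  finally have A: "(LINT \<tau>|lborel. laplace_weight (l\<^sup>2) \<tau>) - (LINT \<tau>|lborel. E \<tau>) \<le> norm (laplace_int (Complex (l\<^sup>2) y))" .
  \<comment> \<open>Here \<open>l >= 512\<close> is used. Both summands of the loss become at most
    \<open>sqrt l / 64\<close>, in units of \<open>exp (- 2 * l)\<close>, against a main term
    \<open>sqrt l / 8\<close>, so at least \<open>sqrt l / 16\<close> survives.\<close>
  have "2 * exp (- (l/2)) * (l/2 - 1) \<le> 1/64 * sqrt l"
  proof -
    have "(l/2)\<^sup>2 / 2 \<le> exp (l/2)" using exp_lower_Taylor_quadratic[of "l/2"] l by simp
    then have "l\<^sup>2 * exp (- (l/2)) \<le> 8" by (simp add: exp_minus field_simps power_divide)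
    moreover have "512 * (l * exp (- (l/2))) \<le> l * (l * exp (- (l/2)))" using l by (intro mult_right_mono) auto
    ultimately have "l * exp (- (l/2)) \<le> 1/64" by (simp add: power2_eq_square mult.assoc)
    have "2 * exp (- (l/2)) * (l/2 - 1) \<le> 1/64"
    proof -
      have "2 * exp (- (l/2)) * (l/2 - 1) = l * exp (- (l/2)) - 2 * exp (- (l/2))" by (simp add: algebra_simps)
      then show ?thesis using \<open>l * exp (- (l/2)) \<le> 1/64\<close> exp_gt_zero[of "- (l/2)"] by linarith
    qed
    also have "\<dots> \<le> 1/64 * sqrt l" using l by simp
    finally show ?thesis .
  qed
  then have "(LINT \<tau>|lborel. E \<tau>) \<le> exp (- 2 * l) * (1/64 * sqrt l + 1/64 * sqrt l)"
    unfolding IE by (intro mult_left_mono add_mono) auto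
  moreover have "exp (- 2 * l) * sqrt l / 8 \<le> (LINT \<tau>|lborel. laplace_weight (l\<^sup>2) \<tau>)"
    using l by (intro integral_laplace_weight_ge) auto
  moreover have "0 \<le> exp (- 2 * l) * sqrt l" using l by simp
  ultimately show ?thesis using A by (simp add: algebra_simps)
qed

section \<open>Moments of coordinate functions\<close>

text \<open>Multiplies the component along the unit vector \<open>e\<close> by \<alpha> and the
  orthogonal complement by \<beta>. Unit scalars give the rotations used for averaging; \<alpha> =
  -1 and \<beta> = 1 give a complex reflection.\<close>

definition slice_scale :: "complex ^ 'n \<Rightarrow> complex \<Rightarrow> complex \<Rightarrow> complex ^ 'n \<Rightarrow> complex ^ 'n" where
  "slice_scale e \<alpha> \<beta> w = (\<alpha> * cinner w e) *s e + \<beta> *s (w - cinner w e *s e)"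

lemma cinner_unit: "norm e = 1 \<Longrightarrow> cinner e e = 1"
  by (simp add: cinner_self)

lemma cinner_slice_scale: "norm e = 1 \<Longrightarrow> cinner (slice_scale e \<alpha> \<beta> w) e = \<alpha> * cinner w e"
  by (simp add: slice_scale_def cinner_add_left cinner_diff_left cinner_unit)

lemma norm_slice_scale_sq:
  assumes "norm e = 1"
  shows "(norm (slice_scale e \<alpha> \<beta> w))\<^sup>2 = (cmod \<alpha>)\<^sup>2 * (cmod (cinner w e))\<^sup>2 + (cmod \<beta>)\<^sup>2 * ((norm w)\<^sup>2 - (cmod (cinner w e))\<^sup>2)"
proof -
  have "cinner e (w - cinner w e *s e) = 0"
    using assms by (simp add: cinner_diff_right cinner_unit cnj_cinner)
  then have A: "(norm (slice_scale e \<alpha> \<beta> w))\<^sup>2 = (norm ((\<alpha> * cinner w e) *s e))\<^sup>2 + (norm (\<beta> *s (w - cinner w e *s e)))\<^sup>2" for \<alpha> \<beta>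
    unfolding slice_scale_def norm_add_sq_cinner cinner_mult_left cinner_mult_right by simp
  have "slice_scale e 1 1 w = w" by (simp add: slice_scale_def)
  then have "(norm w)\<^sup>2 = (cmod (cinner w e))\<^sup>2 + (norm (w - cinner w e *s e))\<^sup>2"
    using A[of 1 1] assms by (simp add: norm_cscale)
  then show ?thesis unfolding A norm_cscale norm_mult power_mult_distrib using assms by simp
qed

lemma linear_slice_scale: "linear (slice_scale e \<alpha> \<beta>)"
proof (rule linearI)
  show "slice_scale e \<alpha> \<beta> (x + y) = slice_scale e \<alpha> \<beta> x + slice_scale e \<alpha> \<beta> y" for x y
    by (simp add: slice_scale_def cinner_add_left vec_eq_iff algebra_simps)
  show "slice_scale e \<alpha> \<beta> (r *\<^sub>R x) = r *\<^sub>R slice_scale e \<alpha> \<beta> x" for r x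
    by (simp add: slice_scale_def vec_scaleR_eq_cscale vec_eq_iff algebra_simps)
qed

lemma orthogonal_slice_scale:
  assumes "norm e = 1" "cmod \<alpha> = 1" "cmod \<beta> = 1"
  shows "orthogonal_transformation (slice_scale e \<alpha> \<beta>)"
  unfolding orthogonal_transformation
proof (intro conjI allI linear_slice_scale)
  show "norm (slice_scale e \<alpha> \<beta> v) = norm v" for v
    using norm_slice_scale_sq[OF assms(1), of \<alpha> \<beta> v] assms by (simp add: power2_eq_iff_nonneg)
qed

text \<open>The reflection along \<open>e - f\<close> sends \<open>e\<close> to \<open>f\<close>
  only if \<open>cinner f e\<close> is real. So \<open>e'\<close> is first multiplied by a phase to
  achieve this, which is why the conclusion concerns moduli.\<close>

lemma exists_orthogonal_cinner:
  fixes e e' :: "complex ^ 'n"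
  assumes e: "norm e = 1" "norm e' = 1"
  obtains T where "orthogonal_transformation T" "\<And>w. cmod (cinner (T w) e') = cmod (cinner w e)"
proof -
  obtain \<alpha> where \<alpha>: "cmod \<alpha> = 1" "Im (\<alpha> * cinner e' e) = 0"
  proof (cases "cinner e' e = 0")
    case False
    show ?thesis
    proof (rule that[of "cnj (sgn (cinner e' e))"])
      show "cmod (cnj (sgn (cinner e' e))) = 1" using False by (simp add: norm_sgn)
      have "cnj (sgn (cinner e' e)) * cinner e' e = of_real (cmod (cinner e' e))"
        using False by (simp add: sgn_div_norm scaleR_conv_of_real field_simps)
          (metis complex_norm_square mult.commute of_real_mult power2_eq_square)
      then show "Im (cnj (sgn (cinner e' e)) * cinner e' e) = 0" by simp
    qed
  qed (use that[of 1] in auto)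
  define f where "f = \<alpha> *s e'"
  have f: "norm f = 1" using e \<alpha> by (simp add: f_def norm_cscale)
  have fe: "cinner f e = of_real (Re (cinner f e))"
    using \<alpha> by (simp add: f_def complex_eq_iff)
  have nT: "cmod (cinner w f) = cmod (cinner w e')" for w
    using \<alpha> by (simp add: f_def norm_mult)
  show thesis
  proof (cases "e = f")
    case True
    show ?thesis by (rule that[of id]) (use nT True in \<open>auto simp: orthogonal_transformation_def linear_id\<close>)
  next
    case False
    define d where "d = e - f"
    have d0: "norm d \<noteq> 0" using False by (simp add: d_def)
    define v where "v = (1 / norm d) *\<^sub>R d"
    have v: "norm v = 1" using d0 by (simp add: v_def)
    have dv: "d = complex_of_real (norm d) *s v" using d0 by (simp add: v_def vec_scaleR_eq_cscale vec_eq_iff)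
    \<comment> \<open>The complex Householder reflection exchanging \<open>e\<close> and \<open>f\<close>.\<close>
    define T where "T = slice_scale v (-1) 1"
    have oT: "orthogonal_transformation T" unfolding T_def by (rule orthogonal_slice_scale) (use v in auto)
    have Tw: "T w = w - (2 * cinner w v) *s v" for w
      by (simp add: T_def slice_scale_def vec_eq_iff algebra_simps)
    have ef: "cinner e f = cinner f e" using fe by (metis cnj_cinner complex_cnj_complex_of_real)
    have e2: "2 * Re (cinner e d) = (norm d)\<^sup>2"
      unfolding d_def norm_diff_sq_cinner using e f by (simp add: cinner_diff_right cinner_self)
    have "Im (cinner e d) = 0"
      unfolding d_def using ef fe by (simp add: cinner_diff_right cinner_self) (metis Im_complex_of_real)
    then have e3: "2 * cinner e d = of_real ((norm d)\<^sup>2)"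
      using e2 by (simp add: complex_eq_iff)
    have ev: "2 * cinner e v = of_real (norm d)"
    proof -
      have "cinner e d = of_real (norm d) * cinner e v" by (subst dv) simp
      then have "of_real (norm d) * (2 * cinner e v) = of_real (norm d) * of_real (norm d)"
        using e3 by (simp add: power2_eq_square)
      then show ?thesis using d0 by simp
    qed
    have Te: "T e = f" unfolding Tw ev dv[symmetric] by (simp add: d_def)
    have "cinner (T w) f = cinner w e" for w
    proof -
      have "cinner (T w) (T e) = cinner w e"
        unfolding Tw using v
        by (simp add: cinner_diff_left cinner_diff_right cinner_unit cnj_cinner algebra_simps)
      then show ?thesis by (simp add: Te)
    qed
    then show ?thesis using that[OF oT] nT by metis
  qed
qed

lemma nn_integral_unit_direction:
  fixes e e' :: "complex ^ 'n" and F :: "real \<Rightarrow> real \<Rightarrow> ennreal"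
  assumes "norm e = 1" "norm e' = 1" and [measurable]: "case_prod F \<in> borel_measurable (borel \<Otimes>\<^sub>M borel)"
  shows "(\<integral>\<^sup>+w. F (cmod (cinner w e)) (norm w) \<partial>lborel) = (\<integral>\<^sup>+w. F (cmod (cinner w e')) (norm w) \<partial>lborel)"
proof -
  obtain T where T: "orthogonal_transformation T" "\<And>w. cmod (cinner (T w) e') = cmod (cinner w e)"
    using exists_orthogonal_cinner[OF assms(1,2)] by blast
  have "(\<integral>\<^sup>+w. F (cmod (cinner w e')) (norm w) \<partial>lborel) = (\<integral>\<^sup>+w. F (cmod (cinner (T w) e')) (norm (T w)) \<partial>lborel)"
    by (rule nn_integral_lborel_orthogonal[OF T(1), symmetric]) measurable
  then show ?thesis using T(2) orthogonal_transformation_norm[OF T(1)] by simp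
qed

text \<open>The common factor of the Gaussian and of the weighted moments, both of which are
  superpositions of scaled copies of it. The Gaussian case serves to evaluate it.\<close>

definition ball_moment :: "complex ^ 'n \<Rightarrow> nat \<Rightarrow> ennreal" where
  "ball_moment e k = (\<integral>\<^sup>+w. ennreal (cmod (cinner w e) ^ (2 * k)) * indicator {w. norm w < 1} w \<partial>lborel)"

text \<open>The radius is \<open>r = sqrt R\<close>: homogeneity of the integrand gives
  \<open>r^(2 k)\<close> and the real dimension \<open>2 n\<close> gives \<open>r^(2 n)\<close>,
  together \<open>R^(k + n)\<close>.\<close>

lemma ball_moment_scaled:
  fixes e :: "complex ^ 'n"
  assumes "0 < R"
  shows "(\<integral>\<^sup>+w. ennreal (cmod (cinner w e) ^ (2 * k)) * indicator {w. (norm w)\<^sup>2 < R} w \<partial>lborel)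
    = ennreal (R ^ (k + CARD('n))) * ball_moment e k"
proof -
  define r where "r = sqrt R"
  have r: "0 < r" "r\<^sup>2 = R" using assms by (auto simp: r_def)
  let ?f = "\<lambda>w::complex^'n. ennreal (cmod (cinner w e) ^ (2 * k)) * indicator {w. (norm w)\<^sup>2 < R} w"
  have L: "lborel = density (distr lborel borel (\<lambda>x::complex^'n. 0 + r *\<^sub>R x)) (\<lambda>_. ennreal (\<bar>r\<bar> ^ DIM(complex^'n)))"
    using r by (intro lborel_affine) auto
  have "(\<integral>\<^sup>+w. ?f w \<partial>lborel) = (\<integral>\<^sup>+w. ennreal (\<bar>r\<bar> ^ DIM(complex^'n)) * ?f (r *\<^sub>R w) \<partial>lborel)"
  proof -
    have "(\<integral>\<^sup>+w. ?f w \<partial>lborel) = (\<integral>\<^sup>+w. ?f w \<partial>density (distr lborel borel (\<lambda>x::complex^'n. 0 + r *\<^sub>R x)) (\<lambda>_. ennreal (\<bar>r\<bar> ^ DIM(complex^'n))))"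
      by (rule arg_cong[OF L])
    also have "\<dots> = (\<integral>\<^sup>+w. ennreal (\<bar>r\<bar> ^ DIM(complex^'n)) * ?f w \<partial>distr lborel borel (\<lambda>x::complex^'n. 0 + r *\<^sub>R x))"
      by (intro nn_integral_density) measurable
    also have "\<dots> = (\<integral>\<^sup>+w. ennreal (\<bar>r\<bar> ^ DIM(complex^'n)) * ?f (0 + r *\<^sub>R w) \<partial>lborel)"
      by (intro nn_integral_distr) measurable
    finally show ?thesis by simp
  qed
  also have "\<dots> = (\<integral>\<^sup>+w. ennreal (R ^ (k + CARD('n))) * (ennreal (cmod (cinner w e) ^ (2 * k)) * indicator {w. norm w < 1} w) \<partial>lborel)"
  proof (rule nn_integral_cong)
    fix w :: "complex ^ 'n"
    have i: "(norm (r *\<^sub>R w))\<^sup>2 < R \<longleftrightarrow> norm w < 1"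
    proof -
      have "(norm (r *\<^sub>R w))\<^sup>2 = R * (norm w)\<^sup>2" using r by (simp add: power_mult_distrib)
      then show ?thesis using assms abs_square_less_1[of "norm w"] mult_less_cancel_left_pos[of R "(norm w)\<^sup>2" 1] by simp
    qed
    have "\<bar>r\<bar> ^ DIM(complex^'n) = (r ^ 2) ^ CARD('n)"
      unfolding power_mult[symmetric] using r by (simp add: mult.commute)
    then have "\<bar>r\<bar> ^ DIM(complex^'n) = R ^ CARD('n)" by (simp add: r(2))
    moreover have "cmod (cinner (r *\<^sub>R w) e) ^ (2 * k) = R ^ k * cmod (cinner w e) ^ (2 * k)"
      using r by (simp add: vec_scaleR_eq_cscale norm_mult power_mult_distrib power_mult)
    ultimately show "ennreal (\<bar>r\<bar> ^ DIM(complex^'n)) * ?f (r *\<^sub>R w)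
        = ennreal (R ^ (k + CARD('n))) * (ennreal (cmod (cinner w e) ^ (2 * k)) * indicator {w. norm w < 1} w)"
      using i r assms by (simp add: indicator_def power_add ennreal_mult mult_ac)
  qed
  also have "\<dots> = ennreal (R ^ (k + CARD('n))) * ball_moment e k"
    unfolding ball_moment_def by (rule nn_integral_cmult) measurable
  finally show ?thesis .
qed

text \<open>Tonelli, for a radial function written as a superposition of indicators of balls of
  squared radius \<open>R \<tau>\<close>. It is applied with \<open>R \<tau> = \<tau>\<close> for
  the Gaussian and with \<open>R \<tau> = 1 - 1/\<tau>\<close> for the weight
  \<open>exp (- psi w)\<close>.\<close>

lemma moment_layer_cake:
  fixes e :: "complex ^ 'n" and h :: "real \<Rightarrow> ennreal" and R :: "real \<Rightarrow> real" and k :: nat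
  assumes [measurable]: "h \<in> borel_measurable borel" "R \<in> borel_measurable borel"
    and R: "\<And>\<tau>. \<tau> \<in> S \<Longrightarrow> 0 < R \<tau>" and [measurable]: "S \<in> sets borel"
    and g: "\<And>w :: complex ^ 'n. g w = (\<integral>\<^sup>+\<tau>. h \<tau> * indicator S \<tau> * indicator {\<tau>. (norm w)\<^sup>2 < R \<tau>} \<tau> \<partial>lborel)"
  shows "(\<integral>\<^sup>+w. ennreal (cmod (cinner w e) ^ (2 * k)) * g w \<partial>lborel)
    = ball_moment e k * (\<integral>\<^sup>+\<tau>. h \<tau> * indicator S \<tau> * ennreal (R \<tau> ^ (k + CARD('n))) \<partial>lborel)"
proof -
  have "(\<integral>\<^sup>+w. ennreal (cmod (cinner w e) ^ (2 * k)) * g w \<partial>lborel) =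
     (\<integral>\<^sup>+w. (\<integral>\<^sup>+\<tau>. ennreal (cmod (cinner w e) ^ (2 * k)) * (h \<tau> * indicator S \<tau> * indicator {\<tau>. (norm w)\<^sup>2 < R \<tau>} \<tau>) \<partial>lborel) \<partial>lborel)"
    unfolding g by (intro nn_integral_cong nn_integral_cmult[symmetric]) measurable
  also have "\<dots> = (\<integral>\<^sup>+\<tau>. (\<integral>\<^sup>+w. ennreal (cmod (cinner w e) ^ (2 * k)) * (h \<tau> * indicator S \<tau> * indicator {\<tau>. (norm w)\<^sup>2 < R \<tau>} \<tau>) \<partial>lborel) \<partial>lborel)"
    by (intro lborel_pair.Fubini') measurable
  also have "\<dots> = (\<integral>\<^sup>+\<tau>. ball_moment e k * (h \<tau> * indicator S \<tau> * ennreal (R \<tau> ^ (k + CARD('n)))) \<partial>lborel)"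
  proof (rule nn_integral_cong)
    fix \<tau>
    have "(\<integral>\<^sup>+w. ennreal (cmod (cinner w e) ^ (2 * k)) * (h \<tau> * indicator S \<tau> * indicator {\<tau>. (norm w)\<^sup>2 < R \<tau>} \<tau>) \<partial>lborel)
      = (\<integral>\<^sup>+w. (h \<tau> * indicator S \<tau>) * (ennreal (cmod (cinner w e) ^ (2 * k)) * indicator {w. (norm w)\<^sup>2 < R \<tau>} w) \<partial>lborel)"
      by (intro nn_integral_cong) (simp add: indicator_def mult_ac)
    also have "\<dots> = (h \<tau> * indicator S \<tau>) * (\<integral>\<^sup>+w. ennreal (cmod (cinner w e) ^ (2 * k)) * indicator {w. (norm w)\<^sup>2 < R \<tau>} w \<partial>lborel)"
      by (rule nn_integral_cmult) measurable
    finally show "(\<integral>\<^sup>+w. ennreal (cmod (cinner w e) ^ (2 * k)) * (h \<tau> * indicator S \<tau> * indicator {\<tau>. (norm w)\<^sup>2 < R \<tau>} \<tau>) \<partial>lborel)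
      = ball_moment e k * (h \<tau> * indicator S \<tau> * ennreal (R \<tau> ^ (k + CARD('n))))"
      using R[of \<tau>] ball_moment_scaled[of "R \<tau>" e k] by (cases "\<tau> \<in> S") (simp_all add: mult_ac)
  qed
  also have "\<dots> = ball_moment e k * (\<integral>\<^sup>+\<tau>. h \<tau> * indicator S \<tau> * ennreal (R \<tau> ^ (k + CARD('n))) \<partial>lborel)"
    by (rule nn_integral_cmult) measurable
  finally show ?thesis .
qed

section \<open>Evaluation of the moments through Gaussian integrals\<close>

lemma nn_integral_exp_tail: "(\<integral>\<^sup>+\<tau>. ennreal (exp (- \<tau>)) * indicator {a<..} \<tau> \<partial>lborel) = ennreal (exp (- a))"
proof -
  have "(\<integral>\<^sup>+\<tau>. ennreal (exp (- \<tau>)) * indicator {a<..} \<tau> \<partial>lborel) = (\<integral>\<^sup>+\<tau>. ennreal (exp (- \<tau>)) * indicator {a..} \<tau> \<partial>lborel)"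
  proof (rule nn_integral_cong_AE)
    show "AE \<tau> in lborel. ennreal (exp (- \<tau>)) * indicator {a<..} \<tau> = ennreal (exp (- \<tau>)) * indicator {a..} \<tau>"
      using AE_lborel_singleton[of a] by eventually_elim (auto simp: indicator_def)
  qed
  also have "\<dots> = ennreal (0 - (- exp (- a)))"
  proof (rule nn_integral_FTC_atLeast)
    show "((\<lambda>x::real. - exp (- x)) \<longlongrightarrow> 0) at_top" by real_asymp
  qed (auto intro!: derivative_eq_intros)
  finally show ?thesis by simp
qed

lemma gaussian_moment_ball:
  fixes e :: "complex ^ 'n"
  shows "(\<integral>\<^sup>+w. ennreal (cmod (cinner w e) ^ (2 * k)) * ennreal (exp (- (norm w)\<^sup>2)) \<partial>lborel)
    = ball_moment e k * ennreal (fact (k + CARD('n)))"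
proof -
  have "(\<integral>\<^sup>+w. ennreal (cmod (cinner w e) ^ (2 * k)) * ennreal (exp (- (norm w)\<^sup>2)) \<partial>lborel)
    = ball_moment e k * (\<integral>\<^sup>+\<tau>. ennreal (exp (- \<tau>)) * indicator {0<..} \<tau> * ennreal (\<tau> ^ (k + CARD('n))) \<partial>lborel)"
  proof (rule moment_layer_cake)
    show "ennreal (exp (- (norm w)\<^sup>2)) = (\<integral>\<^sup>+\<tau>. ennreal (exp (- \<tau>)) * indicator {0<..} \<tau> * indicator {\<tau>. (norm w)\<^sup>2 < \<tau>} \<tau> \<partial>lborel)" for w :: "complex ^ 'n"
    proof -
      have "0 < \<tau>" if "(norm w)\<^sup>2 < \<tau>" for \<tau> using zero_le_power2[of "norm w"] that by linarith
      then have "(\<integral>\<^sup>+\<tau>. ennreal (exp (- \<tau>)) * indicator {(norm w)\<^sup>2<..} \<tau> \<partial>lborel)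
          = (\<integral>\<^sup>+\<tau>. ennreal (exp (- \<tau>)) * indicator {0<..} \<tau> * indicator {\<tau>. (norm w)\<^sup>2 < \<tau>} \<tau> \<partial>lborel)"
        by (intro nn_integral_cong) (auto simp: indicator_def)
      then show ?thesis using nn_integral_exp_tail[of "(norm w)\<^sup>2"] by simp
    qed
  qed auto
  also have "(\<integral>\<^sup>+\<tau>. ennreal (exp (- \<tau>)) * indicator {0<..} \<tau> * ennreal (\<tau> ^ (k + CARD('n))) \<partial>lborel)
    = (\<integral>\<^sup>+\<tau>. ennreal (\<tau> ^ (k + CARD('n)) * exp (- \<tau>)) * indicator {0..} \<tau> \<partial>lborel)"
  proof (rule nn_integral_cong_AE)
    show "AE \<tau> in lborel. ennreal (exp (- \<tau>)) * indicator {0<..} \<tau> * ennreal (\<tau> ^ (k + CARD('n))) = ennreal (\<tau> ^ (k + CARD('n)) * exp (- \<tau>)) * indicator {0..} \<tau>"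
      using AE_lborel_singleton[of "0::real"] by eventually_elim (auto simp: indicator_def ennreal_mult mult.commute)
  qed
  also have "\<dots> = ennreal (fact (k + CARD('n)))" by (subst nn_intergal_power_times_exp_Ici) simp
  finally show ?thesis .
qed

lemma nn_integral_gaussian:
  assumes "0 < c"
  shows "(\<integral>\<^sup>+x. ennreal (exp (- c * x\<^sup>2)) \<partial>lborel) = ennreal (sqrt pi / sqrt c)"
proof -
  define \<sigma> where "\<sigma> = 1 / sqrt (2 * c)"
  have \<sigma>: "0 < \<sigma>" "\<sigma>\<^sup>2 = 1 / (2 * c)" using assms by (auto simp: \<sigma>_def power_divide)
  have "(\<integral>\<^sup>+x. ennreal (normal_density 0 \<sigma> x) \<partial>lborel) = ennreal 1"
    using \<sigma> by (subst nn_integral_eq_integral) (auto intro: integrable_normal_density)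
  then have one: "(\<integral>\<^sup>+x. ennreal (normal_density 0 \<sigma> x) \<partial>lborel) = 1" by simp
  have e: "exp (- c * x\<^sup>2) = sqrt (pi / c) * normal_density 0 \<sigma> x" for x
  proof -
    have s: "2 * \<sigma>\<^sup>2 = 1 / c" "2 * pi * \<sigma>\<^sup>2 = pi / c" using \<sigma>(2) by simp_all
    show ?thesis unfolding normal_density_def s using assms by (simp add: mult.commute)
  qed
  have "(\<integral>\<^sup>+x. ennreal (exp (- c * x\<^sup>2)) \<partial>lborel) = (\<integral>\<^sup>+x. ennreal (sqrt (pi / c)) * ennreal (normal_density 0 \<sigma> x) \<partial>lborel)"
    unfolding e using assms by (intro nn_integral_cong ennreal_mult) auto
  also have "\<dots> = ennreal (sqrt (pi / c))" by (subst nn_integral_cmult) (auto simp: one)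
  finally show ?thesis by (simp add: real_sqrt_divide)
qed

text \<open>The integrand factors over the real coordinates. Only the two real coordinates of the
  \<open>i\<close>-th complex one have the coefficient \<open>1 - \<mu>\<close>, and they contribute
  \<open>1 / sqrt (1 - \<mu>)\<close> each.\<close>

lemma gaussian_generating:
  fixes i :: "'n::finite"
  assumes "0 \<le> \<mu>" "\<mu> < 1"
  shows "(\<integral>\<^sup>+w. ennreal (exp (\<mu> * (cmod (cinner w (axis i 1)))\<^sup>2 - (norm (w :: complex ^ 'n))\<^sup>2)) \<partial>lborel)
    = ennreal (pi ^ CARD('n) / (1 - \<mu>))"
proof -
  define c where "c = (\<lambda>b :: complex ^ 'n. if b = axis i 1 \<or> b = axis i \<i> then 1 - \<mu> else 1)"
  have c: "0 < c b" for b using assms by (simp add: c_def)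
  have ne: "axis i (1::complex) \<noteq> axis i \<i>" by (simp add: axis_eq_axis)
  have inB: "axis i (1::complex) \<in> Basis" "axis i \<i> \<in> Basis"
    by (auto simp: axis_in_Basis_iff Basis_complex_def)
  have ci: "cinner w (axis i 1) = w $ i" for w :: "complex ^ 'n"
    by (simp add: cinner_def axis_def if_distrib[of cnj] if_distrib[of "\<lambda>x. _ * x"] cong: if_cong)
  have q: "\<mu> * (cmod (cinner w (axis i 1)))\<^sup>2 - (norm w)\<^sup>2 = (\<Sum>b\<in>Basis. - c b * (w \<bullet> b)\<^sup>2)" for w :: "complex ^ 'n"
  proof -
    have "(norm w)\<^sup>2 = (\<Sum>b\<in>Basis. (w \<bullet> b)\<^sup>2)"
      unfolding power2_norm_eq_inner by (subst euclidean_inner) (simp add: power2_eq_square)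
    moreover have "(cmod (cinner w (axis i 1)))\<^sup>2 = (w \<bullet> axis i 1)\<^sup>2 + (w \<bullet> axis i \<i>)\<^sup>2"
      unfolding ci cmod_power2 inner_axis by (simp add: inner_complex_def)
    moreover have "(\<Sum>b\<in>Basis. - c b * (w \<bullet> b)\<^sup>2) = (\<Sum>b\<in>Basis. \<mu> * (if b \<in> {axis i 1, axis i \<i>} then (w \<bullet> b)\<^sup>2 else 0) - (w \<bullet> b)\<^sup>2)"
      by (intro sum.cong) (auto simp: c_def algebra_simps)
    moreover have "\<dots> = \<mu> * (\<Sum>b\<in>Basis. if b \<in> {axis i 1, axis i \<i>} then (w \<bullet> b)\<^sup>2 else 0) - (\<Sum>b\<in>Basis. (w \<bullet> b)\<^sup>2)"
      by (simp only: sum_subtractf sum_distrib_left)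
    moreover have "(\<Sum>b\<in>Basis. if b \<in> {axis i 1, axis i \<i>} then (w \<bullet> b)\<^sup>2 else 0) = (\<Sum>b\<in>{axis i 1, axis i \<i>}. (w \<bullet> b)\<^sup>2)"
      using inB by (subst sum.inter_restrict[symmetric]) (auto intro: sum.cong)
    ultimately show ?thesis using ne by simp
  qed
  have "(\<integral>\<^sup>+w. ennreal (exp (\<mu> * (cmod (cinner w (axis i 1)))\<^sup>2 - (norm w)\<^sup>2)) \<partial>lborel)
     = (\<integral>\<^sup>+w. (\<Prod>b\<in>Basis. ennreal (exp (- c b * (w \<bullet> b)\<^sup>2))) \<partial>(lborel :: (complex ^ 'n) measure))"
    unfolding q by (simp add: exp_sum prod_ennreal)
  also have "\<dots> = (\<Prod>b\<in>Basis. (\<integral>\<^sup>+x. ennreal (exp (- c b * x\<^sup>2)) \<partial>lborel))"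
    by (intro nn_integral_lborel_prod) auto
  also have "\<dots> = (\<Prod>b\<in>(Basis :: (complex ^ 'n) set). ennreal (sqrt pi / sqrt (c b)))"
    using nn_integral_gaussian[OF c] by simp
  also have "\<dots> = ennreal (\<Prod>b\<in>(Basis :: (complex ^ 'n) set). sqrt pi / sqrt (c b))"
    using c by (intro prod_ennreal) (auto simp: less_imp_le)
  also have "(\<Prod>b\<in>(Basis :: (complex ^ 'n) set). sqrt pi / sqrt (c b)) = sqrt pi ^ DIM(complex ^ 'n) / (\<Prod>b\<in>(Basis :: (complex ^ 'n) set). sqrt (c b))"
    by (simp add: prod_dividef)
  also have "(\<Prod>b\<in>(Basis :: (complex ^ 'n) set). sqrt (c b)) = (\<Prod>b\<in>{axis i 1, axis i \<i>}. sqrt (c b))"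
    using inB by (intro prod.mono_neutral_right) (auto simp: c_def)
  also have "\<dots> = 1 - \<mu>" using ne assms by (simp add: c_def)
  also have "sqrt pi ^ DIM(complex ^ 'n) = pi ^ CARD('n)"
  proof -
    have "sqrt pi ^ DIM(complex ^ 'n) = (sqrt pi ^ 2) ^ CARD('n)"
      unfolding power_mult[symmetric] by (simp add: mult.commute)
    then show ?thesis by simp
  qed
  finally show ?thesis .
qed

lemma norm_axis_one: "norm (axis i 1 :: complex ^ 'n) = 1"
  by (simp add: norm_eq_sqrt_inner inner_axis_axis)

lemma ball_moment_finite:
  fixes e :: "complex ^ 'n"
  shows "norm e = 1 \<Longrightarrow> ball_moment e k < \<infinity>"
proof -
  assume e: "norm e = 1"
  have "ball_moment e k \<le> (\<integral>\<^sup>+w. indicator (ball 0 1) w \<partial>(lborel :: (complex ^ 'n) measure))"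
    unfolding ball_moment_def
  proof (rule nn_integral_mono)
    fix w :: "complex ^ 'n"
    have "cmod (cinner w e) \<le> 1" if "norm w < 1" using norm_cinner_le[of w e] e that by simp
    then show "ennreal (cmod (cinner w e) ^ (2 * k)) * indicator {w. norm w < 1} w \<le> indicator (ball 0 1) w"
      by (auto simp: indicator_def power_le_one)
  qed
  also have "\<dots> < \<infinity>" using emeasure_lborel_ball_finite[of "0::complex^'n" 1] by simp
  finally show ?thesis .
qed

text \<open>Expanding \<open>gaussian_generating\<close> in powers of \<mu> gives the moments
  divided by \<open>fact k\<close> on one side and a geometric series on the other; the claim is
  equality of coefficients.\<close>

lemma gaussian_moment_axis:
  fixes i :: "'n::finite" and k :: nat
  shows "(\<integral>\<^sup>+w. ennreal (cmod (cinner w (axis i 1)) ^ (2 * k)) * ennreal (exp (- (norm (w :: complex ^ 'n))\<^sup>2)) \<partial>lborel)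
    = ennreal (pi ^ CARD('n) * fact k)"
proof -
  let ?e = "axis i 1 :: complex ^ 'n"
  define G where "G = (\<lambda>k. (\<integral>\<^sup>+w. ennreal (cmod (cinner w ?e) ^ (2 * k)) * ennreal (exp (- (norm w)\<^sup>2)) \<partial>lborel))"
  have "norm ?e = 1" by (rule norm_axis_one)
  then have fin: "G k < \<infinity>" for k
    unfolding G_def gaussian_moment_ball using ball_moment_finite[of ?e k] by (auto simp: ennreal_mult_less_top)
  define g where "g = (\<lambda>k. enn2real (G k))"
  have Gg: "G k = ennreal (g k)" for k using fin[of k] by (simp add: g_def)
  have g0: "0 \<le> g k" for k by (simp add: g_def)
  have sums: "(\<lambda>k. g k / fact k * \<mu> ^ k) sums (pi ^ CARD('n) / (1 - \<mu>))" if l: "0 \<le> \<mu>" "\<mu> < 1" for \<mu> :: real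
  proof -
    have "ennreal (pi ^ CARD('n) / (1 - \<mu>)) = (\<integral>\<^sup>+w. ennreal (exp (\<mu> * (cmod (cinner w ?e))\<^sup>2 - (norm w)\<^sup>2)) \<partial>lborel)"
      using gaussian_generating[OF l, of i] by simp
    also have "\<dots> = (\<integral>\<^sup>+w. (\<Sum>k. ennreal (\<mu> ^ k / fact k) * (ennreal (cmod (cinner w ?e) ^ (2 * k)) * ennreal (exp (- (norm w)\<^sup>2)))) \<partial>lborel)"
    proof (rule nn_integral_cong)
      fix w :: "complex ^ 'n"
      define x where "x = \<mu> * (cmod (cinner w ?e))\<^sup>2"
      have x0: "0 \<le> x" using l by (simp add: x_def)
      have "(\<lambda>k. x ^ k /\<^sub>R fact k * exp (- (norm w)\<^sup>2)) sums (exp x * exp (- (norm w)\<^sup>2))"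
        by (intro sums_mult2 exp_converges)
      then have "(\<lambda>k. ennreal (x ^ k /\<^sub>R fact k * exp (- (norm w)\<^sup>2))) sums ennreal (exp x * exp (- (norm w)\<^sup>2))"
        using x0 by (subst sums_ennreal) auto
      moreover have "ennreal (x ^ k /\<^sub>R fact k * exp (- (norm w)\<^sup>2)) = ennreal (\<mu> ^ k / fact k) * (ennreal (cmod (cinner w ?e) ^ (2 * k)) * ennreal (exp (- (norm w)\<^sup>2)))" for k
      proof -
        have "x ^ k = \<mu> ^ k * cmod (cinner w ?e) ^ (2 * k)" by (simp add: x_def power_mult_distrib power_mult)
        then have "x ^ k /\<^sub>R fact k * exp (- (norm w)\<^sup>2) = (\<mu> ^ k / fact k) * (cmod (cinner w ?e) ^ (2 * k) * exp (- (norm w)\<^sup>2))"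
          by (simp add: divide_inverse)
        then show ?thesis using l by (simp only: ennreal_mult' ennreal_mult'' zero_le_power norm_ge_zero exp_ge_zero divide_nonneg_nonneg fact_ge_zero)
      qed
      ultimately show "ennreal (exp (\<mu> * (cmod (cinner w ?e))\<^sup>2 - (norm w)\<^sup>2)) = (\<Sum>k. ennreal (\<mu> ^ k / fact k) * (ennreal (cmod (cinner w ?e) ^ (2 * k)) * ennreal (exp (- (norm w)\<^sup>2))))"
        by (simp add: sums_iff x_def exp_diff exp_minus divide_inverse)
    qed
    also have "\<dots> = (\<Sum>k. (\<integral>\<^sup>+w. ennreal (\<mu> ^ k / fact k) * (ennreal (cmod (cinner w ?e) ^ (2 * k)) * ennreal (exp (- (norm w)\<^sup>2))) \<partial>lborel))"
      by (rule nn_integral_suminf) measurable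
    also have "\<dots> = (\<Sum>k. ennreal (\<mu> ^ k / fact k) * G k)"
      unfolding G_def by (subst nn_integral_cmult) auto
    also have "\<dots> = (\<Sum>k. ennreal (g k / fact k * \<mu> ^ k))"
      unfolding Gg using l g0 by (simp flip: ennreal_mult add: mult_ac)
    finally have "(\<Sum>k. ennreal (g k / fact k * \<mu> ^ k)) = ennreal (pi ^ CARD('n) / (1 - \<mu>))" ..
    then have "(\<lambda>k. ennreal (g k / fact k * \<mu> ^ k)) sums ennreal (pi ^ CARD('n) / (1 - \<mu>))"
      using summable_sums[OF summableI, of "\<lambda>k. ennreal (g k / fact k * \<mu> ^ k)"] by simp
    then show ?thesis using l g0 by (subst (asm) sums_ennreal) auto
  qed
  define a where "a = (\<lambda>k. g k / fact k - pi ^ CARD('n))"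
  have sa: "(\<lambda>k. a k * \<mu> ^ k) sums 0" if l: "0 \<le> \<mu>" "\<mu> < 1" for \<mu> :: real
  proof -
    have "(\<lambda>k. pi ^ CARD('n) * \<mu> ^ k) sums (pi ^ CARD('n) * (1 / (1 - \<mu>)))"
      using l by (intro sums_mult geometric_sums) auto
    from sums_diff[OF sums[OF l] this] show ?thesis by (simp add: a_def algebra_simps)
  qed
  \<comment> \<open>Uniqueness of coefficients from values at real \<open>\<mu>\<close> in
    \<open>[0, 1)\<close> alone: divide by the power of the first nonzero coefficient and let \<mu>
    tend to 0 from the right.\<close>
  have "a k = 0"
  proof (rule ccontr)
    assume "a k \<noteq> 0"
    define m where "m = (LEAST k. a k \<noteq> 0)"
    have m: "a m \<noteq> 0" "\<And>j. j < m \<Longrightarrow> a j = 0"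
      using LeastI[of "\<lambda>k. a k \<noteq> 0", OF \<open>a k \<noteq> 0\<close>] not_less_Least[of _ "\<lambda>k. a k \<noteq> 0"]
      unfolding m_def by blast+
    define b where "b = (\<lambda>j. a (j + m))"
    have sb: "(\<lambda>j. b j * \<mu> ^ j) sums 0" if l: "0 < \<mu>" "\<mu> < 1" for \<mu> :: real
    proof -
      have "(\<lambda>j. a (j + m) * \<mu> ^ (j + m)) sums (0 - (\<Sum>j<m. a j * \<mu> ^ j))"
        using sums_split_initial_segment[OF sa, of \<mu> m] l by simp
      then have "(\<lambda>j. a (j + m) * \<mu> ^ (j + m)) sums 0" using m(2) by simp
      from sums_mult2[OF this, of "1 / \<mu> ^ m"] have "(\<lambda>j. a (j + m) * \<mu> ^ (j + m) * (1 / \<mu> ^ m)) sums 0" by simp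
      moreover have "a (j + m) * \<mu> ^ (j + m) * (1 / \<mu> ^ m) = b j * \<mu> ^ j" for j
        using l by (simp add: b_def power_add)
      ultimately show ?thesis by simp
    qed
    have summ: "summable (\<lambda>j. b j * (1/2) ^ j)" using sb[of "1/2"] by (simp add: sums_iff)
    have "isCont (\<lambda>x. \<Sum>j. b j * x ^ j) 0"
      by (rule isCont_powser[OF summ]) simp
    then have "((\<lambda>x. \<Sum>j. b j * x ^ j) \<longlongrightarrow> b 0) (at_right 0)"
      by (simp add: isCont_def filterlim_at_split)
    moreover have "\<forall>\<^sub>F x in at_right 0. (\<Sum>j. b j * x ^ j) = 0"
    proof (rule eventually_mono[OF eventually_at_right_real[of 0 1]])
      show "(\<Sum>j. b j * x ^ j) = 0" if "x \<in> {0<..<1}" for x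
        using sb[of x] that by (simp add: sums_iff)
    qed simp
    ultimately have "((\<lambda>x::real. 0) \<longlongrightarrow> b 0) (at_right 0)"
      by (rule Lim_transform_eventually)
    then have "b 0 = 0" using tendsto_unique[OF _ tendsto_const, of "at_right (0::real)" 0 "b 0"] by simp
    then show False using m by (simp add: b_def)
  qed
  then have "g k = pi ^ CARD('n) * fact k" by (simp add: a_def field_simps)
  then show ?thesis using Gg[of k] by (simp add: G_def)
qed

text \<open>The Gaussian moment is computed twice: by layers for the direction \<open>e\<close>, and
  in closed form along a coordinate axis; unitary invariance identifies the two.\<close>

lemma ball_moment_eq:
  fixes e :: "complex ^ 'n"
  assumes e: "norm e = 1"
  shows "ball_moment e k = ennreal (pi ^ CARD('n) * fact k / fact (k + CARD('n)))"
proof -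
  obtain i :: 'n where True by simp
  let ?a = "axis i 1 :: complex ^ 'n"
  have "ball_moment e k * ennreal (fact (k + CARD('n)))
      = (\<integral>\<^sup>+w. ennreal (cmod (cinner w e) ^ (2 * k)) * ennreal (exp (- (norm w)\<^sup>2)) \<partial>lborel)"
    by (rule gaussian_moment_ball[symmetric])
  also have "\<dots> = (\<integral>\<^sup>+w. ennreal (cmod (cinner w ?a) ^ (2 * k)) * ennreal (exp (- (norm w)\<^sup>2)) \<partial>lborel)"
  proof (rule nn_integral_unit_direction[OF e norm_axis_one])
    show "(\<lambda>(x, y). ennreal (x ^ (2 * k)) * ennreal (exp (- y\<^sup>2))) \<in> borel_measurable (borel \<Otimes>\<^sub>M borel)"
      by measurable
  qed
  also have "\<dots> = ennreal (pi ^ CARD('n) * fact k)" by (rule gaussian_moment_axis)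
  finally have A: "ball_moment e k * ennreal (fact (k + CARD('n))) = ennreal (pi ^ CARD('n) * fact k)" .
  obtain x where x: "ball_moment e k = ennreal x" "0 \<le> x"
    using ball_moment_finite[OF e, of k] by (cases "ball_moment e k") auto
  then have "x * fact (k + CARD('n)) = pi ^ CARD('n) * fact k"
    using A by (simp flip: ennreal_mult)
  then have "x = pi ^ CARD('n) * fact k / fact (k + CARD('n))" by (simp add: field_simps)
  then show ?thesis using x by simp
qed

text \<open>Closed form of the weighted norm squared of \<open>w \<mapsto> cinner w e ^ k\<close>
  for a unit vector \<open>e\<close>; \<open>weighted_moment\<close> proves that it is this
  integral.\<close>

definition axis_moment :: "nat \<Rightarrow> nat \<Rightarrow> real" where
  "axis_moment n k = pi ^ n * fact k / fact (k + n) * (LINT \<tau>|lborel. laplace_weight (real (k + n)) \<tau>)"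

lemma weighted_moment:
  fixes e :: "complex ^ 'n"
  assumes e: "norm e = 1"
  shows "(\<integral>\<^sup>+w. ennreal (cmod (cinner w e) ^ (2 * k)) * (ennreal (exp (- psi w)) * indicator (ball 0 1) w) \<partial>lborel)
    = ennreal (axis_moment CARD('n) k)"
proof -
  have "(\<integral>\<^sup>+w. ennreal (cmod (cinner w e) ^ (2 * k)) * (ennreal (exp (- psi w)) * indicator (ball 0 1) w) \<partial>lborel)
    = ball_moment e k * (\<integral>\<^sup>+\<tau>. ennreal (exp (- \<tau>)) * indicator {1<..} \<tau> * ennreal ((1 - 1/\<tau>) ^ (k + CARD('n))) \<partial>lborel)"
  proof (rule moment_layer_cake)
    fix w :: "complex ^ 'n"
    \<comment> \<open>The sublevel set \<open>psi w < \<tau>\<close> inside the ball is the ball of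
      squared radius \<open>1 - 1/\<tau>\<close>, and is empty for \<tau> \<le> 1.\<close>
    have eq: "indicator (ball 0 1) w * indicator {psi w<..} \<tau> = (indicator {1<..} \<tau> * indicator {\<tau>. (norm w)\<^sup>2 < 1 - 1/\<tau>} \<tau> :: ennreal)" for \<tau>
    proof -
      have "norm w < 1 \<and> psi w < \<tau> \<longleftrightarrow> 1 < \<tau> \<and> (norm w)\<^sup>2 < 1 - 1/\<tau>"
      proof (cases "norm w < 1")
        case True
        then have p: "0 < 1 - (norm w)\<^sup>2" "1 - (norm w)\<^sup>2 \<le> 1" by (auto simp: abs_square_less_1)
        then have "1 \<le> psi w" by (simp add: psi_def)
        moreover have "psi w < \<tau> \<longleftrightarrow> (norm w)\<^sup>2 < 1 - 1/\<tau>" if "1 < \<tau>"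
          unfolding psi_def using p that by (simp add: field_simps)
        ultimately show ?thesis using True by linarith
      next
        case False
        then have "1 \<le> (norm w)\<^sup>2" by (simp add: power_increasing one_le_power)
        moreover have "1 - 1/\<tau> \<le> 1" if "1 < \<tau>" using that by simp
        ultimately show ?thesis using False by linarith
      qed
      then show ?thesis by (auto simp: indicator_def)
    qed
    have "ennreal (exp (- psi w)) * indicator (ball 0 1) w = (\<integral>\<^sup>+\<tau>. ennreal (exp (- \<tau>)) * indicator {psi w<..} \<tau> \<partial>lborel) * indicator (ball 0 1) w"
      by (simp add: nn_integral_exp_tail)
    also have "\<dots> = (\<integral>\<^sup>+\<tau>. ennreal (exp (- \<tau>)) * indicator {psi w<..} \<tau> * indicator (ball 0 1) w \<partial>lborel)"
      by (rule nn_integral_multc[symmetric]) measurable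
    also have "\<dots> = (\<integral>\<^sup>+\<tau>. ennreal (exp (- \<tau>)) * indicator {1<..} \<tau> * indicator {\<tau>. (norm w)\<^sup>2 < 1 - 1/\<tau>} \<tau> \<partial>lborel)"
      using eq by (intro nn_integral_cong) (metis mult.assoc mult.commute)
    finally show "ennreal (exp (- psi w)) * indicator (ball 0 1) w = (\<integral>\<^sup>+\<tau>. ennreal (exp (- \<tau>)) * indicator {1<..} \<tau> * indicator {\<tau>. (norm w)\<^sup>2 < 1 - 1/\<tau>} \<tau> \<partial>lborel)" .
  qed auto
  also have "(\<integral>\<^sup>+\<tau>. ennreal (exp (- \<tau>)) * indicator {1<..} \<tau> * ennreal ((1 - 1/\<tau>) ^ (k + CARD('n))) \<partial>lborel)
      = (\<integral>\<^sup>+\<tau>. ennreal (laplace_weight (real (k + CARD('n))) \<tau>) \<partial>lborel)"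
  proof (rule nn_integral_cong)
    fix \<tau> :: real
    show "ennreal (exp (- \<tau>)) * indicator {1<..} \<tau> * ennreal ((1 - 1/\<tau>) ^ (k + CARD('n))) = ennreal (laplace_weight (real (k + CARD('n))) \<tau>)"
    proof (cases "1 < \<tau>")
      case True
      then have "0 < 1 - 1/\<tau>" by simp
      then have "(1 - 1/\<tau>) ^ (k + CARD('n)) = exp (real (k + CARD('n)) * ln (1 - 1/\<tau>))"
        by (simp only: exp_of_nat_mult exp_ln)
      then show ?thesis using True by (simp only: laplace_weight_def exp_add) (simp add: ennreal_mult)
    qed (simp add: laplace_weight_def)
  qed
  also have "\<dots> = ennreal (LINT \<tau>|lborel. laplace_weight (real (k + CARD('n))) \<tau>)"
    by (intro nn_integral_eq_integral integrable_laplace_weight) (auto simp: laplace_weight_nonneg)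
  also have "ball_moment e k * \<dots> = ennreal (axis_moment CARD('n) k)"
    unfolding axis_moment_def ball_moment_eq[OF e]
    by (intro ennreal_mult[symmetric]) (auto intro!: Bochner_Integration.integral_nonneg laplace_weight_nonneg)
  finally show ?thesis .
qed

section \<open>Summation by contour shift\<close>

text \<open>Truncation to the compact intervals \<open>[a n, b n]\<close> inside \<tau> > 1 gives
  holomorphic functions by differentiation under the integral. Their distance to
  \<open>laplace_int\<close> is at most \<open>e n\<close>, which does not depend on
  \<open>X\<close>, because \<open>laplace_weight_le\<close> is uniform in nonnegative
  exponents.\<close>

lemma laplace_int_holomorphic: "laplace_int holomorphic_on {X. 0 < Re X}"
proof (rule holomorphic_uniform_sequence)
  let ?f = "\<lambda>X \<tau>. exp (- of_real \<tau> + X * of_real (ln (1 - 1/\<tau>))) :: complex"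
  define a b where "a = (\<lambda>n::nat. 1 + 1 / (real n + 2))" and "b = (\<lambda>n::nat. real n + 2)"
  have a1: "1 < a n" for n by (simp add: a_def)
  define L where "L = (\<lambda>n X. integral (cbox (a n) (b n)) (?f X))"
  have cont: "continuous_on (cbox (a n) (b n)) (\<lambda>\<tau>. ln (1 - 1/\<tau>))" for n
    using a1[of n] by (intro continuous_intros) (auto simp: field_simps)
  show "open {X. 0 < Re X}" by (rule open_halfspace_Re_gt)
  show "L n holomorphic_on {X. 0 < Re X}" for n
    unfolding L_def
  proof (rule leibniz_rule_holomorphic)
    show "((\<lambda>X. ?f X \<tau>) has_field_derivative ?f X \<tau> * of_real (ln (1 - 1/\<tau>))) (at X within U)" for X U and \<tau> :: real
      by (auto intro!: derivative_eq_intros)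
    show "?f X integrable_on cbox (a n) (b n)" for X
      by (intro integrable_continuous continuous_intros cont)
    have "continuous_on ({X. 0 < Re X} \<times> cbox (a n) (b n)) (\<lambda>p. of_real (ln (1 - 1 / snd p)) :: complex)"
      by (intro continuous_on_of_real continuous_on_compose2[OF cont] continuous_intros) auto
    then show "continuous_on ({X. 0 < Re X} \<times> cbox (a n) (b n)) (\<lambda>(X, \<tau>). ?f X \<tau> * of_real (ln (1 - 1/\<tau>)))"
      unfolding case_prod_unfold using a1[of n] by (intro continuous_on_mult continuous_on_exp continuous_on_add continuous_on_minus continuous_on_of_real continuous_on_fst continuous_on_snd continuous_on_id) auto
    show "convex {X. 0 < Re X}" by (rule convex_halfspace_Re_gt)
  qed
  define e where "e = (\<lambda>n. LINT \<tau>|lborel. indicator ({1<..} - {a n..b n}) \<tau> * (exp 1 * exp (- 1 * \<bar>\<tau> - 1\<bar>)))"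
  have ib: "integrable lborel (\<lambda>\<tau>. exp 1 * exp (- 1 * \<bar>\<tau> - (1::real)\<bar>))"
    by (intro integrable_mult_right integrable_exp_minus_abs) simp
  have ii: "integrable lborel (\<lambda>\<tau>. indicator ({1<..} - {a n..b n}) \<tau> * (exp 1 * exp (- 1 * \<bar>\<tau> - (1::real)\<bar>)))" for n
    by (rule Bochner_Integration.integrable_bound[OF ib]) (auto simp: indicator_def)
  have "e \<longlonglongrightarrow> (LINT \<tau>::real|lborel. (0::real))"
    unfolding e_def
  proof (rule integral_dominated_convergence[where w = "\<lambda>\<tau>. exp 1 * exp (- 1 * \<bar>\<tau> - 1\<bar>)"])
    show "AE \<tau> in lborel. (\<lambda>n. indicator ({1<..} - {a n..b n}) \<tau> * (exp 1 * exp (- 1 * \<bar>\<tau> - 1\<bar>))) \<longlonglongrightarrow> (0::real)"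
    proof (rule AE_I2)
      fix \<tau> :: real
      have "\<forall>\<^sub>F n in sequentially. indicator ({1<..} - {a n..b n}) \<tau> * (exp 1 * exp (- 1 * \<bar>\<tau> - 1\<bar>)) = (0::real)"
      proof (cases "1 < \<tau>")
        case True
        have "a \<longlonglongrightarrow> 1" unfolding a_def by real_asymp
        then have "\<forall>\<^sub>F n in sequentially. a n < \<tau>" using True by (rule order_tendstoD)
        moreover have "filterlim b at_top sequentially" unfolding b_def by real_asymp
        then have "\<forall>\<^sub>F n in sequentially. \<tau> \<le> b n" by (simp add: filterlim_at_top)
        ultimately show ?thesis by eventually_elim auto
      qed (auto simp: indicator_def)
      then show "(\<lambda>n. indicator ({1<..} - {a n..b n}) \<tau> * (exp 1 * exp (- 1 * \<bar>\<tau> - 1\<bar>))) \<longlonglongrightarrow> (0::real)"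
        by (rule tendsto_eventually)
    qed
    show "AE \<tau> in lborel. norm (indicator ({1<..} - {a n..b n}) \<tau> * (exp 1 * exp (- 1 * \<bar>\<tau> - (1::real)\<bar>))) \<le> exp 1 * exp (- 1 * \<bar>\<tau> - 1\<bar>)" for n
      by (auto simp: indicator_def)
  qed (use ib in auto)
  then have e0: "e \<longlonglongrightarrow> 0" by simp
  have diff: "norm (laplace_int X - L n X) \<le> e n" if X: "0 < Re X" for X n
  proof -
    have iS: "integrable lborel (\<lambda>\<tau>. indicator {1<..} \<tau> *\<^sub>R ?f X \<tau>)" using X by (intro integrable_laplace_int) auto
    have iT: "integrable lborel (\<lambda>\<tau>. indicator (cbox (a n) (b n)) \<tau> *\<^sub>R ?f X \<tau>)"
      by (rule borel_integrable_compact[OF compact_cbox]) (intro continuous_intros cont)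
    have "L n X = (LINT \<tau>|lborel. indicator (cbox (a n) (b n)) \<tau> *\<^sub>R ?f X \<tau>)"
      unfolding L_def using set_borel_integral_eq_integral(2)[of "cbox (a n) (b n)" "?f X"] iT
      by (simp add: set_integrable_def set_lebesgue_integral_def)
    then have "laplace_int X - L n X = (LINT \<tau>|lborel. indicator {1<..} \<tau> *\<^sub>R ?f X \<tau> - indicator (cbox (a n) (b n)) \<tau> *\<^sub>R ?f X \<tau>)"
      unfolding laplace_int_def using iS iT by simp
    also have "norm \<dots> \<le> e n" unfolding e_def
    proof (rule Bochner_Integration.integral_norm_bound_integral)
      fix \<tau> :: real
      show "norm (indicator {1<..} \<tau> *\<^sub>R ?f X \<tau> - indicator (cbox (a n) (b n)) \<tau> *\<^sub>R ?f X \<tau>) \<le> indicator ({1<..} - {a n..b n}) \<tau> * (exp 1 * exp (- 1 * \<bar>\<tau> - 1\<bar>))"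
        using norm_laplace_int_integrand[of \<tau> X] laplace_weight_le[of "Re X" \<tau>] a1[of n] X
        by (auto simp: indicator_def split: if_splits)
    qed (use iS iT ii in auto)
    finally show ?thesis .
  qed
  show "\<exists>d>0. cball X d \<subseteq> {X. 0 < Re X} \<and> uniform_limit (cball X d) L laplace_int sequentially"
    if "X \<in> {X. 0 < Re X}" for X
  proof -
    define d where "d = Re X / 2"
    have d: "0 < d" "cball X d \<subseteq> {X. 0 < Re X}"
    proof -
      show "0 < d" using that by (simp add: d_def)
      show "cball X d \<subseteq> {X. 0 < Re X}"
      proof
        fix x assume "x \<in> cball X d"
        then have "\<bar>Re (X - x)\<bar> \<le> d" using abs_Re_le_cmod[of "X - x"] by (simp add: dist_norm)
        then have "Re X - Re x \<le> d" by simp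
        then show "x \<in> {X. 0 < Re X}" using \<open>0 < d\<close> by (simp add: d_def)
      qed
    qed
    have "uniform_limit (cball X d) L laplace_int sequentially"
    proof (rule uniform_limitI)
      fix \<epsilon> :: real assume "0 < \<epsilon>"
      then have "\<forall>\<^sub>F n in sequentially. e n < \<epsilon>" using e0 by (intro order_tendstoD)
      then show "\<forall>\<^sub>F n in sequentially. \<forall>x\<in>cball X d. dist (L n x) (laplace_int x) < \<epsilon>"
      proof eventually_elim
        case (elim n)
        show ?case
        proof
          fix x assume "x \<in> cball X d"
          then have "0 < Re x" using d by blast
          then have "norm (laplace_int x - L n x) < \<epsilon>" using diff[of x n] elim by linarith
          then show "dist (L n x) (laplace_int x) < \<epsilon>" by (simp add: dist_norm norm_minus_commute)
        qed
      qed
    qed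
    then show ?thesis using d by (intro exI[of _ d] conjI)
  qed
qed

text \<open>The denominator has a simple zero with derivative \<open>2 * pi * \<i>\<close> at
  \<open>k\<close> and no other zero in the open box, so the residue theorem on a unit-width
  rectangle returns \<open>g\<close> at \<open>k\<close>. The vertical sides lie at half-integers
  and are kept as differences of \<open>V\<close>, so that they telescope when summed. The height
  \<open>Z > Y\<close> leaves an open neighbourhood of the rectangle; the continuity claims
  guarantee that the side integrals exist.\<close>

lemma integer_point_contour:
  fixes g :: "complex \<Rightarrow> complex" and k :: nat
  assumes Y: "0 < Y" "Y < Z"
    and g: "g holomorphic_on {z. real k - 1 < Re z \<and> Re z < real k + 1 \<and> \<bar>Im z\<bar> < Z}"
  defines "G \<equiv> \<lambda>z. g z / (exp (2 * pi * \<i> * z) - 1)"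
  defines "V \<equiv> \<lambda>x. contour_integral (linepath (Complex x (- Y)) (Complex x Y)) G"
  shows "g (of_nat k) = contour_integral (linepath (Complex (real k - 1/2) (- Y)) (Complex (real k + 1/2) (- Y))) G
     + contour_integral (linepath (Complex (real k + 1/2) Y) (Complex (real k - 1/2) Y)) G
     + V (real k + 1/2) - V (real k - 1/2)"
    "continuous_on (closed_segment (Complex (real k - 1/2) (- Y)) (Complex (real k + 1/2) (- Y))) G"
    "continuous_on (closed_segment (Complex (real k + 1/2) Y) (Complex (real k - 1/2) Y)) G"
    "continuous_on (closed_segment (Complex (real k + 1/2) (-Y)) (Complex (real k + 1/2) Y)) G"
    "continuous_on (closed_segment (Complex (real k - 1/2) (-Y)) (Complex (real k - 1/2) Y)) G"
proof -
  define S where "S = {z. real k - 1 < Re z \<and> Re z < real k + 1 \<and> \<bar>Im z\<bar> < Z}"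
  have Seq: "S = box (Complex (real k - 1) (- Z)) (Complex (real k + 1) Z)"
    by (auto simp: S_def in_box_complex_iff)
  have S: "open S" "connected S" unfolding Seq by (auto intro: convex_connected)
  have kS: "of_nat k \<in> S" using Y by (simp add: S_def)
  define h where "h = (\<lambda>z::complex. exp (2 * pi * \<i> * z) - 1)"
  have h0: "h z \<noteq> 0" if "z \<in> S - {of_nat k}" for z
  proof
    assume "h z = 0"
    then have "exp (2 * pi * \<i> * z) = 1" by (simp add: h_def)
    then obtain n :: int where "Re (2 * pi * \<i> * z) = 0" "Im (2 * pi * \<i> * z) = real_of_int (2 * n) * pi"
      unfolding exp_eq_1 by blast
    then have "Im z = 0" "Re z = real_of_int n" by auto
    moreover have "n = int k" using that \<open>Re z = real_of_int n\<close> by (auto simp: S_def)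
    ultimately have "z = of_nat k" by (simp add: complex_eq_iff)
    then show False using that by simp
  qed
  have gS: "g holomorphic_on S" using g by (simp add: S_def)
  have hol: "G holomorphic_on S - {of_nat k}"
    unfolding G_def using h0[unfolded h_def]
    by (intro holomorphic_intros holomorphic_on_subset[OF gS]) auto
  define \<gamma> where "\<gamma> = rectpath (Complex (real k - 1/2) (- Y)) (Complex (real k + 1/2) Y)"
  have im: "path_image \<gamma> \<subseteq> S - {of_nat k}"
    unfolding \<gamma>_def using Y by (subst path_image_rectpath) (auto simp: S_def)
  have e1: "exp (2 * pi * \<i> * of_nat k) = 1"
    unfolding exp_eq_1 by (auto intro!: exI[of _ "int k"])
  have hk: "h (of_nat k) = 0" using e1 by (simp add: h_def)
  have res: "residue G (of_nat k) = g (of_nat k) / (2 * pi * \<i>)"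
  proof (rule residue_simple'[OF S(1) kS hol])
    have "(h has_field_derivative 2 * pi * \<i>) (at (of_nat k))"
      unfolding h_def using e1 by (auto intro!: derivative_eq_intros)
    then have "((\<lambda>z. h z / (z - of_nat k)) \<longlongrightarrow> 2 * pi * \<i>) (at (of_nat k))"
      using hk by (simp add: has_field_derivative_iff)
    moreover have "(g \<longlongrightarrow> g (of_nat k)) (at (of_nat k))"
      using gS S kS by (metis continuous_on_eq_continuous_at holomorphic_on_imp_continuous_on isCont_def)
    ultimately have "((\<lambda>z. g z / (h z / (z - of_nat k))) \<longlongrightarrow> g (of_nat k) / (2 * pi * \<i>)) (at (of_nat k))"
      by (intro tendsto_divide) auto
    then show "((\<lambda>z. G z * (z - of_nat k)) \<longlongrightarrow> g (of_nat k) / (2 * pi * \<i>)) (at (of_nat k))"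
      by (simp add: G_def h_def)
  qed
  have contG: "continuous_on (S - {of_nat k}) G" using hol by (rule holomorphic_on_imp_continuous_on)
  have seg: "closed_segment (Complex (real k - 1/2) (- Y)) (Complex (real k + 1/2) (- Y)) \<subseteq> S - {of_nat k}"
    "closed_segment (Complex (real k + 1/2) Y) (Complex (real k - 1/2) Y) \<subseteq> S - {of_nat k}"
    "closed_segment (Complex (real k + 1/2) (-Y)) (Complex (real k + 1/2) Y) \<subseteq> S - {of_nat k}"
    "closed_segment (Complex (real k - 1/2) (-Y)) (Complex (real k - 1/2) Y) \<subseteq> S - {of_nat k}"
    using Y by (auto simp: S_def closed_segment_same_Re closed_segment_same_Im closed_segment_eq_real_ivl split: if_splits)
  show c1: "continuous_on (closed_segment (Complex (real k - 1/2) (- Y)) (Complex (real k + 1/2) (- Y))) G"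
    by (rule continuous_on_subset[OF contG seg(1)])
  show c2: "continuous_on (closed_segment (Complex (real k + 1/2) Y) (Complex (real k - 1/2) Y)) G"
    by (rule continuous_on_subset[OF contG seg(2)])
  show c3: "continuous_on (closed_segment (Complex (real k + 1/2) (-Y)) (Complex (real k + 1/2) Y)) G"
    by (rule continuous_on_subset[OF contG seg(3)])
  show c4: "continuous_on (closed_segment (Complex (real k - 1/2) (-Y)) (Complex (real k - 1/2) Y)) G"
    by (rule continuous_on_subset[OF contG seg(4)])
  have "contour_integral \<gamma> G = 2 * pi * \<i> * (\<Sum>p\<in>{of_nat k}. winding_number \<gamma> p * residue G p)"
  proof (rule Residue_theorem[OF S _ hol])
    show "\<forall>z. z \<notin> S \<longrightarrow> winding_number \<gamma> z = 0"
      unfolding \<gamma>_def using Y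
      by (intro allI impI winding_number_rectpath_outside) (auto simp: S_def in_cbox_complex_iff)
  qed (use im in \<open>auto simp: \<gamma>_def\<close>)
  also have "winding_number \<gamma> (of_nat k) = 1"
    unfolding \<gamma>_def using Y by (intro winding_number_rectpath) (auto simp: in_box_complex_iff)
  then have "2 * pi * \<i> * (\<Sum>p\<in>{of_nat k}. winding_number \<gamma> p * residue G p) = g (of_nat k)"
    by (simp add: res)
  finally have I: "contour_integral \<gamma> G = g (of_nat k)" .
  have c4': "continuous_on (closed_segment (Complex (real k - 1/2) Y) (Complex (real k - 1/2) (-Y))) G"
    using c4 by (simp add: closed_segment_commute)
  note ci = contour_integrable_continuous_linepath
  have "contour_integral \<gamma> G =
     contour_integral (linepath (Complex (real k - 1/2) (- Y)) (Complex (real k + 1/2) (- Y))) G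
     + (contour_integral (linepath (Complex (real k + 1/2) (-Y)) (Complex (real k + 1/2) Y)) G
     + (contour_integral (linepath (Complex (real k + 1/2) Y) (Complex (real k - 1/2) Y)) G
     + contour_integral (linepath (Complex (real k - 1/2) Y) (Complex (real k - 1/2) (-Y))) G))"
    unfolding \<gamma>_def rectpath_def Let_def
    by (simp add: ci[OF c1] ci[OF c2] ci[OF c3] ci[OF c4'] contour_integrable_joinI)
  moreover have "contour_integral (linepath (Complex (real k - 1/2) Y) (Complex (real k - 1/2) (-Y))) G = - V (real k - 1/2)"
    unfolding V_def using contour_integral_reverse_linepath[OF c4'] by simp
  ultimately show "g (of_nat k) = contour_integral (linepath (Complex (real k - 1/2) (- Y)) (Complex (real k + 1/2) (- Y))) G
     + contour_integral (linepath (Complex (real k + 1/2) Y) (Complex (real k - 1/2) Y)) G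
     + V (real k + 1/2) - V (real k - 1/2)"
    using I by (simp add: V_def)
qed

text \<open>The numerator is the modulus of \<open>exp (\<i> * \<theta> * z)\<close>. On the upper
  line it decays and the denominator is bounded below. On the lower line it grows like
  \<open>exp (Y * \<theta>)\<close>, but the denominator grows like \<open>exp (2 * pi * Y)\<close>,
  leaving \<open>exp (- (2 * pi - \<theta>) * Y)\<close>; this is where \<theta> \<le>
  \<open>pi\<close> is needed.\<close>

lemma summation_kernel_horizontal:
  assumes \<theta>: "0 \<le> \<theta>" "\<theta> \<le> pi" and Y: "1 \<le> Y" and z: "\<bar>Im z\<bar> = Y"
  shows "exp (- Im z * \<theta>) / cmod (exp (2 * pi * \<i> * z) - 1) \<le> 2 * exp (- Y * \<theta>)"
proof -
  have n: "cmod (exp (2 * pi * \<i> * z)) = exp (- 2 * pi * Im z)" by simp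
  have e6: "2 \<le> exp (2 * pi * Y)"
  proof -
    have "1 * 1 \<le> pi * Y" using Y pi_gt3 by (intro mult_mono) auto
    then show ?thesis using exp_ge_add_one_self[of "2 * pi * Y"] by linarith
  qed
  show ?thesis
  proof (cases "Im z \<ge> 0")
    case True
    then have iz: "Im z = Y" using z by simp
    have "1 - exp (- 2 * pi * Y) \<le> cmod (exp (2 * pi * \<i> * z) - 1)"
      using norm_triangle_ineq2[of 1 "exp (2 * pi * \<i> * z)"] n iz by (simp add: norm_minus_commute)
    moreover have "exp (- 2 * pi * Y) \<le> 1/2" using e6 by (simp add: exp_minus field_simps)
    ultimately have "1/2 \<le> cmod (exp (2 * pi * \<i> * z) - 1)" by linarith
    then have "exp (- Y * \<theta>) / cmod (exp (2 * pi * \<i> * z) - 1) \<le> exp (- Y * \<theta>) / (1/2)"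
      by (intro divide_left_mono) auto
    then show ?thesis by (simp add: iz mult.commute)
  next
    case False
    then have iz: "Im z = - Y" using z by simp
    have "exp (2 * pi * Y) - 1 \<le> cmod (exp (2 * pi * \<i> * z) - 1)"
      using norm_triangle_ineq2[of "exp (2 * pi * \<i> * z)" 1] n iz by simp
    then have h: "exp (2 * pi * Y) / 2 \<le> cmod (exp (2 * pi * \<i> * z) - 1)" using e6 by linarith
    have "exp (Y * \<theta>) / cmod (exp (2 * pi * \<i> * z) - 1) \<le> exp (Y * \<theta>) / (exp (2 * pi * Y) / 2)"
      using h e6 by (intro divide_left_mono mult_pos_pos) auto
    also have "\<dots> = 2 * exp (Y * \<theta> - 2 * pi * Y)" by (simp add: exp_diff)
    also have "Y * \<theta> - 2 * pi * Y \<le> - Y * \<theta>"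
      using mult_left_mono[OF \<theta>(2), of Y] Y by (simp add: algebra_simps)
    finally show ?thesis by (simp add: iz)
  qed
qed

text \<open>At half-integer real part \<open>exp (2 * pi * \<i> * z)\<close> is a negative real
  number, so no cancellation occurs in the denominator.\<close>

lemma summation_kernel_vertical:
  fixes k :: nat
  assumes \<theta>: "0 \<le> \<theta>" "\<theta> \<le> pi" and z: "Re z = real k + 1/2 \<or> Re z = real k - 1/2"
  shows "exp (- Im z * \<theta>) / cmod (exp (2 * pi * \<i> * z) - 1) \<le> 1"
proof -
  have "exp (2 * pi * \<i> * z) = of_real (exp (- 2 * pi * Im z)) * cis (2 * pi * Re z)"
    by (subst exp_eq_polar) simp
  also have "cis (2 * pi * Re z) = -1"
  proof -
    have "2 * pi * Re z = 2 * pi * real k + pi \<or> 2 * pi * Re z = 2 * pi * real k - pi"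
    proof (rule disjE[OF z])
      assume a: "Re z = real k + 1/2"
      show ?thesis unfolding a by (rule disjI1) (simp add: algebra_simps)
    next
      assume a: "Re z = real k - 1/2"
      show ?thesis unfolding a by (rule disjI2) (simp add: algebra_simps)
    qed
    moreover have "cis (2 * pi * real k) = 1"
      using cis_multiple_2pi[of "real k"] by simp
    ultimately show ?thesis
      by (auto simp: cis_mult[symmetric] cis_divide[symmetric])
  qed
  finally have "exp (2 * pi * \<i> * z) - 1 = - of_real (exp (- 2 * pi * Im z) + 1)" by simp
  then have n: "cmod (exp (2 * pi * \<i> * z) - 1) = exp (- 2 * pi * Im z) + 1"
    by (simp del: of_real_add add: norm_of_real abs_of_pos add_pos_pos)
  have "exp (- Im z * \<theta>) \<le> exp (- 2 * pi * Im z) + 1"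
  proof (cases "Im z \<ge> 0")
    case True
    then have "exp (- Im z * \<theta>) \<le> 1" using \<theta> by simp
    then show ?thesis by (simp add: add_increasing)
  next
    case False
    then have "(- Im z) * \<theta> \<le> (- Im z) * (2 * pi)" using \<theta> pi_gt_zero by (intro mult_left_mono) auto
    then have "exp (- Im z * \<theta>) \<le> exp (- 2 * pi * Im z)" by (simp add: mult_ac)
    then show ?thesis by linarith
  qed
  then show ?thesis unfolding n by (simp add: divide_le_eq add_pos_pos)
qed

text \<open>Analytic interpolation of \<open>1 / axis_moment n k\<close> in \<open>k\<close>: the
  quotient of factorials \<open>(k + n)! / k!\<close> becomes a Pochhammer symbol, hence a
  polynomial, and the Laplace integral is taken at the complex exponent
  \<open>z + n\<close>.\<close>

definition kernel_coeff :: "nat \<Rightarrow> complex \<Rightarrow> complex" where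
  "kernel_coeff n z = pochhammer (z + 1) n / (of_real (pi ^ n) * laplace_int (z + of_nat n))"

lemma norm_pochhammer_le:
  assumes "0 \<le> Re z" "\<bar>Im z\<bar> \<le> Re z + real n"
  shows "norm (pochhammer (z + 1) n) \<le> (2 * (Re z + real n)) ^ n"
proof -
  have "norm (pochhammer (z + 1) n) = (\<Prod>i<n. norm (z + 1 + of_nat i))"
    by (simp add: pochhammer_prod prod_norm atLeast0LessThan)
  also have "\<dots> \<le> (\<Prod>i<n. 2 * (Re z + real n))"
  proof (intro prod_mono conjI)
    fix i assume "i \<in> {..<n}"
    then have "i + 1 \<le> n" by simp
    then have i: "real i + 1 \<le> real n" by linarith
    have "norm (z + 1 + of_nat i) \<le> \<bar>Re (z + 1 + of_nat i)\<bar> + \<bar>Im (z + 1 + of_nat i)\<bar>" by (rule cmod_le)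
    also have "\<dots> \<le> 2 * (Re z + real n)" using assms i by simp
    finally show "norm (z + 1 + of_nat i) \<le> 2 * (Re z + real n)" .
  qed simp
  finally show ?thesis by simp
qed

lemma powr_minus_quarter:
  assumes "0 < X"
  shows "X ^ n / sqrt (sqrt X) = X powr (real n - 1/4)"
proof -
  have "sqrt (sqrt X) = X powr (1/4)"
    using assms by (simp add: powr_half_sqrt[symmetric] powr_powr)
  then show ?thesis using assms by (simp add: powr_diff powr_realpow)
qed

lemma two_div_pi_power_le: "(2 / pi) ^ n \<le> 1"
  using pi_gt3 by (intro power_le_one) auto

text \<open>Exactly the hypotheses of \<open>norm_laplace_int_ge\<close> for
  \<open>l = sqrt (Re z + n)\<close>, together with \<open>Re z >= 0\<close>: the condition
  \<open>512 <= l\<close> is squared, and \<open>l * sqrt l\<close> becomes a power 3/4 of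
  \<open>Re z + n\<close>.\<close>

definition coeff_region :: "nat \<Rightarrow> complex \<Rightarrow> bool" where
  "coeff_region n z \<longleftrightarrow> 0 \<le> Re z \<and> 512\<^sup>2 \<le> Re z + real n \<and>
     \<bar>Im z\<bar> \<le> sqrt (Re z + real n) * sqrt (sqrt (Re z + real n)) / 1024"

lemma coeff_region_laplace_int:
  assumes "coeff_region n z"
  defines "X \<equiv> Re z + real n"
  shows "exp (- 2 * sqrt X) * sqrt (sqrt X) / 16 \<le> norm (laplace_int (z + of_nat n))"
proof -
  have X: "512 \<le> sqrt X" "0 \<le> X" using assms by (auto simp: coeff_region_def intro!: real_le_rsqrt)
  have "Complex ((sqrt X)\<^sup>2) (Im z) = z + of_nat n" using X by (simp add: complex_eq_iff X_def)
  then show ?thesis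
    using norm_laplace_int_ge[OF X(1), of "Im z"] assms by (simp add: coeff_region_def)
qed

text \<open>In the region \<open>|Im z| <= X\<close>, so each Pochhammer factor is at most
  \<open>2 * X\<close>; the resulting \<open>2^n\<close> is absorbed by \<open>pi^n\<close>. The
  quarter power in the exponent is the width factor \<open>sqrt (sqrt X)\<close> of the Laplace
  integral.\<close>

lemma norm_kernel_coeff_le:
  assumes "coeff_region n z"
  defines "X \<equiv> Re z + real n"
  shows "norm (kernel_coeff n z) \<le> 16 * X powr (real n - 1/4) * exp (2 * sqrt X)"
proof -
  have X: "512\<^sup>2 \<le> X" "0 < X" "1 \<le> X" using assms by (auto simp: coeff_region_def)
  have "\<bar>Im z\<bar> \<le> sqrt X * sqrt (sqrt X) / 1024" using assms by (simp add: coeff_region_def)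
  also have "\<dots> \<le> sqrt X * sqrt (sqrt X)" using X by simp
  also have "sqrt X * sqrt (sqrt X) \<le> sqrt X * sqrt X"
    using X by (intro mult_left_mono real_sqrt_le_mono) (auto intro!: real_le_lsqrt simp: power2_eq_square)
  finally have "\<bar>Im z\<bar> \<le> X" using X by simp
  then have p: "norm (pochhammer (z + 1) n) \<le> (2 * X) ^ n"
    using norm_pochhammer_le[of z n] assms by (simp add: coeff_region_def)
  have l: "0 < exp (- 2 * sqrt X) * sqrt (sqrt X) / 16" using X by simp
  note L = coeff_region_laplace_int[OF assms(1), folded X_def]
  have "norm (kernel_coeff n z) = norm (pochhammer (z + 1) n) / (pi ^ n * norm (laplace_int (z + of_nat n)))"
    by (simp add: kernel_coeff_def norm_divide norm_mult norm_power)
  also have "\<dots> \<le> (2 * X) ^ n / (pi ^ n * (exp (- 2 * sqrt X) * sqrt (sqrt X) / 16))"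
    using p L l X by (intro frac_le mult_left_mono mult_pos_pos) auto
  also have "\<dots> = (2 / pi) ^ n * (16 * (X ^ n / sqrt (sqrt X)) * exp (2 * sqrt X))"
    by (simp add: power_mult_distrib power_divide exp_minus field_simps)
  also have "\<dots> \<le> 1 * (16 * (X ^ n / sqrt (sqrt X)) * exp (2 * sqrt X))"
    using X two_div_pi_power_le by (intro mult_right_mono) auto
  finally show ?thesis using powr_minus_quarter[OF X(2), of n] by simp
qed

text \<open>From \<open>ln (1 - s) <= - s\<close>; rewriting \<open>Re z\<close> as
  \<open>X - n\<close> in the exponent costs at most \<open>exp (real n)\<close>.\<close>

lemma norm_kernel_coeff_exp_le:
  assumes z: "coeff_region n z" and s: "0 < s" "s < 1"
  shows "norm (kernel_coeff n z * exp (z * (of_real (ln (1 - s)) + \<i> * of_real \<theta>)))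
     \<le> 16 * exp (real n) * saddle_term n s (Re z + real n) * exp (- Im z * \<theta>)"
proof -
  define X where "X = Re z + real n"
  have X: "0 \<le> Re z" using z by (simp add: coeff_region_def)
  have "ln (1 - s) \<le> - s" using ln_le_minus_one[of "1 - s"] s by simp
  then have "Re z * ln (1 - s) \<le> Re z * (- s)" using X by (intro mult_left_mono)
  also have "\<dots> = - s * X + s * real n" by (simp add: X_def algebra_simps)
  also have "\<dots> \<le> - s * X + 1 * real n" using s by (intro add_left_mono mult_right_mono) auto
  finally have e: "Re z * ln (1 - s) \<le> real n + - s * X" by simp
  have "norm (exp (z * (of_real (ln (1 - s)) + \<i> * of_real \<theta>))) = exp (Re z * ln (1 - s)) * exp (- Im z * \<theta>)"
    by (simp flip: exp_add)
  also have "\<dots> \<le> exp (real n + - s * X) * exp (- Im z * \<theta>)" using e by (intro mult_right_mono) auto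
  finally have "norm (kernel_coeff n z * exp (z * (of_real (ln (1 - s)) + \<i> * of_real \<theta>)))
     \<le> (16 * X powr (real n - 1/4) * exp (2 * sqrt X)) * (exp (real n + - s * X) * exp (- Im z * \<theta>))"
    unfolding norm_mult using norm_kernel_coeff_le[OF z] by (intro mult_mono) (auto simp: X_def)
  also have "\<dots> = 16 * exp (real n) * saddle_term n s X * exp (- Im z * \<theta>)"
    by (simp add: saddle_term_def exp_diff exp_add exp_minus field_simps)
  finally show ?thesis by (simp add: X_def)
qed

text \<open>The lower bound \<open>coeff_region_laplace_int\<close> excludes zeros of the
  denominator.\<close>

lemma kernel_coeff_holomorphic:
  assumes "open S" "\<And>z. z \<in> S \<Longrightarrow> coeff_region n z"
  shows "kernel_coeff n holomorphic_on S"
proof -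
  have re: "0 < Re z + real n" "0 < sqrt (sqrt (Re z + real n))" if "z \<in> S" for z
    using assms(2)[OF that] by (auto simp: coeff_region_def)
  have "(\<lambda>z. laplace_int (z + of_nat n)) holomorphic_on S"
    using holomorphic_on_compose_gen[OF _ laplace_int_holomorphic, of "\<lambda>z. z + of_nat n" S] re(1)
    by (simp add: o_def image_subset_iff holomorphic_intros)
  moreover have "laplace_int (z + of_nat n) \<noteq> 0" if "z \<in> S" for z
  proof
    assume "laplace_int (z + of_nat n) = 0"
    then have "exp (- 2 * sqrt (Re z + real n)) * sqrt (sqrt (Re z + real n)) \<le> 0"
      using coeff_region_laplace_int[OF assms(2)[OF that]] by simp
    moreover have "0 < exp (- 2 * sqrt (Re z + real n)) * sqrt (sqrt (Re z + real n))"
      using re[OF that] by (intro mult_pos_pos) auto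
    ultimately show False by linarith
  qed
  ultimately show ?thesis
    unfolding kernel_coeff_def pochhammer_prod by (intro holomorphic_intros) auto
qed

text \<open>Lets the values at real points of a rectangle be replaced by the value at a nearby
  larger integer, at the price of a constant uniform in \<open>s\<close>.\<close>

lemma saddle_term_shift:
  assumes "0 \<le> x" "x \<le> y" "y \<le> x + 2" "0 < s" "s \<le> 1" "1 \<le> n"
  shows "saddle_term n s x \<le> exp 2 * saddle_term n s y"
proof -
  have "s * (y - x) \<le> 1 * 2" using assms by (intro mult_mono) auto
  moreover have "sqrt x \<le> sqrt y" using assms by simp
  moreover have "s * (y - x) = s * y - s * x" by (simp add: algebra_simps)
  ultimately have "2 * sqrt x - s * x \<le> 2 + (2 * sqrt y - s * y)" by linarith
  then have "exp (2 * sqrt x - s * x) \<le> exp 2 * exp (2 * sqrt y - s * y)" by (simp flip: exp_add)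
  moreover have "x powr (real n - 1/4) \<le> y powr (real n - 1/4)" using assms by (intro powr_mono2) auto
  ultimately have "x powr (real n - 1/4) * exp (2 * sqrt x - s * x) \<le> y powr (real n - 1/4) * (exp 2 * exp (2 * sqrt y - s * y))"
    by (intro mult_mono) auto
  then show ?thesis by (simp add: saddle_term_def mult_ac)
qed

text \<open>Adding \<open>integer_point_contour\<close> over consecutive \<open>k\<close> cancels
  all inner vertical sides. The horizontal sides carry the gain \<open>exp (- Y * \<theta>)\<close>.
  The two outer vertical sides have no such gain: the left one lies below the peak, where the terms
  are small, and the right one disappears as \<open>N\<close> grows. The region is required up to
  height \<open>2 * Y\<close> because the lemma needs room around the rectangles.\<close>

lemma tail_sum_bound:
  fixes n m N :: nat and s \<theta> Y :: real
  defines "g \<equiv> \<lambda>z. kernel_coeff n z * exp (z * (of_real (ln (1 - s)) + \<i> * of_real \<theta>))"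
  assumes n: "1 \<le> n" and s: "0 < s" "s < 1" and \<theta>: "0 \<le> \<theta>" "\<theta> \<le> pi" and Y: "1 \<le> Y" and m: "1 \<le> m"
    and reg: "\<And>z. real m - 1 < Re z \<Longrightarrow> \<bar>Im z\<bar> < 2 * Y \<Longrightarrow> coeff_region n z"
  shows "norm (\<Sum>k\<in>{m..<m+N}. g (of_nat k)) \<le>
     64 * exp (real n + 2) * exp (- Y * \<theta>) * (\<Sum>k\<in>{m..<m+N}. saddle_term n s (real (k + n + 1)))
     + 32 * exp (real n) * Y * saddle_term n s (real m - 1/2 + real n)
     + 32 * exp (real n + 2) * Y * saddle_term n s (real (m + N + n))"
proof -
  define G where "G = (\<lambda>z. g z / (exp (2 * pi * \<i> * z) - 1))"
  define V where "V = (\<lambda>x. contour_integral (linepath (Complex x (- Y)) (Complex x Y)) G)"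
  define A where "A = (\<lambda>k::nat. contour_integral (linepath (Complex (real k - 1/2) (- Y)) (Complex (real k + 1/2) (- Y))) G)"
  define B where "B = (\<lambda>k::nat. contour_integral (linepath (Complex (real k + 1/2) Y) (Complex (real k - 1/2) Y)) G)"
  have gb: "norm (g z) \<le> 16 * exp (real n) * saddle_term n s (Re z + real n) * exp (- Im z * \<theta>)"
    if "real m - 1 < Re z" "\<bar>Im z\<bar> < 2 * Y" for z
    unfolding g_def by (rule norm_kernel_coeff_exp_le[OF reg[OF that] s])
  have Gb: "norm (G z) \<le> 16 * exp (real n) * saddle_term n s (Re z + real n) * K"
    if "real m - 1 < Re z" "\<bar>Im z\<bar> < 2 * Y" "exp (- Im z * \<theta>) / cmod (exp (2 * pi * \<i> * z) - 1) \<le> K" for z K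
  proof -
    have "norm (G z) \<le> (16 * exp (real n) * saddle_term n s (Re z + real n) * exp (- Im z * \<theta>)) / cmod (exp (2 * pi * \<i> * z) - 1)"
      unfolding G_def norm_divide using gb[OF that(1,2)] by (intro divide_right_mono) auto
    also have "\<dots> = 16 * exp (real n) * saddle_term n s (Re z + real n) * (exp (- Im z * \<theta>) / cmod (exp (2 * pi * \<i> * z) - 1))" by simp
    also have "\<dots> \<le> 16 * exp (real n) * saddle_term n s (Re z + real n) * K"
      using that(3) saddle_term_nonneg by (intro mult_left_mono) auto
    finally show ?thesis .
  qed
  have hol: "g holomorphic_on {z. real k - 1 < Re z \<and> Re z < real k + 1 \<and> \<bar>Im z\<bar> < 2 * Y}" if "m \<le> k" for k :: nat
    unfolding g_def
  proof (intro holomorphic_intros kernel_coeff_holomorphic)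
    have "{z. real k - 1 < Re z \<and> Re z < real k + 1 \<and> \<bar>Im z\<bar> < 2 * Y} = box (Complex (real k - 1) (- (2 * Y))) (Complex (real k + 1) (2 * Y))"
      by (auto simp: in_box_complex_iff)
    then show "open {z. real k - 1 < Re z \<and> Re z < real k + 1 \<and> \<bar>Im z\<bar> < 2 * Y}" by (simp only: open_box)
  qed (use that in \<open>auto intro!: reg\<close>)
  have Y0: "0 < Y" "Y < 2 * Y" using Y by auto
  note ipc = integer_point_contour[OF Y0 hol, folded G_def, folded V_def A_def B_def]
  have gk: "g (of_nat k) = A k + B k + V (real k + 1/2) - V (real k - 1/2)" if "m \<le> k" for k
    using ipc(1)[OF that] unfolding A_def B_def V_def .
  \<comment> \<open>The shift by \<open>n + 1\<close> makes the comparison point an integer to the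
    right of the whole rectangle, at distance less than 2.\<close>
  have bsh: "saddle_term n s (Re z + real n) \<le> exp 2 * saddle_term n s (real (k + n + 1))"
    if "m \<le> k" "real k - 1/2 \<le> Re z" "Re z \<le> real k + 1/2" for z and k :: nat
    using that s n m by (intro saddle_term_shift) auto
  define T where "T = (\<lambda>k::nat. 32 * exp (real n + 2) * exp (- Y * \<theta>) * saddle_term n s (real (k + n + 1)))"
  have Hb: "norm (G z) \<le> T k" if "m \<le> k" "real k - 1/2 \<le> Re z" "Re z \<le> real k + 1/2" "\<bar>Im z\<bar> = Y" for z k
  proof -
    have "norm (G z) \<le> 16 * exp (real n) * saddle_term n s (Re z + real n) * (2 * exp (- Y * \<theta>))"
      using that Y by (intro Gb summation_kernel_horizontal \<theta>) auto
    also have "\<dots> \<le> 16 * exp (real n) * (exp 2 * saddle_term n s (real (k + n + 1))) * (2 * exp (- Y * \<theta>))"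
      using bsh[OF that(1-3)] by (intro mult_right_mono mult_left_mono) auto
    also have "\<dots> = T k" by (simp add: T_def exp_add)
    finally show ?thesis .
  qed
  have T0: "0 \<le> T k" for k by (simp add: T_def saddle_term_nonneg)
  have Ab: "norm (A k) \<le> T k" if k: "m \<le> k" for k
  proof -
    have "norm (A k) \<le> T k * norm (Complex (real k + 1/2) (- Y) - Complex (real k - 1/2) (- Y))"
    proof (rule has_contour_integral_bound_linepath)
      show "(G has_contour_integral A k) (linepath (Complex (real k - 1/2) (- Y)) (Complex (real k + 1/2) (- Y)))"
        unfolding A_def using ipc(2)[OF k] by (intro has_contour_integral_integral contour_integrable_continuous_linepath)
      show "norm (G z) \<le> T k" if "z \<in> closed_segment (Complex (real k - 1/2) (- Y)) (Complex (real k + 1/2) (- Y))" for z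
        using that Y k by (intro Hb) (auto simp: closed_segment_same_Im closed_segment_eq_real_ivl)
    qed (rule T0)
    also have "Complex (real k + 1/2) (- Y) - Complex (real k - 1/2) (- Y) = 1" by (simp add: complex_eq_iff)
    finally show ?thesis by simp
  qed
  have Bb: "norm (B k) \<le> T k" if k: "m \<le> k" for k
  proof -
    have "norm (B k) \<le> T k * norm (Complex (real k - 1/2) Y - Complex (real k + 1/2) Y)"
    proof (rule has_contour_integral_bound_linepath)
      show "(G has_contour_integral B k) (linepath (Complex (real k + 1/2) Y) (Complex (real k - 1/2) Y))"
        unfolding B_def using ipc(3)[OF k] by (intro has_contour_integral_integral contour_integrable_continuous_linepath)
      show "norm (G z) \<le> T k" if "z \<in> closed_segment (Complex (real k + 1/2) Y) (Complex (real k - 1/2) Y)" for z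
        using that Y k by (intro Hb) (auto simp: closed_segment_same_Im closed_segment_eq_real_ivl split: if_splits)
    qed (rule T0)
    also have "Complex (real k - 1/2) Y - Complex (real k + 1/2) Y = -1" by (simp add: complex_eq_iff)
    finally show ?thesis by simp
  qed
  have Vb: "norm (V x) \<le> (16 * exp (real n) * saddle_term n s (x + real n)) * (2 * Y)"
    if k: "m \<le> k" and x: "x = real k + 1/2 \<or> x = real k - 1/2" for x and k :: nat
  proof -
    have "norm (V x) \<le> (16 * exp (real n) * saddle_term n s (x + real n)) * norm (Complex x Y - Complex x (- Y))"
    proof (rule has_contour_integral_bound_linepath)
      have "continuous_on (closed_segment (Complex x (- Y)) (Complex x Y)) G"
        using x ipc(4,5)[OF k] by auto
      then show "(G has_contour_integral V x) (linepath (Complex x (- Y)) (Complex x Y))"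
        unfolding V_def by (intro has_contour_integral_integral contour_integrable_continuous_linepath)
      show "norm (G z) \<le> 16 * exp (real n) * saddle_term n s (x + real n)"
        if z: "z \<in> closed_segment (Complex x (- Y)) (Complex x Y)" for z
      proof -
        have rz: "Re z = x" "\<bar>Im z\<bar> \<le> Y"
          using z Y by (auto simp: closed_segment_same_Re closed_segment_eq_real_ivl)
        have "exp (- Im z * \<theta>) / cmod (exp (2 * pi * \<i> * z) - 1) \<le> 1"
          using rz x by (intro summation_kernel_vertical[OF \<theta>, of z k]) simp
        then show ?thesis using Gb[of z 1] rz Y x k by auto
      qed
    qed (simp add: saddle_term_nonneg)
    also have "Complex x Y - Complex x (- Y) = of_real (2 * Y) * \<i>" by (simp add: complex_eq_iff)
    also have "norm (of_real (2 * Y) * \<i>) = 2 * Y" unfolding norm_mult norm_of_real using Y by simp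
    finally show ?thesis .
  qed
  \<comment> \<open>Consecutive rectangles share the side at \<open>k + 1/2\<close>.\<close>
  have tel: "(\<Sum>k\<in>{m..<m+N}. g (of_nat k)) = (\<Sum>k\<in>{m..<m+N}. A k + B k) + V (real (m + N) - 1/2) - V (real m - 1/2)"
  proof (induction N)
    case (Suc N)
    have "V (real (m + N) + 1/2) = V (real (m + Suc N) - 1/2)" by (simp add: algebra_simps)
    then show ?case using Suc gk[of "m + N"] by simp
  qed simp
  have V1: "norm (V (real (m + N) - 1/2)) \<le> 32 * exp (real n + 2) * Y * saddle_term n s (real (m + N + n))"
  proof -
    have "norm (V (real (m + N) - 1/2)) \<le> (16 * exp (real n) * saddle_term n s (real (m + N) - 1/2 + real n)) * (2 * Y)"
      by (rule Vb[of "m + N"]) auto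
    also have "\<dots> \<le> (16 * exp (real n) * (exp 2 * saddle_term n s (real (m + N + n)))) * (2 * Y)"
      using Y s n m by (intro mult_right_mono mult_left_mono saddle_term_shift) auto
    also have "\<dots> = 32 * exp (real n + 2) * Y * saddle_term n s (real (m + N + n))" by (simp add: exp_add)
    finally show ?thesis .
  qed
  have V2: "norm (V (real m - 1/2)) \<le> 32 * exp (real n) * Y * saddle_term n s (real m - 1/2 + real n)"
    using Vb[of m "real m - 1/2"] by (simp add: mult_ac)
  have "norm (\<Sum>k\<in>{m..<m+N}. A k + B k) \<le> (\<Sum>k\<in>{m..<m+N}. T k + T k)"
    using Ab Bb by (intro sum_norm_le order_trans[OF norm_triangle_ineq] add_mono) auto
  also have "\<dots> = 64 * exp (real n + 2) * exp (- Y * \<theta>) * (\<Sum>k\<in>{m..<m+N}. saddle_term n s (real (k + n + 1)))"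
    unfolding T_def sum_distrib_left by (intro sum.cong) auto
  finally have "norm (\<Sum>k\<in>{m..<m+N}. A k + B k) \<le> 64 * exp (real n + 2) * exp (- Y * \<theta>) * (\<Sum>k\<in>{m..<m+N}. saddle_term n s (real (k + n + 1)))" .
  then show ?thesis unfolding tel using V1 V2
    norm_triangle_ineq4[of "(\<Sum>k\<in>{m..<m+N}. A k + B k) + V (real (m + N) - 1/2)" "V (real m - 1/2)"]
    norm_triangle_ineq[of "\<Sum>k\<in>{m..<m+N}. A k + B k" "V (real (m + N) - 1/2)"] by linarith
qed

section \<open>Growth of the kernel series\<close>

definition kernel_series :: "nat \<Rightarrow> complex \<Rightarrow> complex" where
  "kernel_series n t = (\<Sum>k. of_real (1 / axis_moment n k) * t ^ k)"

lemma integral_laplace_weight_pos: "1 \<le> x \<Longrightarrow> 0 < (LINT \<tau>|lborel. laplace_weight x \<tau>)"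
proof -
  assume "1 \<le> x"
  then have l: "1 \<le> sqrt x" "(sqrt x)\<^sup>2 = x" by auto
  have "0 < exp (- 2 * sqrt x) * sqrt (sqrt x) / 8" using l by simp
  also have "\<dots> \<le> (LINT \<tau>|lborel. laplace_weight x \<tau>)" using integral_laplace_weight_ge[OF l(1)] l(2) by simp
  finally show ?thesis .
qed

lemma axis_moment_pos: "1 \<le> n \<Longrightarrow> 0 < axis_moment n k"
  unfolding axis_moment_def by (intro mult_pos_pos divide_pos_pos integral_laplace_weight_pos) auto

lemma kernel_coeff_of_nat: "kernel_coeff n (of_nat k) = of_real (1 / axis_moment n k)"
proof -
  have "pochhammer (1::complex) (k + n) = pochhammer 1 k * pochhammer (1 + of_nat k) n"
    by (subst pochhammer_product[of k]) auto
  then have "pochhammer (of_nat k + 1 :: complex) n = fact (k + n) / fact k"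
    by (simp add: pochhammer_fact[symmetric] add.commute field_simps)
  moreover have "laplace_int (of_nat k + of_nat n) = of_real (LINT \<tau>|lborel. laplace_weight (real (k + n)) \<tau>)"
    using laplace_int_of_real[of "real (k + n)"] by simp
  ultimately show ?thesis by (simp add: kernel_coeff_def axis_moment_def)
qed

text \<open>At a real exponent nothing oscillates, so the one-window lower bound applies to every
  \<open>k\<close>, including the small ones that \<open>coeff_region\<close> excludes.\<close>

lemma inverse_axis_moment_le:
  assumes n: "1 \<le> n"
  shows "1 / axis_moment n k \<le> 8 * real (k + n) powr (real n - 1/4) * exp (2 * sqrt (real (k + n)))"
proof -
  define X where "X = real (k + n)"
  have X: "1 \<le> X" using n by (simp add: X_def)
  then have l: "1 \<le> sqrt X" "(sqrt X)\<^sup>2 = X" by auto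
  have L: "exp (- 2 * sqrt X) * sqrt (sqrt X) / 8 \<le> (LINT \<tau>|lborel. laplace_weight X \<tau>)"
    using integral_laplace_weight_ge[OF l(1)] l(2) by simp
  have L0: "0 < exp (- 2 * sqrt X) * sqrt (sqrt X) / 8" using l by simp
  have "cmod (pochhammer (of_nat k + 1) n) \<le> (2 * X) ^ n"
    using norm_pochhammer_le[of "of_nat k" n] by (simp add: X_def)
  moreover have "pochhammer (of_nat k + 1 :: complex) n = of_real (fact (k + n) / fact k)"
  proof -
    have "pochhammer (1::complex) (k + n) = pochhammer 1 k * pochhammer (1 + of_nat k) n"
      by (subst pochhammer_product[of k]) auto
    then show ?thesis by (simp add: pochhammer_fact[symmetric] add.commute field_simps)
  qed
  ultimately have p: "fact (k + n) / fact k \<le> (2 * X) ^ n" by (simp only: norm_of_real)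
  have "1 / axis_moment n k = (fact (k + n) / fact k) / (pi ^ n * (LINT \<tau>|lborel. laplace_weight X \<tau>))"
    by (simp add: axis_moment_def X_def)
  also have "\<dots> \<le> (2 * X) ^ n / (pi ^ n * (exp (- 2 * sqrt X) * sqrt (sqrt X) / 8))"
    using p L L0 X by (intro frac_le mult_left_mono mult_pos_pos) auto
  also have "\<dots> = (2 / pi) ^ n * (8 * (X ^ n / sqrt (sqrt X)) * exp (2 * sqrt X))"
    by (simp add: power_mult_distrib power_divide exp_minus field_simps)
  also have "\<dots> \<le> 1 * (8 * (X ^ n / sqrt (sqrt X)) * exp (2 * sqrt X))"
    using X two_div_pi_power_le by (intro mult_right_mono) auto
  also have "X ^ n / sqrt (sqrt X) = X powr (real n - 1/4)" using X by (intro powr_minus_quarter) simp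
  finally show ?thesis by (simp add: X_def)
qed

lemma kernel_series_term_le:
  assumes n: "1 \<le> n" and s: "0 < s" "s \<le> 1"
  shows "(1 - s) ^ k / axis_moment n k \<le> 8 * exp (real n) * saddle_term n s (real (k + n))"
proof -
  have "(1 - s) ^ k \<le> exp (- s) ^ k" using s exp_ge_add_one_self[of "- s"] by (intro power_mono) auto
  also have "\<dots> = exp (- s * real (k + n) + s * real n)"
    by (simp add: exp_of_nat_mult[symmetric] algebra_simps)
  also have "\<dots> \<le> exp (- s * real (k + n) + 1 * real n)" using s by (intro exp_le_cancel_iff[THEN iffD2] add_left_mono mult_right_mono) auto
  finally have e: "(1 - s) ^ k \<le> exp (- s * real (k + n)) * exp (real n)" by (simp only: exp_add) simp
  have "(1 - s) ^ k / axis_moment n k = (1 / axis_moment n k) * (1 - s) ^ k" by simp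
  also have "\<dots> \<le> (8 * real (k + n) powr (real n - 1/4) * exp (2 * sqrt (real (k + n)))) * (exp (- s * real (k + n)) * exp (real n))"
    using inverse_axis_moment_le[OF n] e s axis_moment_pos[OF n, of k] by (intro mult_mono) (auto simp: less_imp_le)
  also have "\<dots> = 8 * exp (real n) * (real (k + n) powr (real n - 1/4) * (exp (2 * sqrt (real (k + n))) * exp (- s * real (k + n))))"
    by (simp only: mult_ac)
  also have "exp (2 * sqrt (real (k + n))) * exp (- s * real (k + n)) = exp (2 * sqrt (real (k + n)) - s * real (k + n))"
    by (subst exp_add[symmetric]) simp
  also have "8 * exp (real n) * (real (k + n) powr (real n - 1/4) * exp (2 * sqrt (real (k + n)) - s * real (k + n))) = 8 * exp (real n) * saddle_term n s (real (k + n))"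
    by (simp only: saddle_term_def)
  finally show ?thesis .
qed

lemma saddle_term_sum_shift:
  assumes n: "1 \<le> n" and s: "0 < s" "s \<le> 1"
  shows "summable (\<lambda>k. saddle_term n s (real (k + m)))" "(\<Sum>k. saddle_term n s (real (k + m))) \<le> (\<Sum>j. saddle_term n s (real j))"
proof -
  note S = saddle_term_sum(1)[OF n s]
  show "summable (\<lambda>k. saddle_term n s (real (k + m)))"
    using S by (rule summable_ignore_initial_segment)
  show "(\<Sum>k. saddle_term n s (real (k + m))) \<le> (\<Sum>j. saddle_term n s (real j))"
    using suminf_split_initial_segment[OF S, of m] by (simp add: sum_nonneg saddle_term_nonneg)
qed

lemma norm_kernel_series_term:
  fixes t :: complex
  assumes "1 \<le> n"
  shows "norm (of_real (1 / axis_moment n k) * t ^ k) = norm t ^ k / axis_moment n k"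
  unfolding norm_mult norm_of_real norm_power using axis_moment_pos[OF assms, of k] by simp

lemma kernel_series_summable:
  fixes t :: complex
  assumes n: "1 \<le> n" and t: "norm t < 1"
  shows "summable (\<lambda>k. norm (of_real (1 / axis_moment n k) * t ^ k))"
proof -
  define s where "s = 1 - norm t"
  have s: "0 < s" "s \<le> 1" "norm t = 1 - s" using t by (auto simp: s_def)
  have S: "summable (\<lambda>k. 8 * exp (real n) * saddle_term n s (real (k + n)))"
    by (intro summable_mult saddle_term_sum_shift[OF n s(1,2)])
  show ?thesis
    unfolding norm_kernel_series_term[OF n] s(3)
  proof (rule summable_comparison_test[OF _ S], intro exI allI impI)
    fix k
    have "0 \<le> (1 - s) ^ k / axis_moment n k" using s axis_moment_pos[OF n, of k] by simp
    then show "norm ((1 - s) ^ k / axis_moment n k) \<le> 8 * exp (real n) * saddle_term n s (real (k + n))"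
      using kernel_series_term_le[OF n s(1,2), of k] by simp
  qed
qed

text \<open>The bound by absolute values, without any gain in the phase; it serves when
  \<open>s\<close> is bounded away from 0.\<close>

lemma norm_kernel_series_crude:
  assumes n: "1 \<le> n" and s: "0 < s" "s \<le> 1" and t: "norm t = 1 - s"
  shows "norm (kernel_series n t) \<le> 8 * exp (real n) * (\<Sum>j. saddle_term n s (real j))"
proof -
  have t1: "norm t < 1" using s t by simp
  have S: "summable (\<lambda>k. 8 * exp (real n) * saddle_term n s (real (k + n)))"
    by (intro summable_mult saddle_term_sum_shift[OF n s])
  have "norm (kernel_series n t) \<le> (\<Sum>k. norm (of_real (1 / axis_moment n k) * t ^ k))"
    unfolding kernel_series_def by (rule summable_norm[OF kernel_series_summable[OF n t1]])
  also have "\<dots> \<le> (\<Sum>k. 8 * exp (real n) * saddle_term n s (real (k + n)))"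
    by (rule suminf_le[OF _ kernel_series_summable[OF n t1] S]) (simp only: norm_kernel_series_term[OF n] t kernel_series_term_le[OF n s])
  also have "\<dots> = 8 * exp (real n) * (\<Sum>k. saddle_term n s (real (k + n)))"
    by (intro suminf_mult saddle_term_sum_shift[OF n s])
  also have "\<dots> \<le> 8 * exp (real n) * (\<Sum>j. saddle_term n s (real j))"
    using saddle_term_sum_shift(2)[OF n s] by (intro mult_left_mono) auto
  finally show ?thesis .
qed

lemma cnj_kernel_series:
  assumes n: "1 \<le> n" and t: "norm t < 1"
  shows "cnj (kernel_series n t) = kernel_series n (cnj t)"
proof -
  have "(\<lambda>k. of_real (1 / axis_moment n k) * t ^ k) sums kernel_series n t"
    unfolding kernel_series_def using kernel_series_summable[OF n t] by (rule summable_sums[OF summable_norm_cancel])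
  then have "(\<lambda>k. cnj (of_real (1 / axis_moment n k) * t ^ k)) sums cnj (kernel_series n t)" by (simp only: sums_cnj)
  then have "(\<lambda>k. of_real (1 / axis_moment n k) * cnj t ^ k) sums cnj (kernel_series n t)" by simp
  then show ?thesis unfolding kernel_series_def by (simp add: sums_iff)
qed

text \<open>Used to trade one factor \<open>1/s\<close> for half of the exponential saving
  \<open>1/(16 s)\<close> below the peak.\<close>

lemma inverse_le_exp:
  fixes s :: real
  assumes "0 < s" shows "1 / s \<le> 32 * exp (1 / (32 * s))"
  using exp_ge_add_one_self[of "1 / (32 * s)"] assms by (simp add: field_simps)

text \<open>The oscillating bound; the terms with \<open>k < 1/(4s\<^sup>2)\<close> are exponentially small, the others are summed by
  moving the contour to height \<open>\<plusminus>1/(8192 s\<^sup>3\<^sup>/\<^sup>2)\<close>, which is where \<open>norm_laplace_int_ge\<close> still applies.\<close>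

lemma norm_kernel_series_oscillation:
  assumes n: "1 \<le> n" and s: "0 < s" "s \<le> 1 / (1024 * (real n + 1))" and \<theta>: "0 \<le> \<theta>" "\<theta> \<le> pi"
  shows "norm (kernel_series n (of_real (1 - s) * cis \<theta>)) \<le>
     64 * exp (real n + 2) * exp (- (1 / (8192 * (s * sqrt s))) * \<theta>) * (\<Sum>j. saddle_term n s (real j))
     + 512 * exp (real n) * exp (1/s - 1 / (32 * s)) / s ^ (2 * n + 1)"
proof -
  define t where "t = of_real (1 - s) * cis \<theta>"
  have s1: "s \<le> 1/1024" "s < 1" "s \<le> 1"
  proof -
    have "1 / (1024 * (real n + 1)) \<le> 1 / (1024 * 1)" by (intro divide_left_mono) auto
    then show "s \<le> 1/1024" using s(2) by linarith
    then show "s < 1" "s \<le> 1" by auto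
  qed
  have nt: "norm t = 1 - s" "norm t < 1" unfolding t_def norm_mult norm_of_real using s s1 by simp_all
  \<comment> \<open>The number 8192 is \<open>4 * 2 * 1024\<close>: for
    \<open>X >= 1/(4 s^2)\<close> the power \<open>X^(3/4)\<close> is at least
    \<open>1/(4 * (s * sqrt s))\<close>, so the doubled height \<open>2 * Y\<close> still satisfies
    the bound with 1024 in \<open>coeff_region\<close>.\<close>
  define Y where "Y = 1 / (8192 * (s * sqrt s))"
  \<comment> \<open>The cut is at half the saddle in the variable \<open>sqrt k\<close>: high enough
    for \<open>coeff_region\<close>, and low enough that \<open>m + n\<close> stays below the bound
    \<open>9 / (16 * s^2)\<close> of \<open>saddle_term_small\<close>. Both use that
    \<open>s\<close> is small compared with \<open>1/(n + 1)\<close>.\<close>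
  define m where "m = nat \<lceil>1 / (4 * s\<^sup>2)\<rceil>"
  have s2: "1024 * (real n + 1) \<le> 1 / s"
  proof -
    have "s * (1024 * (real n + 1)) \<le> 1 / (1024 * (real n + 1)) * (1024 * (real n + 1))"
      using s(2) by (rule mult_right_mono) simp
    then show ?thesis using s(1) by (simp add: pos_le_divide_eq mult.commute)
  qed
  have s3: "1048576 * (real n + 1) \<le> 1 / s\<^sup>2"
  proof -
    have "1024 * (1024 * (real n + 1)) \<le> (1/s) * (1/s)" using s1 s s2 by (intro mult_mono) (auto simp: field_simps)
    then show ?thesis by (simp add: power2_eq_square)
  qed
  have m: "1 / (4 * s\<^sup>2) \<le> real m" "real m \<le> 1 / (4 * s\<^sup>2) + 1"
  proof -
    show "1 / (4 * s\<^sup>2) \<le> real m" unfolding m_def by (rule real_nat_ceiling_ge)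
    have "0 \<le> 1 / (4 * s\<^sup>2)" by simp
    then have "0 \<le> \<lceil>1 / (4 * s\<^sup>2)\<rceil>" by linarith
    then have "real m = of_int \<lceil>1 / (4 * s\<^sup>2)\<rceil>" by (simp add: m_def)
    then show "real m \<le> 1 / (4 * s\<^sup>2) + 1" using ceiling_correct[of "1 / (4 * s\<^sup>2)"] by linarith
  qed
  have ms: "real m + real n \<le> 9 / (16 * s\<^sup>2)" "1 \<le> m"
  proof -
    define P where "P = 1 / s\<^sup>2"
    have q: "1 / (4 * s\<^sup>2) = P / 4" "9 / (16 * s\<^sup>2) = 9 * P / 16" by (auto simp: P_def)
    have "1048576 * (real n + 1) \<le> P" "0 \<le> real n" using s3 by (auto simp: P_def)
    then have P: "real n + 1 \<le> 5 * P / 16" "4 \<le> P" by (simp_all add: field_simps)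
    show "real m + real n \<le> 9 / (16 * s\<^sup>2)" using m(2) P unfolding q by linarith
    have "1 \<le> real m" using m(1) P unfolding q by linarith
    then show "1 \<le> m" by simp
  qed
  have ss: "s * sqrt s \<le> 1 / 8192"
  proof -
    have "sqrt s \<le> sqrt (1/1024)" using s1 by (intro real_sqrt_le_mono)
    also have "sqrt (1/1024) = 1/32" using real_sqrt_unique[of "1/32" "1/1024"] by (simp add: power2_eq_square)
    finally have "s * sqrt s \<le> (1/1024) * (1/32)" using s1 s by (intro mult_mono) auto
    then show ?thesis by simp
  qed
  have Y: "1 \<le> Y" using ss s by (simp add: Y_def field_simps)
  have reg: "coeff_region n z" if z: "real m - 1 < Re z" "\<bar>Im z\<bar> < 2 * Y" for z
  proof -
    define X where "X = Re z + real n"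
    have "real m \<le> X" using z n by (simp add: X_def)
    then have X: "1 / (4 * s\<^sup>2) \<le> X" using m by linarith
    then have "sqrt (1 / (4 * s\<^sup>2)) \<le> sqrt X" by (rule real_sqrt_le_mono)
    moreover have "sqrt (1 / (4 * s\<^sup>2)) = 1 / (2 * s)" using s by (simp add: real_sqrt_divide real_sqrt_mult)
    ultimately have l: "1 / (2 * s) \<le> sqrt X" by simp
    have "2 * Y * 1024 = 1 / (4 * (s * sqrt s))" by (simp add: Y_def)
    also have "\<dots> = 1 / (2 * s) * (1 / (2 * sqrt s))" by simp
    also have "\<dots> \<le> sqrt X * sqrt (sqrt X)"
    proof (intro mult_mono l)
      have "1 / (2 * sqrt s) \<le> sqrt (1 / (2 * s))"
        using s by (intro real_le_rsqrt) (simp add: power_divide power_mult_distrib field_simps)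
      also have "\<dots> \<le> sqrt (sqrt X)" using l by (rule real_sqrt_le_mono)
      finally show "1 / (2 * sqrt s) \<le> sqrt (sqrt X)" .
      have "0 < 1 / (2 * s)" using s by simp
      then show "0 \<le> sqrt X" using l by linarith
    qed (use s in auto)
    finally have "\<bar>Im z\<bar> \<le> sqrt X * sqrt (sqrt X) / 1024" using z by simp
    moreover have "512\<^sup>2 \<le> X" using X s3 by simp
    moreover have "0 \<le> Re z" using z ms by simp
    ultimately show ?thesis by (simp add: coeff_region_def X_def)
  qed
  define g where "g = (\<lambda>z. kernel_coeff n z * exp (z * (of_real (ln (1 - s)) + \<i> * of_real \<theta>)))"
  have gk: "g (of_nat k) = of_real (1 / axis_moment n k) * t ^ k" for k
  proof -
    have "exp (of_real (ln (1 - s)) + \<i> * of_real \<theta>) = t"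
      unfolding t_def using s1 by (simp add: exp_add exp_of_real cis_conv_exp[symmetric])
    then have "exp (of_nat k * (of_real (ln (1 - s)) + \<i> * of_real \<theta>)) = t ^ k"
      by (simp only: exp_of_nat_mult)
    then show ?thesis by (simp add: g_def kernel_coeff_of_nat)
  qed
  define \<Sigma> where "\<Sigma> = (\<Sum>j. saddle_term n s (real j))"
  note SB = saddle_term_sum(1)[OF n s(1) s1(3)]
  define E1 where "E1 = 64 * exp (real n + 2) * exp (- Y * \<theta>) * \<Sigma>"
  define E2 where "E2 = 32 * exp (real n) * Y * saddle_term n s (real m - 1/2 + real n)"
  have tail: "norm (\<Sum>k\<in>{m..<m+N}. of_real (1 / axis_moment n k) * t ^ k) \<le> E1 + E2 + 32 * exp (real n + 2) * Y * saddle_term n s (real (m + N + n))" for N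
  proof -
    have "(\<Sum>k\<in>{m..<m+N}. saddle_term n s (real (k + n + 1))) \<le> \<Sigma>"
    proof -
      have "(\<Sum>k\<in>{m..<m+N}. saddle_term n s (real (k + (n + 1)))) \<le> (\<Sum>k. saddle_term n s (real (k + (n + 1))))"
        by (rule sum_le_suminf[OF saddle_term_sum_shift(1)[OF n s(1) s1(3)]]) (auto simp: saddle_term_nonneg)
      also have "\<dots> \<le> \<Sigma>" unfolding \<Sigma>_def by (rule saddle_term_sum_shift(2)[OF n s(1) s1(3)])
      finally show ?thesis by (simp add: add.assoc)
    qed
    then have "64 * exp (real n + 2) * exp (- Y * \<theta>) * (\<Sum>k\<in>{m..<m+N}. saddle_term n s (real (k + n + 1))) \<le> E1"
      unfolding E1_def by (intro mult_left_mono) auto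
    then show ?thesis
      using tail_sum_bound[OF n s(1) s1(2) \<theta> Y ms(2) reg, of N] unfolding gk[symmetric] g_def E2_def by linarith
  qed
  have sm: "summable (\<lambda>k. of_real (1 / axis_moment n k) * t ^ k)"
    using kernel_series_summable[OF n nt(2)] by (rule summable_norm_cancel)
  have "(\<lambda>N. \<Sum>k<m+N. of_real (1 / axis_moment n k) * t ^ k) \<longlonglongrightarrow> kernel_series n t"
    unfolding kernel_series_def using LIMSEQ_ignore_initial_segment[OF summable_LIMSEQ[OF sm], of m] by (simp add: add.commute)
  then have lim1: "(\<lambda>N. norm (\<Sum>k<m+N. of_real (1 / axis_moment n k) * t ^ k)) \<longlonglongrightarrow> norm (kernel_series n t)"
    by (rule tendsto_norm)
  define H where "H = (\<Sum>k<m. norm (of_real (1 / axis_moment n k) * t ^ k))"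
  \<comment> \<open>The right vertical side vanishes as \<open>N\<close> tends to infinity, since
    the saddle terms are summable.\<close>
  have lim2: "(\<lambda>N. H + (E1 + E2 + 32 * exp (real n + 2) * Y * saddle_term n s (real (m + N + n)))) \<longlonglongrightarrow> H + (E1 + E2 + 32 * exp (real n + 2) * Y * 0)"
  proof (intro tendsto_intros)
    show "(\<lambda>N. saddle_term n s (real (m + N + n))) \<longlonglongrightarrow> 0"
      using summable_LIMSEQ_zero[OF saddle_term_sum_shift(1)[OF n s(1) s1(3), of "m + n"]] by (simp add: add_ac)
  qed
  have "norm (kernel_series n t) \<le> H + (E1 + E2 + 32 * exp (real n + 2) * Y * 0)"
  proof (rule tendsto_le[OF _ lim2 lim1])
    show "\<forall>\<^sub>F N in sequentially. norm (\<Sum>k<m+N. of_real (1 / axis_moment n k) * t ^ k) \<le> H + (E1 + E2 + 32 * exp (real n + 2) * Y * saddle_term n s (real (m + N + n)))"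
    proof (rule always_eventually, rule allI)
      fix N
      have "(\<Sum>k<m+N. of_real (1 / axis_moment n k) * t ^ k) = (\<Sum>k<m. of_real (1 / axis_moment n k) * t ^ k) + (\<Sum>k\<in>{m..<m+N}. of_real (1 / axis_moment n k) * t ^ k)"
        by (subst sum.atLeastLessThan_concat[symmetric, of 0 m "m+N", simplified atLeast0LessThan]) (auto simp: atLeast0LessThan)
      then have "norm (\<Sum>k<m+N. of_real (1 / axis_moment n k) * t ^ k) \<le> norm (\<Sum>k<m. of_real (1 / axis_moment n k) * t ^ k) + norm (\<Sum>k\<in>{m..<m+N}. of_real (1 / axis_moment n k) * t ^ k)"
        by (simp only: norm_triangle_ineq)
      also have "norm (\<Sum>k<m. of_real (1 / axis_moment n k) * t ^ k) \<le> H" unfolding H_def by (rule norm_sum)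
      finally show "norm (\<Sum>k<m+N. of_real (1 / axis_moment n k) * t ^ k) \<le> H + (E1 + E2 + 32 * exp (real n + 2) * Y * saddle_term n s (real (m + N + n)))"
        using tail[of N] by linarith
    qed
  qed simp
  then have main: "norm (kernel_series n t) \<le> E1 + (H + E2)" by simp
  define D where "D = exp (1/s - 1 / (16 * s)) / s ^ (2 * n)"
  have D0: "0 \<le> D" using s by (simp add: D_def)
  have ie: "(1 / s) * D \<le> 32 * exp (1/s - 1 / (32 * s)) / s ^ (2 * n)"
  proof -
    have "(1 / s) * D \<le> (32 * exp (1 / (32 * s))) * D" using inverse_le_exp[OF s(1)] D0 by (intro mult_right_mono)
    also have "\<dots> = 32 * (exp (1 / (32 * s)) * exp (1/s - 1 / (16 * s))) / s ^ (2 * n)" by (simp add: D_def)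
    also have "exp (1 / (32 * s)) * exp (1/s - 1 / (16 * s)) = exp (1 / (32 * s) + (1/s - 1 / (16 * s)))" by (simp only: exp_add)
    also have "1 / (32 * s) + (1/s - 1 / (16 * s)) = 1/s - 1 / (32 * s)" by (simp add: field_simps)
    finally show ?thesis .
  qed
  \<comment> \<open>There are at most \<open>1/s^2\<close> terms below the cut, each of the
    exponentially small size \<open>D\<close>. The left vertical side, of length
    \<open>2 * Y\<close>, obeys the same bound below.\<close>
  have H: "H \<le> (1 / s\<^sup>2) * (8 * exp (real n) * D)"
  proof -
    have "H \<le> (\<Sum>k<m. 8 * exp (real n) * D)"
      unfolding H_def
    proof (rule sum_mono)
      fix k assume "k \<in> {..<m}"
      then have "real (k + n) \<le> 9 / (16 * s\<^sup>2)" using ms by simp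
      then have "saddle_term n s (real (k + n)) \<le> D" unfolding D_def using n s s1 by (intro saddle_term_small) auto
      then have "8 * exp (real n) * saddle_term n s (real (k + n)) \<le> 8 * exp (real n) * D" by (intro mult_left_mono) auto
      then show "norm (of_real (1 / axis_moment n k) * t ^ k) \<le> 8 * exp (real n) * D"
        unfolding norm_kernel_series_term[OF n] nt using kernel_series_term_le[OF n s(1) s1(3), of k] by linarith
    qed
    also have "\<dots> = real m * (8 * exp (real n) * D)" by simp
    also have "\<dots> \<le> (1 / s\<^sup>2) * (8 * exp (real n) * D)"
    proof (rule mult_right_mono)
      have "9 / (16 * s\<^sup>2) \<le> 1 / s\<^sup>2" using s by (simp add: field_simps)
      then show "real m \<le> 1 / s\<^sup>2" using ms by linarith
    qed (use D0 in auto)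
    finally show ?thesis .
  qed
  have E2: "E2 \<le> (1 / s\<^sup>2) * (8 * exp (real n) * D)"
  proof -
    have "saddle_term n s (real m - 1/2 + real n) \<le> D" unfolding D_def using n s s1 ms by (intro saddle_term_small) auto
    moreover have "4 * Y \<le> 1 / s\<^sup>2"
    proof -
      have "s\<^sup>2 \<le> s * sqrt s" using s s1 unfolding power2_eq_square
        by (intro mult_left_mono real_le_rsqrt) (auto simp: power2_eq_square mult_left_le)
      then have "1 / (s * sqrt s) \<le> 1 / s\<^sup>2" using s by (intro divide_left_mono) auto
      moreover have "4 * Y = (1/2048) * (1 / (s * sqrt s))" by (simp add: Y_def)
      moreover have "0 \<le> 1 / (s * sqrt s)" using s by simp
      ultimately show ?thesis by linarith
    qed
    ultimately have "(4 * Y) * (8 * exp (real n) * saddle_term n s (real m - 1/2 + real n)) \<le> (1 / s\<^sup>2) * (8 * exp (real n) * D)"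
      using Y by (intro mult_mono) (auto simp: saddle_term_nonneg)
    then show ?thesis by (simp add: E2_def mult_ac)
  qed
  \<comment> \<open>Of the two factors \<open>1/s\<close> one enters the exponential through
    \<open>ie\<close>, the other raises the power of \<open>s\<close> to
    \<open>2 * n + 1\<close>.\<close>
  have "H + E2 \<le> (16 * exp (real n) / s) * ((1 / s) * D)"
  proof -
    have "(16 * exp (real n) / s) * ((1 / s) * D) = 2 * ((1 / s\<^sup>2) * (8 * exp (real n) * D))"
      by (simp add: power2_eq_square)
    then show ?thesis using H E2 by linarith
  qed
  also have "\<dots> \<le> (16 * exp (real n) / s) * (32 * exp (1/s - 1 / (32 * s)) / s ^ (2 * n))"
    using ie s by (intro mult_left_mono) auto
  also have "\<dots> = 512 * exp (real n) * exp (1/s - 1 / (32 * s)) / s ^ (2 * n + 1)" by simp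
  finally show ?thesis using main unfolding t_def[symmetric] E1_def \<Sigma>_def Y_def by simp
qed

section \<open>The reproducing property\<close>

lemma card_index_ge_1: "1 \<le> CARD('n::finite)"
  using zero_less_card_finite[where 'a = 'n] by linarith

text \<open>The cutoff is part of the weight so that all integrals run over the whole space; outside
  the closed ball \<open>psi\<close> is negative and \<open>exp (- psi w)\<close> would exceed
  1.\<close>

definition ball_weight :: "complex ^ 'n \<Rightarrow> real" where
  "ball_weight w = indicator (ball 0 1) w * exp (- psi w)"

lemma borel_measurable_psi [measurable]: "psi \<in> borel_measurable borel"
  unfolding psi_def[abs_def] by measurable

lemma borel_measurable_ball_weight [measurable]: "ball_weight \<in> borel_measurable borel"
  unfolding ball_weight_def[abs_def]
  by (intro borel_measurable_times borel_measurable_indicator) auto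

lemma borel_measurable_cnj [measurable]: "cnj \<in> borel_measurable borel"
  by (intro borel_measurable_continuous_onI continuous_intros)

lemma ball_weight_bounds: "0 \<le> ball_weight w" "ball_weight w \<le> indicator (ball 0 1) w"
  by (auto simp: ball_weight_def psi_def indicator_def abs_square_le_1 intro!: divide_nonneg_nonneg)

lemma ball_weight_cong_norm: "norm v = norm w \<Longrightarrow> ball_weight v = ball_weight w"
  by (simp add: ball_weight_def psi_def indicator_def)

lemma integrable_ball_weight: "integrable lborel (ball_weight :: complex ^ 'n \<Rightarrow> real)"
proof (rule Bochner_Integration.integrable_bound)
  show "integrable lborel (indicator (ball 0 1) :: complex ^ 'n \<Rightarrow> real)"
    using emeasure_lborel_ball_finite[of "0 :: complex ^ 'n" 1] by (intro integrable_real_indicator) auto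
  show "AE w in lborel. norm (ball_weight w) \<le> norm (indicator (ball (0 :: complex ^ 'n) 1) w :: real)"
  proof (rule AE_I2)
    fix w :: "complex ^ 'n"
    show "norm (ball_weight w) \<le> norm (indicator (ball 0 1) w :: real)"
      using ball_weight_bounds[of w] by simp
  qed
qed measurable

lemma continuous_on_bergman: "f \<in> bergman_space \<Longrightarrow> continuous_on (ball 0 1) f"
  unfolding bergman_space_def holomorphic_Cn_on_def
  by (auto simp: continuous_on_eq_continuous_at intro: has_derivative_continuous)

text \<open>Continuity is known only on the ball; the convention that \<open>f\<close> vanishes
  outside supplies the rest.\<close>

lemma borel_measurable_bergman: "f \<in> bergman_space \<Longrightarrow> f \<in> borel_measurable borel"
proof -
  assume f: "f \<in> bergman_space"
  have "(\<lambda>w. indicator (ball 0 1) w *\<^sub>R f w) \<in> borel_measurable borel"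
    by (rule borel_measurable_continuous_on_indicator[OF _ continuous_on_bergman[OF f]]) simp
  moreover have "(\<lambda>w. indicator (ball 0 1) w *\<^sub>R f w) = f"
    using f by (auto simp: bergman_space_def indicator_def fun_eq_iff)
  ultimately show ?thesis by simp
qed

lemma integrable_bergman_sq:
  "f \<in> bergman_space \<Longrightarrow> integrable lborel (\<lambda>w. ball_weight w * (cmod (f w))\<^sup>2)"
  unfolding bergman_space_def set_integrable_def ball_weight_def by (simp add: mult_ac)

lemma integrable_bergman_mult:
  assumes f: "f \<in> bergman_space" and g: "g \<in> bergman_space"
  shows "integrable lborel (\<lambda>w. of_real (ball_weight w) * (f w * cnj (g w)))"
proof (rule Bochner_Integration.integrable_bound)
  note [measurable] = borel_measurable_bergman[OF f] borel_measurable_bergman[OF g]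
  show "integrable lborel (\<lambda>w. ball_weight w * (cmod (f w))\<^sup>2 + ball_weight w * (cmod (g w))\<^sup>2)"
    using f g by (intro Bochner_Integration.integrable_add integrable_bergman_sq)
  show "(\<lambda>w. of_real (ball_weight w) * (f w * cnj (g w))) \<in> borel_measurable lborel" by measurable
  show "AE w in lborel. norm (of_real (ball_weight w) * (f w * cnj (g w))) \<le> norm (ball_weight w * (cmod (f w))\<^sup>2 + ball_weight w * (cmod (g w))\<^sup>2)"
  proof (rule AE_I2)
    fix w
    have "2 * (cmod (f w) * cmod (g w)) \<le> (cmod (f w))\<^sup>2 + (cmod (g w))\<^sup>2"
      using sum_squares_bound[of "cmod (f w)" "cmod (g w)"] by simp
    moreover have "0 \<le> cmod (f w) * cmod (g w)" by simp
    ultimately have "cmod (f w) * cmod (g w) \<le> (cmod (f w))\<^sup>2 + (cmod (g w))\<^sup>2" by linarith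
    then have "ball_weight w * (cmod (f w) * cmod (g w)) \<le> ball_weight w * ((cmod (f w))\<^sup>2 + (cmod (g w))\<^sup>2)"
      using ball_weight_bounds(1) by (intro mult_left_mono)
    then show "norm (of_real (ball_weight w) * (f w * cnj (g w))) \<le> norm (ball_weight w * (cmod (f w))\<^sup>2 + ball_weight w * (cmod (g w))\<^sup>2)"
      using ball_weight_bounds(1)[of w] by (simp add: norm_mult distrib_left abs_of_nonneg)
  qed
qed

lemma bergman_inner_eq:
  "bergman_inner f g = (LINT w|lborel. of_real (ball_weight w) * (f w * cnj (g w)))"
  unfolding bergman_inner_def set_lebesgue_integral_def
  by (intro Bochner_Integration.integral_cong) (auto simp: ball_weight_def scaleR_conv_of_real indicator_def)

lemma integrable_bergman:
  assumes f: "f \<in> bergman_space"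
  shows "integrable lborel (\<lambda>w. of_real (ball_weight w) * f w)"
proof (rule Bochner_Integration.integrable_bound)
  note [measurable] = borel_measurable_bergman[OF f]
  show "integrable lborel (\<lambda>w. ball_weight w + ball_weight w * (cmod (f w))\<^sup>2)"
    using f by (intro Bochner_Integration.integrable_add integrable_bergman_sq integrable_ball_weight)
  show "(\<lambda>w. of_real (ball_weight w) * f w) \<in> borel_measurable lborel" by measurable
  show "AE w in lborel. norm (of_real (ball_weight w) * f w) \<le> norm (ball_weight w + ball_weight w * (cmod (f w))\<^sup>2)"
  proof (rule AE_I2)
    fix w
    have "cmod (f w) \<le> 1 + (cmod (f w))\<^sup>2"
      using sum_power2_ge_zero[of "cmod (f w) - 1/2" 0] by (simp add: power2_eq_square algebra_simps)
    then have "ball_weight w * cmod (f w) \<le> ball_weight w * (1 + (cmod (f w))\<^sup>2)"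
      using ball_weight_bounds(1) by (intro mult_left_mono)
    then show "norm (of_real (ball_weight w) * f w) \<le> norm (ball_weight w + ball_weight w * (cmod (f w))\<^sup>2)"
      using ball_weight_bounds(1)[of w] by (simp add: norm_mult distrib_left abs_of_nonneg)
  qed
qed

text \<open>Fubini with invariance under each unitary map \<open>T x\<close>. The frequencies
  \<open>a\<close> and \<open>b\<close> decide which components rotate. Integrability of the average
  is part of the conclusion so that the lemma can be applied again to it.\<close>

lemma integral_slice_average:
  fixes e :: "complex ^ 'n" and \<Psi> A :: "complex ^ 'n \<Rightarrow> complex" and a b :: real
  assumes e: "norm e = 1" and \<Psi>: "integrable lborel \<Psi>"
  defines "T \<equiv> \<lambda>x. slice_scale e (cis (a * x)) (cis (b * x))"
  assumes A: "\<And>w. (LINT x|lborel. indicator {0..1} x *\<^sub>R \<Psi> (T x w)) = A w"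
  shows "integrable lborel A" "(LINT w|lborel. \<Psi> w) = (LINT w|lborel. A w)"
proof -
  have [measurable]: "\<Psi> \<in> borel_measurable borel" using \<Psi> by auto
  have Tm: "(\<lambda>p. T (fst p) (snd p)) \<in> borel_measurable (borel :: (real \<times> (complex ^ 'n)) measure)"
    unfolding T_def slice_scale_def by (intro borel_measurable_continuous_onI continuous_intros)
  then have Tm': "(\<lambda>p. T (fst p) (snd p)) \<in> borel_measurable (borel \<Otimes>\<^sub>M (borel :: (complex ^ 'n) measure))"
    unfolding borel_prod .
  have Tx [measurable]: "T x \<in> borel_measurable borel" for x
    unfolding T_def slice_scale_def by (intro borel_measurable_continuous_onI continuous_intros)
  have oT: "orthogonal_transformation (T x)" for x
    unfolding T_def by (rule orthogonal_slice_scale[OF e]) auto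
  let ?F = "\<lambda>x w. indicator {0..1} x *\<^sub>R \<Psi> (T x w)"
  have Fm: "case_prod ?F \<in> borel_measurable (borel \<Otimes>\<^sub>M (borel :: (complex ^ 'n) measure))"
  proof -
    have [measurable]: "(\<lambda>p. \<Psi> (T (fst p) (snd p))) \<in> borel_measurable (borel \<Otimes>\<^sub>M (borel :: (complex ^ 'n) measure))"
      by (rule measurable_compose[OF Tm']) measurable
    show ?thesis unfolding case_prod_unfold by measurable
  qed
  then have Fm': "case_prod ?F \<in> borel_measurable (lborel \<Otimes>\<^sub>M (lborel :: (complex ^ 'n) measure))" by simp
  have fin: "(\<integral>\<^sup>+w. ennreal (norm (\<Psi> w)) \<partial>lborel) < \<infinity>" using \<Psi> by (simp add: integrable_iff_bounded)
  have "(\<integral>\<^sup>+p. ennreal (norm (case_prod ?F p)) \<partial>(lborel \<Otimes>\<^sub>M lborel)) = (\<integral>\<^sup>+x. (\<integral>\<^sup>+w. ennreal (norm (?F x w)) \<partial>lborel) \<partial>lborel)"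
    using Fm' by (subst lborel.nn_integral_fst[symmetric]) auto
  also have "\<dots> = (\<integral>\<^sup>+x. indicator {0..1} x * (\<integral>\<^sup>+w. ennreal (norm (\<Psi> w)) \<partial>lborel) \<partial>(lborel :: real measure))"
  proof (rule nn_integral_cong)
    fix x :: real
    have "(\<integral>\<^sup>+w. ennreal (norm (?F x w)) \<partial>lborel) = (\<integral>\<^sup>+w. indicator {0..1} x * ennreal (norm (\<Psi> (T x w))) \<partial>lborel)"
      by (intro nn_integral_cong) (auto simp: indicator_def)
    also have "\<dots> = indicator {0..1} x * (\<integral>\<^sup>+w. ennreal (norm (\<Psi> (T x w))) \<partial>lborel)"
      by (rule nn_integral_cmult) measurable
    also have "(\<integral>\<^sup>+w. ennreal (norm (\<Psi> (T x w))) \<partial>lborel) = (\<integral>\<^sup>+w. ennreal (norm (\<Psi> w)) \<partial>lborel)"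
      by (rule nn_integral_lborel_orthogonal[OF oT]) measurable
    finally show "(\<integral>\<^sup>+w. ennreal (norm (?F x w)) \<partial>lborel) = indicator {0..1} x * (\<integral>\<^sup>+w. ennreal (norm (\<Psi> w)) \<partial>lborel)" .
  qed
  also have "\<dots> = (\<integral>\<^sup>+w. ennreal (norm (\<Psi> w)) \<partial>lborel)"
    by (subst nn_integral_multc) auto
  finally have "(\<integral>\<^sup>+p. ennreal (norm (case_prod ?F p)) \<partial>(lborel \<Otimes>\<^sub>M lborel)) < \<infinity>" using fin by simp
  then have int: "integrable (lborel \<Otimes>\<^sub>M lborel) (case_prod ?F)"
    using Fm' by (simp add: integrable_iff_bounded)
  have "integrable lborel (\<lambda>w. (LINT x|lborel. ?F x w))"
    using lborel_pair.integrable_snd[OF int] by simp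
  then show "integrable lborel A" unfolding A .
  have "(LINT w|lborel. A w) = (LINT w|lborel. (LINT x|lborel. ?F x w))" unfolding A ..
  also have "\<dots> = (LINT x|lborel. (LINT w|lborel. ?F x w))"
    by (rule lborel_pair.Fubini_integral[OF int])
  also have "\<dots> = (LINT x::real|lborel. indicator {0..1} x *\<^sub>R (LINT w|lborel. \<Psi> w))"
  proof (rule Bochner_Integration.integral_cong[OF refl])
    fix x :: real
    have "(LINT w|lborel. ?F x w) = indicator {0..1} x *\<^sub>R (LINT w|lborel. \<Psi> (T x w))" by simp
    also have "(LINT w|lborel. \<Psi> (T x w)) = (LINT w|distr lborel borel (T x). \<Psi> w)"
      by (rule integral_distr[symmetric]) measurable
    also have "\<dots> = (LINT w|lborel. \<Psi> w)" by (simp add: distr_lborel_orthogonal[OF oT])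
    finally show "(LINT w|lborel. ?F x w) = indicator {0..1} x *\<^sub>R (LINT w|lborel. \<Psi> w)" .
  qed
  also have "\<dots> = (LINT w|lborel. \<Psi> w)" by simp
  finally show "(LINT w|lborel. \<Psi> w) = (LINT w|lborel. A w)" ..
qed

text \<open>Cauchy's formula on the unit circle, where \<open>1/u\<close> is the conjugate of
  \<open>u\<close>; the conjugate is the form in which powers of \<open>cinner w e\<close> occur in
  the inner product.\<close>

lemma cauchy_coefficient:
  assumes h: "h holomorphic_on S" and S: "cball 0 1 \<subseteq> S"
  shows "(LINT x|lborel. indicator {0..1} x *\<^sub>R (h (cis (2 * pi * x)) * cnj (cis (2 * pi * x)) ^ k)) = (deriv ^^ k) h 0 / fact k"
proof -
  have c: "continuous_on (cball 0 1) h"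
    by (rule continuous_on_subset[OF holomorphic_on_imp_continuous_on[OF h] S])
  have ho: "h holomorphic_on ball 0 1" using S by (intro holomorphic_on_subset[OF h]) auto
  have "((\<lambda>u. h u / (u - 0) ^ Suc k) has_contour_integral (2 * pi * \<i>) / fact k * (deriv ^^ k) h 0) (circlepath 0 1)"
    by (rule Cauchy_has_contour_integral_higher_derivative_circlepath[OF c ho]) auto
  then have "((\<lambda>x. h (cis (2 * pi * x)) / cis (2 * pi * x) ^ Suc k * (2 * pi * \<i> * cis (2 * pi * x))) has_integral (2 * pi * \<i>) / fact k * (deriv ^^ k) h 0) {0..1}"
    unfolding has_contour_integral_def
  proof (rule has_integral_eq[rotated])
    fix x :: real assume "x \<in> {0..1}"
    then have "vector_derivative (circlepath 0 1) (at x within {0..1}) = 2 * pi * \<i> * cis (2 * pi * x)"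
      by (simp add: vector_derivative_circlepath01 cis_conv_exp mult_ac)
    moreover have "circlepath 0 1 x = cis (2 * pi * x)" by (simp add: circlepath cis_conv_exp mult_ac)
    ultimately show "h (circlepath 0 1 x) / (circlepath 0 1 x - 0) ^ Suc k * vector_derivative (circlepath 0 1) (at x within {0..1}) =
        h (cis (2 * pi * x)) / cis (2 * pi * x) ^ Suc k * (2 * pi * \<i> * cis (2 * pi * x))"
      by simp
  qed
  then have "((\<lambda>x. 1 / (2 * pi * \<i>) * (h (cis (2 * pi * x)) / cis (2 * pi * x) ^ Suc k * (2 * pi * \<i> * cis (2 * pi * x)))) has_integral 1 / (2 * pi * \<i>) * ((2 * pi * \<i>) / fact k * (deriv ^^ k) h 0)) {0..1}"
    by (rule has_integral_mult_right)
  moreover have "1 / (2 * pi * \<i>) * (h (cis (2 * pi * x)) / cis (2 * pi * x) ^ Suc k * (2 * pi * \<i> * cis (2 * pi * x))) = h (cis (2 * pi * x)) * cnj (cis (2 * pi * x)) ^ k" for x :: real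
  proof -
    define u where "u = cis (2 * pi * x)"
    have u0: "u \<noteq> 0" by (simp add: u_def)
    have "u * cnj u = 1" by (simp add: u_def cis_cnj cis_mult)
    then have "cnj u = 1 / u" using u0 by (simp add: eq_divide_eq mult.commute)
    then have "h u * cnj u ^ k = h u / u ^ k" by (simp add: power_one_over)
    moreover have "1 / (2 * pi * \<i>) * (h u / u ^ Suc k * (2 * pi * \<i> * u)) = h u / u ^ k" using u0 by simp
    ultimately show ?thesis by (simp add: u_def)
  qed
  ultimately have I: "((\<lambda>x. h (cis (2 * pi * x)) * cnj (cis (2 * pi * x)) ^ k) has_integral (deriv ^^ k) h 0 / fact k) {0..1}"
    by simp
  have "continuous_on {0..1} (\<lambda>x. h (cis (2 * pi * x)) * cnj (cis (2 * pi * x)) ^ k)"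
    by (intro continuous_intros continuous_on_compose2[OF c]) auto
  then have "set_integrable lborel {0..1} (\<lambda>x. h (cis (2 * pi * x)) * cnj (cis (2 * pi * x)) ^ k)"
    by (rule borel_integrable_atLeastAtMost')
  from set_borel_integral_eq_integral(2)[OF this] I show ?thesis
    by (simp add: set_lebesgue_integral_def integral_unique)
qed

text \<open>Complex homogeneity of the real derivative of \<open>f\<close> makes the chain rule
  produce multiplication by the single number \<open>f' v\<close>.\<close>

lemma holomorphic_slice:
  assumes f: "holomorphic_Cn_on f (ball 0 1)" and S: "open S" "\<And>c. c \<in> S \<Longrightarrow> norm (u + c *s v) < 1"
  shows "(\<lambda>c. f (u + c *s v)) holomorphic_on S"
  unfolding holomorphic_on_def
proof
  fix c assume c: "c \<in> S"
  have "u + c *s v \<in> ball 0 1" using S(2)[OF c] by simp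
  with f have "\<exists>f'. (f has_derivative f') (at (u + c *s v)) \<and> (\<forall>a x. f' (a *s x) = a * f' x)"
    unfolding holomorphic_Cn_on_def by (rule bspec)
  then obtain f' where f': "(f has_derivative f') (at (u + c *s v))" "\<And>a x. f' (a *s x) = a * f' x"
    by blast
  have "((\<lambda>c. u + c *s v) has_derivative (\<lambda>h. h *s v)) (at c within S)"
  proof -
    have "bounded_linear (\<lambda>h. h *s v)"
      by (rule bounded_linear_intro[where K = "norm v"])
         (simp_all add: vector_sadd_rdistrib norm_cscale vec_scaleR_eq_cscale scaleR_conv_of_real vector_smult_assoc)
    then have "((\<lambda>c. c *s v) has_derivative (\<lambda>h. h *s v)) (at c within S)" by (rule bounded_linear_imp_has_derivative)
    from has_derivative_add[OF has_derivative_const[of u] this] show ?thesis by simp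
  qed
  from has_derivative_compose[OF this f'(1)]
  have "((\<lambda>c. f (u + c *s v)) has_derivative (\<lambda>h. h * f' v)) (at c within S)" by (simp add: f'(2))
  then have "((\<lambda>c. f (u + c *s v)) has_field_derivative f' v) (at c within S)"
    by (simp add: has_field_derivative_def mult.commute[of _ "f' v"])
  then show "(\<lambda>c. f (u + c *s v)) field_differentiable at c within S"
    by (auto simp: field_differentiable_def)
qed

text \<open>Two averages reduce the integral to one variable. Rotating the complement of
  \<open>e\<close> replaces \<open>f w\<close> by its value on the line through \<open>e\<close>, by
  the mean value property; rotating everything then isolates the \<open>k\<close>-th Taylor
  coefficient of the slice function and leaves the moment of
  \<open>|cinner w e|^(2 k)\<close>.\<close>

lemma moment_against_power:
  fixes f :: "complex ^ 'n \<Rightarrow> complex" and e :: "complex ^ 'n"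
  assumes f: "f \<in> bergman_space" and e: "norm e = 1"
  defines "\<phi> \<equiv> \<lambda>c. f (c *s e)"
  shows "integrable lborel (\<lambda>w. of_real (ball_weight w) * (f w * cnj (cinner w e) ^ k))"
    "(LINT w|lborel. of_real (ball_weight w) * (f w * cnj (cinner w e) ^ k)) = (deriv ^^ k) \<phi> 0 / fact k * of_real (axis_moment CARD('n) k)"
proof -
  note [measurable] = borel_measurable_bergman[OF f]
  have hf: "holomorphic_Cn_on f (ball 0 1)" using f by (simp add: bergman_space_def)
  have cle: "norm (cinner w e) < 1" if "norm w < 1" for w using norm_cinner_le[of w e] e that by simp
  define \<Psi> where "\<Psi> = (\<lambda>w. of_real (ball_weight w) * (f w * cnj (cinner w e) ^ k))"
  define \<Psi>' where "\<Psi>' = (\<lambda>w. of_real (ball_weight w) * (f (cinner w e *s e) * cnj (cinner w e) ^ k))"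
  define \<Psi>'' where "\<Psi>'' = (\<lambda>w. of_real (ball_weight w * cmod (cinner w e) ^ (2 * k)) * ((deriv ^^ k) \<phi> 0 / fact k))"
  have bw0: "ball_weight w = 0" if "\<not> norm w < 1" for w :: "complex ^ 'n"
    using that by (simp add: ball_weight_def)
  show int: "integrable lborel (\<lambda>w. of_real (ball_weight w) * (f w * cnj (cinner w e) ^ k))"
  proof (rule Bochner_Integration.integrable_bound[OF integrable_bergman[OF f]])
    show "AE w in lborel. norm (of_real (ball_weight w) * (f w * cnj (cinner w e) ^ k)) \<le> norm (of_real (ball_weight w) * f w)"
    proof (rule AE_I2)
      fix w
      show "norm (of_real (ball_weight w) * (f w * cnj (cinner w e) ^ k)) \<le> norm (of_real (ball_weight w) * f w)"
      proof (cases "norm w < 1")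
        case True
        then have "cmod (cinner w e) ^ k \<le> 1" using cle[OF True] by (simp add: power_le_one)
        then show ?thesis by (simp add: norm_mult norm_power mult_left_le mult_left_mono)
      qed (simp add: bw0)
    qed
  qed measurable
  have nrot: "norm (slice_scale e (cis x) (cis y) w) = norm w" for x y w
    using orthogonal_transformation_norm[OF orthogonal_slice_scale[OF e]] by simp
  \<comment> \<open>First average, with frequency 0 along \<open>e\<close>: the coefficient of order
    0 of \<open>h\<close> is its value at the centre of the disc orthogonal to
    \<open>e\<close>.\<close>
  have A1: "(LINT x|lborel. indicator {0..1} x *\<^sub>R \<Psi> (slice_scale e (cis (0 * x)) (cis (2 * pi * x)) w)) = \<Psi>' w" for w
  proof (cases "norm w < 1")
    case True
    define v where "v = w - cinner w e *s e"
    define h where "h = (\<lambda>c. f (cinner w e *s e + c *s v))"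
    have hol: "\<exists>S. h holomorphic_on S \<and> cball 0 1 \<subseteq> S"
    proof -
      have n: "(norm (cinner w e *s e + c *s v))\<^sup>2 = (cmod (cinner w e))\<^sup>2 + (cmod c)\<^sup>2 * ((norm w)\<^sup>2 - (cmod (cinner w e))\<^sup>2)" for c
        using norm_slice_scale_sq[OF e, of 1 c w] by (simp add: slice_scale_def v_def)
      have "continuous_on UNIV (\<lambda>c::complex. cinner w e *s e + c *s v)" by (intro continuous_intros)
      then have op: "open ((\<lambda>c::complex. cinner w e *s e + c *s v) -` ball 0 1)" (is "open ?U")
        by (rule open_vimage[rotated]) simp
      have sub: "cball 0 1 \<subseteq> ?U"
      proof
        fix c :: complex assume "c \<in> cball 0 1"
        then have "(cmod c)\<^sup>2 \<le> 1" by (simp add: power_le_one)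
        moreover have "0 \<le> (norm w)\<^sup>2 - (cmod (cinner w e))\<^sup>2"
          using norm_cinner_le[of w e] e by (simp add: power_mono)
        ultimately have "(norm (cinner w e *s e + c *s v))\<^sup>2 \<le> (norm w)\<^sup>2"
          unfolding n using mult_right_mono[of "(cmod c)\<^sup>2" 1 "(norm w)\<^sup>2 - (cmod (cinner w e))\<^sup>2"] by simp
        then have "norm (cinner w e *s e + c *s v) \<le> norm w" by (rule power2_le_imp_le) simp
        then show "c \<in> ?U" using True by simp
      qed
      have "h holomorphic_on ?U"
        unfolding h_def by (rule holomorphic_slice[OF hf op]) auto
      then show ?thesis using sub by (intro exI[of _ ?U] conjI)
    qed
    then obtain S where S: "h holomorphic_on S" "cball 0 1 \<subseteq> S" by blast
    have "\<Psi> (slice_scale e (cis (0 * x)) (cis (2 * pi * x)) w) = (of_real (ball_weight w) * cnj (cinner w e) ^ k) * (h (cis (2 * pi * x)) * cnj (cis (2 * pi * x)) ^ 0)" for x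
    proof -
      have "ball_weight (slice_scale e (cis (0 * x)) (cis (2 * pi * x)) w) = ball_weight w" by (rule ball_weight_cong_norm) (simp add: nrot del: cis_zero mult_zero_left)
      moreover have "slice_scale e (cis (0 * x)) (cis (2 * pi * x)) w = cinner w e *s e + cis (2 * pi * x) *s v" by (simp add: slice_scale_def v_def)
      moreover have "cinner (slice_scale e (cis (0 * x)) (cis (2 * pi * x)) w) e = cinner w e" using e by (simp add: cinner_slice_scale)
      ultimately show ?thesis unfolding \<Psi>_def h_def by simp
    qed
    then have "(LINT x|lborel. indicator {0..1} x *\<^sub>R \<Psi> (slice_scale e (cis (0 * x)) (cis (2 * pi * x)) w)) =
        (LINT x|lborel. (of_real (ball_weight w) * cnj (cinner w e) ^ k) * (indicator {0..1} x *\<^sub>R (h (cis (2 * pi * x)) * cnj (cis (2 * pi * x)) ^ 0)))"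
      by (intro Bochner_Integration.integral_cong) auto
    also have "\<dots> = (of_real (ball_weight w) * cnj (cinner w e) ^ k) * ((deriv ^^ 0) h 0 / fact 0)"
      by (subst integral_mult_right_zero, subst cauchy_coefficient[OF S]) simp
    also have "\<dots> = \<Psi>' w" by (simp add: \<Psi>'_def h_def)
    finally show ?thesis .
  next
    case False
    then show ?thesis using nrot[of _ _ w] by (simp add: \<Psi>_def \<Psi>'_def bw0 del: mult_zero_left cis_zero)
  qed
  note S1 = integral_slice_average[OF e int[folded \<Psi>_def], of 0 "2 * pi", OF A1]
  \<comment> \<open>Second average: both components rotate together, and the conjugate power selects
    the coefficient of order \<open>k\<close>.\<close>
  have A2: "(LINT x|lborel. indicator {0..1} x *\<^sub>R \<Psi>' (slice_scale e (cis (2 * pi * x)) (cis (2 * pi * x)) w)) = \<Psi>'' w" for w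
  proof (cases "norm w < 1")
    case True
    define c where "c = cinner w e"
    have c: "cmod c < 1" using cle[OF True] by (simp add: c_def)
    \<comment> \<open>A radius above 1 on which \<open>c * x\<close> stays in the unit disc, as
      \<open>cauchy_coefficient\<close> needs the closed disc inside the domain; for
      \<open>c = 0\<close> any such radius works.\<close>
    define R where "R = (if c = 0 then 2 else 1 / cmod c)"
    have R: "1 < R" using c by (simp add: R_def)
    have sub: "cball 0 1 \<subseteq> ball (0::complex) R" using R by auto
    have cR: "cmod (c * x) < 1" if "x \<in> ball 0 R" for x
      using that by (auto simp: R_def norm_mult field_simps split: if_splits)
    have h\<phi>: "\<phi> holomorphic_on ball 0 1"
      using holomorphic_slice[OF hf, of "ball 0 1" 0 e] e by (simp add: \<phi>_def norm_cscale)
    define h where "h = (\<lambda>x. \<phi> (c * x))"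
    have hh: "h holomorphic_on ball 0 R"
      unfolding h_def using cR
      by (intro holomorphic_on_compose_gen[OF _ h\<phi>, unfolded o_def] holomorphic_intros) auto
    have dh: "(deriv ^^ k) h 0 = c ^ k * (deriv ^^ k) \<phi> 0"
      unfolding h_def using R cR by (subst higher_deriv_compose_linear[OF h\<phi>, of "ball 0 R"]) auto
    have "\<Psi>' (slice_scale e (cis (2 * pi * x)) (cis (2 * pi * x)) w) = (of_real (ball_weight w) * cnj c ^ k) * (h (cis (2 * pi * x)) * cnj (cis (2 * pi * x)) ^ k)" for x
    proof -
      have "ball_weight (slice_scale e (cis (2 * pi * x)) (cis (2 * pi * x)) w) = ball_weight w" by (rule ball_weight_cong_norm) (simp add: nrot)
      moreover have "cinner (slice_scale e (cis (2 * pi * x)) (cis (2 * pi * x)) w) e = cis (2 * pi * x) * c" using e by (simp add: cinner_slice_scale c_def)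
      ultimately show ?thesis unfolding \<Psi>'_def h_def \<phi>_def by (simp add: power_mult_distrib mult_ac)
    qed
    then have "(LINT x|lborel. indicator {0..1} x *\<^sub>R \<Psi>' (slice_scale e (cis (2 * pi * x)) (cis (2 * pi * x)) w)) =
        (LINT x|lborel. (of_real (ball_weight w) * cnj c ^ k) * (indicator {0..1} x *\<^sub>R (h (cis (2 * pi * x)) * cnj (cis (2 * pi * x)) ^ k)))"
      by (intro Bochner_Integration.integral_cong) auto
    also have "\<dots> = (of_real (ball_weight w) * cnj c ^ k) * ((deriv ^^ k) h 0 / fact k)"
      by (subst integral_mult_right_zero, subst cauchy_coefficient[OF hh sub]) simp
    also have "\<dots> = of_real (ball_weight w) * (c * cnj c) ^ k * ((deriv ^^ k) \<phi> 0 / fact k)" by (simp add: dh power_mult_distrib mult_ac)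
    also have "(c * cnj c) ^ k = of_real (cmod c ^ (2 * k))"
      by (simp add: complex_norm_square[symmetric] power_mult)
    finally show ?thesis by (simp add: \<Psi>''_def c_def mult_ac)
  next
    case False
    then show ?thesis using nrot[of _ _ w] by (simp add: \<Psi>''_def \<Psi>'_def bw0)
  qed
  note S2 = integral_slice_average[OF e S1(1), of "2 * pi" "2 * pi", OF A2]
  have km: "0 \<le> axis_moment CARD('n) k" by (intro less_imp_le axis_moment_pos card_index_ge_1)
  have "has_bochner_integral lborel (\<lambda>w. ball_weight w * cmod (cinner w e) ^ (2 * k)) (axis_moment CARD('n) k)"
  proof (rule has_bochner_integral_nn_integral)
    have "(\<integral>\<^sup>+w. ennreal (ball_weight w * cmod (cinner w e) ^ (2 * k)) \<partial>lborel) = (\<integral>\<^sup>+w. ennreal (cmod (cinner w e) ^ (2 * k)) * (ennreal (exp (- psi w)) * indicator (ball 0 1) w) \<partial>lborel)"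
      by (intro nn_integral_cong) (auto simp: ball_weight_def indicator_def ennreal_mult mult.commute)
    then show "(\<integral>\<^sup>+w. ennreal (ball_weight w * cmod (cinner w e) ^ (2 * k)) \<partial>lborel) = ennreal (axis_moment CARD('n) k)"
      using weighted_moment[OF e, of k] by simp
  next
    show "AE w in lborel. 0 \<le> ball_weight w * cmod (cinner w e) ^ (2 * k)"
      using ball_weight_bounds(1) by (intro AE_I2 mult_nonneg_nonneg) auto
  qed (use km in auto)
  then have "(LINT w|lborel. ball_weight w * cmod (cinner w e) ^ (2 * k)) = axis_moment CARD('n) k" by (rule has_bochner_integral_integral_eq)
  then have "(LINT w|lborel. \<Psi>'' w) = of_real (axis_moment CARD('n) k) * ((deriv ^^ k) \<phi> 0 / fact k)"
    unfolding \<Psi>''_def integral_mult_left_zero integral_complex_of_real by simp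
  then show "(LINT w|lborel. of_real (ball_weight w) * (f w * cnj (cinner w e) ^ k)) = (deriv ^^ k) \<phi> 0 / fact k * of_real (axis_moment CARD('n) k)"
    using S1(2) S2(2) by (simp add: \<Psi>_def mult.commute)
qed

text \<open>The candidate for the representer of evaluation at \<open>z\<close>, extended by 0 as
  membership in \<open>bergman_space\<close> demands.\<close>

definition kernel_section :: "complex ^ 'n \<Rightarrow> complex ^ 'n \<Rightarrow> complex" where
  "kernel_section z w = (if w \<in> ball 0 1 then kernel_series CARD('n) (cinner w z) else 0)"

lemma kernel_series_holomorphic:
  assumes "1 \<le> n"
  shows "kernel_series n holomorphic_on ball 0 1"
proof (rule power_series_holomorphic)
  fix t :: complex assume "t \<in> ball 0 1"
  then have "norm t < 1" by simp
  from summable_sums[OF summable_norm_cancel[OF kernel_series_summable[OF assms this]]]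
  show "(\<lambda>k. of_real (1 / axis_moment n k) * (t - 0) ^ k) sums kernel_series n t" by (simp add: kernel_series_def)
qed

lemma norm_cinner_less: "norm (w :: complex ^ 'n) < 1 \<Longrightarrow> norm z < 1 \<Longrightarrow> cmod (cinner w z) < 1"
proof -
  assume "norm w < 1" "norm z < 1"
  then have "norm w * norm z \<le> 1 * norm z" by (intro mult_right_mono) auto
  then show ?thesis using norm_cinner_le[of w z] \<open>norm z < 1\<close> by linarith
qed

text \<open>For fixed \<open>z\<close> the argument \<open>cinner w z\<close> stays in the compact
  disc of radius \<open>norm z < 1\<close>, so the section is bounded, and the weight is
  integrable.\<close>

lemma kernel_section_in_bergman_space:
  fixes z :: "complex ^ 'n"
  assumes z: "z \<in> ball 0 1"
  shows "kernel_section z \<in> bergman_space"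
  unfolding bergman_space_def
proof (intro CollectI conjI allI impI)
  have nz: "norm z < 1" using z by simp
  show "kernel_section z w = 0" if "w \<notin> ball 0 1" for w using that by (simp add: kernel_section_def)
  show hol: "holomorphic_Cn_on (kernel_section z) (ball 0 1)"
    unfolding holomorphic_Cn_on_def
  proof
    fix w :: "complex ^ 'n" assume w: "w \<in> ball 0 1"
    have "cinner w z \<in> ball 0 1" using norm_cinner_less[of w z] w nz by simp
    then obtain D where "(kernel_series CARD('n) has_field_derivative D) (at (cinner w z))"
      using kernel_series_holomorphic[OF card_index_ge_1[where 'n = 'n]] holomorphic_derivI open_ball by blast
    then have "(kernel_series CARD('n) has_derivative (\<lambda>h. D * h)) (at (cinner w z))"
      by (simp add: has_field_derivative_def)
    then have "((\<lambda>w. kernel_series CARD('n) (cinner w z)) has_derivative (\<lambda>h. D * cinner h z)) (at w)"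
      by (rule has_derivative_compose[OF bounded_linear_imp_has_derivative[OF bounded_linear_cinner_left]])
    then have "(kernel_section z has_derivative (\<lambda>h. D * cinner h z)) (at w)"
      by (rule has_derivative_transform_within_open[OF _ open_ball w]) (simp add: kernel_section_def)
    then show "\<exists>f'. (kernel_section z has_derivative f') (at w) \<and> (\<forall>c v. f' (c *s v) = c * f' v)"
      by (intro exI[of _ "\<lambda>h. D * cinner h z"] conjI) auto
  qed
  have "compact (kernel_series CARD('n) ` cball 0 (norm z))"
    using nz by (intro compact_continuous_image compact_cball continuous_on_subset[OF holomorphic_on_imp_continuous_on[OF kernel_series_holomorphic[OF card_index_ge_1[where 'n = 'n]]]]) auto
  then have "bounded (kernel_series CARD('n) ` cball 0 (norm z))" by (rule compact_imp_bounded)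
  then obtain B where B0: "\<forall>x\<in>kernel_series CARD('n) ` cball 0 (norm z). norm x \<le> B"
    unfolding bounded_iff by blast
  have B: "norm (kernel_series CARD('n) t) \<le> B" if "norm t \<le> norm z" for t
    using B0 that by simp
  have kb: "norm (kernel_section z w) \<le> B" if "w \<in> ball 0 1" for w
  proof -
    have "norm (cinner w z) \<le> 1 * norm z"
      using that by (intro order_trans[OF norm_cinner_le] mult_right_mono) auto
    then show ?thesis using B that by (simp add: kernel_section_def)
  qed
  have meas: "(\<lambda>w. indicator (ball 0 1) w *\<^sub>R kernel_section z w) \<in> borel_measurable borel"
    using hol unfolding holomorphic_Cn_on_def
    by (intro borel_measurable_continuous_on_indicator continuous_at_imp_continuous_on)
       (auto intro: has_derivative_continuous)
  moreover have "(\<lambda>w. indicator (ball 0 1) w *\<^sub>R kernel_section z w) = kernel_section z"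
    by (auto simp: kernel_section_def indicator_def fun_eq_iff)
  ultimately have [measurable]: "kernel_section z \<in> borel_measurable borel" by simp
  have "integrable lborel (\<lambda>w. ball_weight w * (cmod (kernel_section z w))\<^sup>2)"
  proof (rule Bochner_Integration.integrable_bound)
    show "integrable lborel (\<lambda>w :: complex ^ 'n. ball_weight w * B\<^sup>2)"
      by (intro integrable_mult_left integrable_ball_weight)
    show "AE w in lborel. norm (ball_weight w * (cmod (kernel_section z w))\<^sup>2) \<le> norm (ball_weight w * B\<^sup>2)"
    proof (rule AE_I2)
      fix w
      show "norm (ball_weight w * (cmod (kernel_section z w))\<^sup>2) \<le> norm (ball_weight w * B\<^sup>2)"
      proof (cases "w \<in> ball 0 1")
        case True
        then have "(cmod (kernel_section z w))\<^sup>2 \<le> B\<^sup>2" using kb by (intro power_mono) auto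
        then show ?thesis using ball_weight_bounds(1)[of w] by (simp add: abs_mult mult_left_mono)
      qed (simp add: ball_weight_def)
    qed
  qed measurable
  then show "set_integrable lborel (ball 0 1) (\<lambda>w. (cmod (kernel_section z w))\<^sup>2 * exp (- psi w))"
    by (simp add: set_integrable_def ball_weight_def mult_ac)
qed

lemma exists_unit_direction:
  fixes z :: "complex ^ 'n"
  obtains e where "norm e = 1" "z = of_real (norm z) *s e"
proof (cases "z = 0")
  case True
  show ?thesis
    by (rule that[OF norm_axis_one]) (simp add: True vec_eq_iff)
next
  case False
  show ?thesis
    by (rule that[of "(1 / norm z) *\<^sub>R z"]) (use False in \<open>simp_all add: vec_scaleR_eq_cscale vec_eq_iff norm_cscale norm_divide\<close>)
qed

text \<open>Write \<open>z\<close> as \<open>r\<close> times a unit vector \<open>e\<close>. The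
  kernel at \<open>z\<close> is then a series in powers of \<open>cinner w e\<close>, and
  \<open>moment_against_power\<close> turns it term by term into the Taylor series of the slice
  function at \<open>r\<close>: each coefficient \<open>1 / axis_moment\<close> cancels the
  moment.\<close>

lemma kernel_section_reproducing:
  fixes z :: "complex ^ 'n"
  assumes f: "f \<in> bergman_space" and z: "z \<in> ball 0 1"
  shows "f z = bergman_inner f (kernel_section z)"
proof -
  note n1 = card_index_ge_1[where 'n = 'n]
  obtain e where e: "norm e = 1" "z = of_real (norm z) *s e" by (rule exists_unit_direction)
  define r where "r = norm z"
  have r: "0 \<le> r" "r < 1" using z by (auto simp: r_def)
  have ze: "z = of_real r *s e" using e by (simp add: r_def)
  define \<phi> where "\<phi> = (\<lambda>c. f (c *s e))"
  define c where "c = (\<lambda>k. 1 / axis_moment CARD('n) k)"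
  have km: "0 < axis_moment CARD('n) k" for k by (rule axis_moment_pos[OF n1])
  have c0: "0 < c k" for k using km by (simp add: c_def)
  define g where "g = (\<lambda>k w. of_real (ball_weight w) * (f w * cnj (cinner w e) ^ k) * of_real (c k * r ^ k))"
  note mom = moment_against_power[OF f e(1), folded \<phi>_def]
  have ig: "integrable lborel (g k)" for k
    unfolding g_def by (intro integrable_mult_left mom(1))
  have cle: "norm (cinner w e) \<le> 1" if "norm w < 1" for w
    using norm_cinner_le[of w e] e that by simp
  have ng: "norm (g k w) \<le> norm (of_real (ball_weight w) * f w) * (c k * r ^ k)" for k w
  proof (cases "norm w < 1")
    case True
    have "norm (g k w) = (norm (of_real (ball_weight w) * f w) * (c k * r ^ k)) * norm (cinner w e) ^ k"
      using r c0[of k] by (simp add: g_def norm_mult norm_power)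
    also have "\<dots> \<le> (norm (of_real (ball_weight w) * f w) * (c k * r ^ k)) * 1"
      using cle[OF True] r c0[of k] by (intro mult_left_mono power_le_one) auto
    finally show ?thesis by simp
  qed (simp add: g_def ball_weight_def)
  have sc: "summable (\<lambda>k. c k * r ^ k)"
    using kernel_series_summable[OF n1, of "of_real r"] r unfolding norm_kernel_series_term[OF n1] by (simp add: c_def)
  have s1: "summable (\<lambda>k. norm (g k w))" for w
    by (rule summable_comparison_test[OF _ summable_mult[OF sc, of "norm (of_real (ball_weight w) * f w)"]])
       (use ng in auto)
  \<comment> \<open>Absolute summability of the integrals, from
    \<open>cmod (cinner w e) <= 1\<close> and convergence of the series at \<open>r < 1\<close>; it
    justifies exchanging sum and integral.\<close>
  have s2: "summable (\<lambda>k. (LINT w|lborel. norm (g k w)))"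
  proof (rule summable_comparison_test[OF _ summable_mult[OF sc, of "LINT w|lborel. norm (of_real (ball_weight w) * f w)"]], intro exI allI impI)
    fix k
    have "(LINT w|lborel. norm (g k w)) \<le> (LINT w|lborel. norm (of_real (ball_weight w) * f w) * (c k * r ^ k))"
      using ig integrable_bergman[OF f] ng
      by (intro integral_mono integrable_norm integrable_mult_left) auto
    also have "\<dots> = (LINT w|lborel. norm (of_real (ball_weight w) * f w)) * (c k * r ^ k)" by simp
    finally show "norm (LINT w|lborel. norm (g k w)) \<le> (LINT w|lborel. norm (of_real (ball_weight w) * f w)) * (c k * r ^ k)"
      by simp
  qed
  have "(\<lambda>k. LINT w|lborel. g k w) sums (LINT w|lborel. (\<Sum>k. g k w))"
    by (rule sums_integral[OF ig AE_I2[OF s1] s2])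
  moreover have "(LINT w|lborel. g k w) = (deriv ^^ k) \<phi> 0 / fact k * (of_real r - 0) ^ k" for k
    unfolding g_def integral_mult_left_zero mom(2) using km[of k] by (simp add: c_def)
  moreover have "(\<Sum>k. g k w) = of_real (ball_weight w) * (f w * cnj (kernel_section z w))" for w
  proof (cases "norm w < 1")
    case True
    have zw: "cnj (cinner w z) = of_real r * cnj (cinner w e)" by (simp add: ze)
    have t1: "norm (cinner w z) < 1" using norm_cinner_less[of w z] True z by simp
    then have t2: "norm (cnj (cinner w z)) < 1" by simp
    have "cnj (kernel_section z w) = kernel_series CARD('n) (cnj (cinner w z))"
      using True cnj_kernel_series[OF n1 t1] by (simp add: kernel_section_def)
    moreover have "(\<lambda>k. of_real (1 / axis_moment CARD('n) k) * cnj (cinner w z) ^ k) sums kernel_series CARD('n) (cnj (cinner w z))"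
      unfolding kernel_series_def by (rule summable_sums[OF summable_norm_cancel[OF kernel_series_summable[OF n1 t2]]])
    ultimately have "(\<lambda>k. (of_real (ball_weight w) * f w) * (of_real (1 / axis_moment CARD('n) k) * cnj (cinner w z) ^ k)) sums ((of_real (ball_weight w) * f w) * cnj (kernel_section z w))"
      by (metis sums_mult)
    moreover have "(of_real (ball_weight w) * f w) * (of_real (1 / axis_moment CARD('n) k) * cnj (cinner w z) ^ k) = g k w" for k
      unfolding zw g_def c_def by (simp add: power_mult_distrib)
    ultimately show ?thesis by (simp add: sums_iff mult.assoc)
  qed (simp add: g_def ball_weight_def)
  ultimately have "(\<lambda>k. (deriv ^^ k) \<phi> 0 / fact k * (of_real r - 0) ^ k) sums bergman_inner f (kernel_section z)"
    by (simp add: bergman_inner_eq)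
  moreover have "(\<lambda>k. (deriv ^^ k) \<phi> 0 / fact k * (of_real r - 0) ^ k) sums \<phi> (of_real r)"
  proof (rule holomorphic_power_series)
    have "holomorphic_Cn_on f (ball 0 1)" using f by (simp add: bergman_space_def)
    then show "\<phi> holomorphic_on ball 0 1"
      using holomorphic_slice[of f "ball 0 1" 0 e] e by (simp add: \<phi>_def norm_cscale)
    show "complex_of_real r \<in> ball 0 1" using r by simp
  qed
  ultimately have "bergman_inner f (kernel_section z) = \<phi> (of_real r)" by (rule sums_unique2)
  then show ?thesis by (simp add: \<phi>_def ze[symmetric])
qed

text \<open>Testing both representers against each other shows that their difference has norm 0. The
  set where they differ in the ball is then open and null, hence empty. This makes the definite
  description in \<open>point_eval_rep\<close> well defined.\<close>

lemma bergman_rep_unique: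
  assumes k: "k \<in> bergman_space" "\<And>f. f \<in> bergman_space \<Longrightarrow> f z = bergman_inner f k"
    and k': "k' \<in> bergman_space" "\<And>f. f \<in> bergman_space \<Longrightarrow> f z = bergman_inner f k'"
  shows "k = k'"
proof -
  have kk: "bergman_inner k k = bergman_inner k k'" "bergman_inner k' k = bergman_inner k' k'"
    using k k' by metis+
  note I = integrable_bergman_mult[OF k(1) k(1)] integrable_bergman_mult[OF k(1) k'(1)]
    integrable_bergman_mult[OF k'(1) k(1)] integrable_bergman_mult[OF k'(1) k'(1)]
  define d where "d = (\<lambda>w. ball_weight w * (cmod (k w - k' w))\<^sup>2)"
  have e: "of_real (d w) = (of_real (ball_weight w) * (k w * cnj (k w)) - of_real (ball_weight w) * (k w * cnj (k' w)))
     - (of_real (ball_weight w) * (k' w * cnj (k w)) - of_real (ball_weight w) * (k' w * cnj (k' w)))" for w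
    by (simp only: d_def of_real_mult complex_norm_square complex_cnj_diff) (simp add: algebra_simps)
  have id: "integrable lborel (\<lambda>w. complex_of_real (d w))"
    unfolding e by (intro Bochner_Integration.integrable_diff I)
  have "(LINT w|lborel. complex_of_real (d w)) = (bergman_inner k k - bergman_inner k k') - (bergman_inner k' k - bergman_inner k' k')"
    unfolding e bergman_inner_eq
    by (subst Bochner_Integration.integral_diff, (intro Bochner_Integration.integrable_diff I)+)
       (simp add: Bochner_Integration.integral_diff I)
  then have "(LINT w|lborel. d w) = 0" using kk by simp
  moreover have d0: "0 \<le> d w" for w by (simp add: d_def ball_weight_bounds(1))
  moreover have "integrable lborel d" using id by (simp add: complex_of_real_integrable_eq)
  ultimately have "AE w in lborel. d w = 0" by (subst (asm) integral_nonneg_eq_0_iff_AE) auto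
  then have ae: "AE w in lborel. w \<notin> {w \<in> ball 0 1. k w \<noteq> k' w}"
    by eventually_elim (auto simp: d_def ball_weight_def)
  have op: "open {w \<in> ball 0 1. k w \<noteq> k' w}"
  proof -
    have "continuous_on (ball 0 1) (\<lambda>w. k w - k' w)"
      using k k' by (intro continuous_on_diff continuous_on_bergman)
    from continuous_open_preimage[OF this open_ball, of "- {0}"]
    have "open (ball 0 1 \<inter> (\<lambda>w. k w - k' w) -` (- {0}))" by (simp add: open_Compl)
    moreover have "{w \<in> ball 0 1. k w \<noteq> k' w} = ball 0 1 \<inter> (\<lambda>w. k w - k' w) -` (- {0})" by auto
    ultimately show ?thesis by simp
  qed
  have "{w \<in> ball 0 1. k w \<noteq> k' w} = {}"
  proof (rule ccontr)
    assume "{w \<in> ball 0 1. k w \<noteq> k' w} \<noteq> {}"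
    then have "\<not> negligible {w \<in> ball 0 1. k w \<noteq> k' w}" using op open_not_negligible by blast
    moreover have "{w \<in> ball 0 1. k w \<noteq> k' w} \<in> null_sets lborel"
      using op ae by (subst AE_iff_null_sets) auto
    then have "negligible {w \<in> ball 0 1. k w \<noteq> k' w}"
      by (simp add: negligible_iff_null_sets null_sets_completionI)
    ultimately show False by blast
  qed
  then show ?thesis using k(1) k'(1) by (force simp: bergman_space_def fun_eq_iff)
qed

lemma bergman_kernel_eq:
  fixes z w :: "complex ^ 'n"
  assumes z: "z \<in> ball 0 1" and w: "w \<in> ball 0 1"
  shows "bergman_kernel z w = kernel_series CARD('n) (cinner z w)"
proof -
  have "point_eval_rep z = kernel_section z"
    unfolding point_eval_rep_def
  proof (rule the_equality)
    show "kernel_section z \<in> bergman_space \<and> (\<forall>f\<in>bergman_space. f z = bergman_inner f (kernel_section z))"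
      using kernel_section_in_bergman_space[OF z] kernel_section_reproducing[OF _ z] by blast
    show "k = kernel_section z" if "k \<in> bergman_space \<and> (\<forall>f\<in>bergman_space. f z = bergman_inner f k)" for k
      using that kernel_section_in_bergman_space[OF z] kernel_section_reproducing[OF _ z] by (intro bergman_rep_unique[of k z]) auto
  qed
  then have "bergman_kernel z w = cnj (kernel_series CARD('n) (cinner w z))"
    using w by (simp add: bergman_kernel_def kernel_section_def)
  also have "\<dots> = kernel_series CARD('n) (cnj (cinner w z))"
    using z w by (intro cnj_kernel_series card_index_ge_1 norm_cinner_less) auto
  finally show ?thesis by (simp add: cnj_cinner)
qed

section \<open>The off-diagonal estimate\<close>

text \<open>Below the threshold \<open>s0\<close> the oscillating bound applies. Above it the
  minimum in the exponent is at most \<open>1/(32 s0)\<close>, so the crude bound suffices after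
  enlarging \<open>A\<close> by \<open>exp (1/32 / s0)\<close>. Negative \<theta> follows by
  conjugation, the coefficients being real.\<close>

lemma norm_kernel_series_le:
  assumes n: "1 \<le> n"
  obtains A where "0 < A"
    "\<And>s \<theta>. 0 < s \<Longrightarrow> s \<le> 1 \<Longrightarrow> \<bar>\<theta>\<bar> \<le> pi \<Longrightarrow>
      norm (kernel_series n (of_real (1 - s) * cis \<theta>)) \<le>
        A * (exp (1/s) / s ^ (2 * n + 1)) * exp (- min (1/8192 * \<bar>\<theta>\<bar> / (s * sqrt s)) (1/32 / s))"
proof -
  define C1 :: real where "C1 = 10 * 4 ^ n * exp 2 + 9 * fact n * 8 ^ n"
  have C1: "0 < C1" by (simp add: C1_def add_pos_pos)
  define s0 where "s0 = 1 / (1024 * (real n + 1))"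
  have s0: "0 < s0" by (simp add: s0_def)
  define A where "A = 64 * exp (real n + 2) * C1 + 512 * exp (real n) + 8 * exp (real n) * C1 * exp (1/32 / s0)"
  have parts: "0 \<le> 64 * exp (real n + 2) * C1" "0 < 512 * exp (real n)" "0 \<le> 8 * exp (real n) * C1 * exp (1/32 / s0)"
    using C1 by auto
  have main: "norm (kernel_series n (of_real (1 - s) * cis \<theta>)) \<le>
        A * (exp (1/s) / s ^ (2 * n + 1)) * exp (- min (1/8192 * \<bar>\<theta>\<bar> / (s * sqrt s)) (1/32 / s))"
    if s: "0 < s" "s \<le> 1" and \<theta>: "0 \<le> \<theta>" "\<theta> \<le> pi" for s \<theta>
  proof -
    define P where "P = exp (1/s) / s ^ (2 * n + 1)"
    define E where "E = exp (- min (1/8192 * \<bar>\<theta>\<bar> / (s * sqrt s)) (1/32 / s))"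
    have P: "0 < P" and E: "0 < E" using s by (auto simp: P_def E_def)
    have sum: "(\<Sum>j. saddle_term n s (real j)) \<le> C1 * P"
      using saddle_term_sum(2)[OF n s] by (simp add: C1_def P_def)
    have sum0: "0 \<le> (\<Sum>j. saddle_term n s (real j))"
      by (intro suminf_nonneg saddle_term_sum(1)[OF n s] saddle_term_nonneg)
    show ?thesis
    proof (cases "s \<le> s0")
      case True
      have e1: "exp (- (1 / (8192 * (s * sqrt s))) * \<theta>) \<le> E" using \<theta> by (simp add: E_def min_def)
      have e2: "exp (- (1/32 / s)) \<le> E" by (simp add: E_def)
      have "norm (kernel_series n (of_real (1 - s) * cis \<theta>)) \<le>
         64 * exp (real n + 2) * exp (- (1 / (8192 * (s * sqrt s))) * \<theta>) * (\<Sum>j. saddle_term n s (real j))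
         + 512 * exp (real n) * exp (1/s - 1 / (32 * s)) / s ^ (2 * n + 1)"
        using norm_kernel_series_oscillation[OF n s(1) True[unfolded s0_def] \<theta>] .
      also have "512 * exp (real n) * exp (1/s - 1 / (32 * s)) / s ^ (2 * n + 1) = 512 * exp (real n) * P * exp (- (1/32 / s))"
      proof -
        have "exp (1/s - 1 / (32 * s)) = exp (1/s) * exp (- (1/32 / s))" by (subst exp_add[symmetric]) simp
        then show ?thesis by (simp add: P_def)
      qed
      also have "512 * exp (real n) * P * exp (- (1/32 / s)) \<le> 512 * exp (real n) * P * E"
        using e2 P by (intro mult_left_mono) auto
      also have "64 * exp (real n + 2) * exp (- (1 / (8192 * (s * sqrt s))) * \<theta>) * (\<Sum>j. saddle_term n s (real j))
          \<le> 64 * exp (real n + 2) * E * (C1 * P)"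
        using e1 sum sum0 E by (intro mult_mono mult_left_mono) auto
      finally have "norm (kernel_series n (of_real (1 - s) * cis \<theta>)) \<le> (64 * exp (real n + 2) * C1 + 512 * exp (real n)) * (P * E)"
        by (simp add: algebra_simps)
      also have "\<dots> \<le> A * (P * E)"
        using P E parts by (intro mult_right_mono) (auto simp: A_def)
      finally show ?thesis by (simp add: P_def E_def)
    next
      case False
      have "1/32 / s \<le> 1/32 / s0" using False s0 by (intro divide_left_mono mult_pos_pos) auto
      then have "min (1/8192 * \<bar>\<theta>\<bar> / (s * sqrt s)) (1/32 / s) \<le> 1/32 / s0" by linarith
      then have "1 \<le> exp (1/32 / s0) * E" unfolding E_def by (simp flip: exp_add)
      then have "C1 * P * 1 \<le> C1 * P * (exp (1/32 / s0) * E)" using C1 P by (intro mult_left_mono) auto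
      then have s': "(\<Sum>j. saddle_term n s (real j)) \<le> C1 * P * (exp (1/32 / s0) * E)" using sum by linarith
      have nt: "norm (of_real (1 - s) * cis \<theta>) = 1 - s"
        unfolding norm_mult norm_of_real using s by simp
      have "norm (kernel_series n (of_real (1 - s) * cis \<theta>)) \<le> 8 * exp (real n) * (\<Sum>j. saddle_term n s (real j))"
        by (rule norm_kernel_series_crude[OF n s nt])
      also have "\<dots> \<le> 8 * exp (real n) * (C1 * P * (exp (1/32 / s0) * E))"
        using s' by (intro mult_left_mono) auto
      also have "\<dots> = (8 * exp (real n) * C1 * exp (1/32 / s0)) * (P * E)" by simp
      also have "\<dots> \<le> A * (P * E)"
        using P E parts by (intro mult_right_mono) (auto simp: A_def)
      finally show ?thesis by (simp add: P_def E_def)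
    qed
  qed
  show thesis
  proof (rule that[of A])
    show "0 < A" using parts unfolding A_def by (intro add_pos_nonneg add_nonneg_pos) auto
    fix s \<theta> :: real assume s: "0 < s" "s \<le> 1" and \<theta>: "\<bar>\<theta>\<bar> \<le> pi"
    have "norm (kernel_series n (of_real (1 - s) * cis \<theta>)) = norm (kernel_series n (of_real (1 - s) * cis \<bar>\<theta>\<bar>))"
    proof (cases "0 \<le> \<theta>")
      case False
      have "norm (of_real (1 - s) * cis \<theta>) < 1"
        unfolding norm_mult norm_of_real using s by simp
      then have "cnj (kernel_series n (of_real (1 - s) * cis \<theta>)) = kernel_series n (cnj (of_real (1 - s) * cis \<theta>))"
        by (rule cnj_kernel_series[OF n])
      also have "cnj (of_real (1 - s) * cis \<theta>) = of_real (1 - s) * cis \<bar>\<theta>\<bar>"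
        using False by (simp add: cis_cnj)
      finally show ?thesis by (metis complex_mod_cnj)
    qed simp
    then show "norm (kernel_series n (of_real (1 - s) * cis \<theta>)) \<le>
        A * (exp (1/s) / s ^ (2 * n + 1)) * exp (- min (1/8192 * \<bar>\<theta>\<bar> / (s * sqrt s)) (1/32 / s))"
      using main[OF s, of "\<bar>\<theta>\<bar>"] \<theta> by simp
  qed
qed

theorem theorem1p1:
  "\<exists>C \<epsilon> :: real. 0 < C \<and> 0 < \<epsilon> \<and> \<epsilon> < sqrt 2 \<and>
    (\<forall>z \<in> ball (0 :: complex ^ 'n) 1. \<forall>w \<in> ball (0 :: complex ^ 'n) 1.
      (cmod (bergman_kernel z w))\<^sup>2 \<le>
        C * (exp (psi z) * exp (psi w) /
              ((1 - (norm z)\<^sup>2) ^ (2 * CARD('n) + 1) * (1 - (norm w)\<^sup>2) ^ (2 * CARD('n) + 1)))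
          * exp (- \<epsilon> * d_psi z w))"
proof -
  define N where "N = 2 * CARD('n) + 1"
  obtain A where A: "0 < A"
    "\<And>s \<theta>. 0 < s \<Longrightarrow> s \<le> 1 \<Longrightarrow> \<bar>\<theta>\<bar> \<le> pi \<Longrightarrow>
      norm (kernel_series CARD('n) (of_real (1 - s) * cis \<theta>)) \<le>
        A * (exp (1/s) / s ^ N) * exp (- min (1/8192 * \<bar>\<theta>\<bar> / (s * sqrt s)) (1/32 / s))"
    using norm_kernel_series_le[OF card_index_ge_1[where 'n = 'n]] unfolding N_def by blast
  obtain \<epsilon> where \<epsilon>: "0 < \<epsilon>" "\<epsilon> < 1"
    "\<And>(z::complex^'n) w s \<theta>. z \<in> ball 0 1 \<Longrightarrow> w \<in> ball 0 1 \<Longrightarrow> 0 < s \<Longrightarrow> s \<le> 1 \<Longrightarrow>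
      cinner z w = of_real (1 - s) * cis \<theta> \<Longrightarrow>
      \<epsilon> * d_psi z w \<le> psi z + psi w - 2/s + 2 * min (1/8192 * \<bar>\<theta>\<bar> / (s * sqrt s)) (1/32 / s) + 2 * \<epsilon>"
    by (rule d_psi_le_exponent_gap[of "1/8192" "1/32"]) auto
  have "(cmod (bergman_kernel z w))\<^sup>2 \<le>
        (A\<^sup>2 * exp (2 * \<epsilon>)) * (exp (psi z) * exp (psi w) / ((1 - (norm z)\<^sup>2) ^ N * (1 - (norm w)\<^sup>2) ^ N))
          * exp (- \<epsilon> * d_psi z w)"
    if z: "z \<in> ball 0 1" and w: "w \<in> ball 0 1" for z w :: "complex ^ 'n"
  proof -
    define a b where "a = 1 - (norm z)\<^sup>2" and "b = 1 - (norm w)\<^sup>2"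
    have ab: "0 < a" "0 < b" using z w by (auto simp: a_def b_def abs_square_less_1)
    define t where "t = cinner z w"
    define s where "s = 1 - cmod t"
    define \<theta> where "\<theta> = Arg t"
    have s: "0 < s" "s \<le> 1" using norm_cinner_less[of z w] z w by (auto simp: s_def t_def)
    have \<theta>: "\<bar>\<theta>\<bar> \<le> pi" using Arg_bounded[of t] by (auto simp: \<theta>_def)
    have t: "t = of_real (1 - s) * cis \<theta>" using rcis_cmod_Arg[of t] by (simp add: s_def \<theta>_def rcis_def)
    define M where "M = min (1/8192 * \<bar>\<theta>\<bar> / (s * sqrt s)) (1/32 / s)"
    have ex: "\<epsilon> * d_psi z w \<le> psi z + psi w - 2/s + 2 * M + 2 * \<epsilon>"
      unfolding M_def by (rule \<epsilon>(3)[OF z w s t[unfolded t_def]])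
    have m: "0 < min a b" "min a b \<le> a" "min a b \<le> b" using ab by auto
    \<comment> \<open>With the arithmetic-geometric mean inequality this gives
      \<open>a * b <= s^2\<close>, which replaces the power of \<open>s\<close> in the kernel bound
      by the powers of \<open>a\<close> and \<open>b\<close> in the theorem.\<close>
    have "a + b \<le> 2 * s"
      by (rule d_psi_near(1)[OF z w t[unfolded t_def] a_def b_def less_imp_le[OF s(1)] s(2) m])
    then have "(a + b)\<^sup>2 \<le> (2 * s)\<^sup>2" using ab by (intro power_mono) auto
    moreover have "4 * (a * b) \<le> (a + b)\<^sup>2"
      using zero_le_power2[of "a - b"] by (simp add: power2_eq_square algebra_simps)
    ultimately have "a * b \<le> s\<^sup>2" by (simp add: power_mult_distrib)
    then have "(a * b) ^ N \<le> (s\<^sup>2) ^ N" using ab by (intro power_mono) auto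
    then have sN: "a ^ N * b ^ N \<le> (s ^ N)\<^sup>2"
      by (simp add: power_mult_distrib power_mult[symmetric] mult.commute)
    have "cmod (bergman_kernel z w) \<le> A * (exp (1/s) / s ^ N) * exp (- M)"
      unfolding bergman_kernel_eq[OF z w] t_def[symmetric] M_def
      by (subst t) (rule A(2)[OF s \<theta>])
    then have "(cmod (bergman_kernel z w))\<^sup>2 \<le> (A * (exp (1/s) / s ^ N) * exp (- M))\<^sup>2"
      by (intro power_mono) auto
    also have "\<dots> = A\<^sup>2 * exp (2/s - 2 * M) / (s ^ N)\<^sup>2"
    proof -
      have "(exp (1/s) * exp (- M))\<^sup>2 = exp (2/s - 2 * M)"
        by (simp add: power2_eq_square flip: exp_add)
      then show ?thesis by (simp add: power_mult_distrib power_divide)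
    qed
    \<comment> \<open>Squaring the kernel estimate produces \<open>2/s - 2 * M\<close>, the
      combination that \<open>ex\<close> bounds; the additive constant \<open>2 * \<epsilon>\<close>
      passes into \<open>C\<close>.\<close>
    also have "\<dots> \<le> A\<^sup>2 * exp (psi z + psi w + 2 * \<epsilon> - \<epsilon> * d_psi z w) / (a ^ N * b ^ N)"
      using sN ab ex by (intro frac_le mult_left_mono) auto
    also have "exp (psi z + psi w + 2 * \<epsilon> - \<epsilon> * d_psi z w) = exp (2 * \<epsilon>) * (exp (psi z) * exp (psi w)) * exp (- \<epsilon> * d_psi z w)"
      by (simp flip: exp_add)
    finally show ?thesis by (simp add: a_def b_def)
  qed
  moreover have "\<epsilon> < sqrt 2" using \<epsilon>(2) by (rule less_trans) simp
  ultimately show ?thesis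
    unfolding N_def using A(1) \<epsilon>(1) by (intro exI[of _ "A\<^sup>2 * exp (2 * \<epsilon>)"] exI[of _ \<epsilon>] conjI ballI) auto
qed

end
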